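(* Let $G$ be the group of a prime knot and let $U\trianglelefteq G$ be a normal subgroup of finite index. Then there is a short exact sequence of groups $$1\longrightarrow M_U\longrightarrow U\longrightarrow \pi_1(E_{\mathcal G}G/U)\longrightarrow 1,$$ where $M_U$ is the normal subgroup of $U$ generated by those powers of the meridians of the knot that lie in $U$, and $M_U\to U$ is the inclusion.
   Context: All knots are tame. A knot $K\subseteq S^3$ is prime if it is nontrivial and is not a knot sum of two nontrivial knots. Let $V$ be an open tubular neighbourhood of $K$, $X=S^3\setminus V$ the knot exterior, and $G=\pi_1(X)$ the knot group. Write $EG$ for the universal cover of $X$ (a free contractible $G$-CW-complex) and $BG=X=EG/G$. Fix a meridian $a\in G$ (class of a simple closed curve on $\partial X$ that is null-homologous in $\overline V$ but not in $\partial V$, with linking number $1$ with $K$) and the corresponding longitude $l$ (class of a simple closed curve on $\partial X$ meeting the meridian once, homologous to $K$ in $\overline V$ and null-homologous in $X$). The peripheral subgroup is $H=\langle a,l\rangle\cong\mathbb Z^2$. The meridians of the knot are the conjugates in $G$ of $a^{\pm1}$. A family of subgroups of $G$ is a set of subgroups closed under conjugation and taking subgroups. Let $\mathcal G=\{\langle g^{-1}a^ig\rangle\mid g\in G,\ i\in\mathbb Z\}$ be the family generated by $\langle a\rangle$. A model for the classifying space $E_{\mathcal G}G$ is a $G$-CW-complex $Z$ such that for every subgroup $C\le G$ the fixed-point set $Z^C$ is contractible if $C\in\mathcal G$ and empty otherwise. Model used: $E_{\mathcal G}G$ is the $3$-dimensional $G$-CW-complex obtained from $EG$ as follows. The boundary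 of $EG$ is a disjoint union of planes indexed by $G/H$, permuted by $G$ with $H$ the stabiliser of one of them. Let $H$ act on $\mathbb R^2$ freely by integer translations, and on $\mathbb R$ with $l$ acting by unit translation and $a$ acting trivially; let $\pi\colon\mathbb R^2\to\mathbb R$ be the ($H$-equivariant) projection and $Cyl(\pi)$ its mapping cylinder. Then $E_{\mathcal G}G$ is obtained by gluing $G$-equivariantly $G\times_H Cyl(\pi)=\bigsqcup_{G/H}Cyl(\pi)$ to $EG$, each copy being glued along its copy of $\mathbb R^2$ to one boundary plane of $EG$. *)

theory Defs
  imports "HOL-Analysis.Analysis" "HOL-Algebra.Group_Action" "HOL-Homology.Homology"
begin

section \<open>Fundamental group of an abstract topological space\<close>

definition loops_at :: "'a topology \<Rightarrow> 'a \<Rightarrow> (real \<Rightarrow> 'a) set" where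
  "loops_at X x = {c. pathin X c \<and> c 0 = x \<and> c 1 = x}"

definition loop_class :: "'a topology \<Rightarrow> 'a \<Rightarrow> (real \<Rightarrow> 'a) \<Rightarrow> (real \<Rightarrow> 'a) set" where
  "loop_class X x c =
     {d \<in> loops_at X x. homotopic_with (\<lambda>r. r 0 = x \<and> r 1 = x) (top_of_set {0..1}) X c d}"

text \<open>The same formula as the library's \<open>+++\<close>, which is restricted to types of class
  \<open>topological_space\<close> and so cannot be used for spaces of equivalence classes.\<close>

definition concat_loops :: "(real \<Rightarrow> 'a) \<Rightarrow> (real \<Rightarrow> 'a) \<Rightarrow> real \<Rightarrow> 'a" where
  "concat_loops c d = (\<lambda>t. if t \<le> 1/2 then c (2 * t) else d (2 * t - 1))"

definition fundamental_group :: "'a topology \<Rightarrow> 'a \<Rightarrow> (real \<Rightarrow> 'a) set monoid" where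
  "fundamental_group X x =
     \<lparr>carrier = loop_class X x ` loops_at X x,
      mult = (\<lambda>A B. \<Union>c\<in>A. \<Union>d\<in>B. loop_class X x (concat_loops c d)),
      one = loop_class X x (\<lambda>_. x)\<rparr>"


section \<open>Quotients, gluings and orbit spaces of abstract topological spaces\<close>

text \<open>Equivalence relation on the points of \<open>X\<close> generated by the pairs in \<open>S\<close>.\<close>

definition identify_equiv :: "'a topology \<Rightarrow> 'a rel \<Rightarrow> 'a rel" where
  "identify_equiv X S = (S \<union> S\<inverse>)\<^sup>* \<inter> (topspace X \<times> topspace X)"

text \<open>Quotient topology; a set of classes is open iff the union of the classes is open in \<open>X\<close>.\<close>

definition identification_space :: "'a topology \<Rightarrow> 'a rel \<Rightarrow> 'a set topology" where
  "identification_space X S =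
     topology (\<lambda>W. W \<subseteq> topspace X // identify_equiv X S \<and> openin X (\<Union>W))"

lemma equiv_identify_equiv: "equiv (topspace X) (identify_equiv X S)"
proof (rule equivI)
  show "identify_equiv X S \<subseteq> topspace X \<times> topspace X"
    by (auto simp: identify_equiv_def)
  show "refl_on (topspace X) (identify_equiv X S)"
    by (auto simp: identify_equiv_def refl_on_def)
  have "sym ((S \<union> S\<inverse>)\<^sup>*)"
    by (rule sym_rtrancl) (auto simp: sym_def)
  then show "sym (identify_equiv X S)"
    unfolding identify_equiv_def sym_def by blast
  show "trans (identify_equiv X S)"
    unfolding identify_equiv_def trans_def by (blast intro: rtrancl_trans)
qed

lemma istopology_identification_space:
  "istopology (\<lambda>W. W \<subseteq> topspace X // identify_equiv X S \<and> openin X (\<Union>W))"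
proof -
  let ?r = "identify_equiv X S"
  have "\<Union>(V \<inter> W) = \<Union>V \<inter> \<Union>W" if "V \<subseteq> topspace X // ?r" "W \<subseteq> topspace X // ?r" for V W
    using that quotient_disj[OF equiv_identify_equiv[of X S]] by blast
  moreover have "openin X (\<Union>(\<Union>\<K>))" if "\<And>W. W \<in> \<K> \<Longrightarrow> openin X (\<Union>W)" for \<K>
  proof -
    have "\<Union>(\<Union>\<K>) = (\<Union>W\<in>\<K>. \<Union>W)" by blast
    with that show ?thesis by (metis (mono_tags, lifting) imageE openin_Union)
  qed
  ultimately show ?thesis
    unfolding istopology_def by (auto simp: openin_Int)
qed

lemma openin_identification_space:
  "openin (identification_space X S) W \<longleftrightarrow>
     W \<subseteq> topspace X // identify_equiv X S \<and> openin X (\<Union>W)"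
  unfolding identification_space_def
  by (simp add: topology_inverse'[OF istopology_identification_space])

definition disjoint_sum :: "'a topology \<Rightarrow> 'b topology \<Rightarrow> ('a + 'b) topology" where
  "disjoint_sum X Y = topology (\<lambda>W. openin X (Inl -` W) \<and> openin Y (Inr -` W))"

lemma openin_disjoint_sum:
  "openin (disjoint_sum X Y) W \<longleftrightarrow> openin X (Inl -` W) \<and> openin Y (Inr -` W)"
proof -
  have "istopology (\<lambda>W. openin X (Inl -` W) \<and> openin Y (Inr -` W))"
    unfolding istopology_def by (auto simp: vimage_Union)
  then show ?thesis
    unfolding disjoint_sum_def by (simp add: topology_inverse')
qed

text \<open>The union of \<open>X\<close> and \<open>Y\<close>, glued by identifying \<open>x\<close> with \<open>y\<close> whenever \<open>(x, y) \<in> S\<close>.\<close>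

definition glue_rel :: "('a \<times> 'b) set \<Rightarrow> ('a + 'b) rel" where
  "glue_rel S = {(Inl x, Inr y) |x y. (x, y) \<in> S}"

definition glue :: "'a topology \<Rightarrow> 'b topology \<Rightarrow> ('a \<times> 'b) set \<Rightarrow> ('a + 'b) set topology" where
  "glue X Y S = identification_space (disjoint_sum X Y) (glue_rel S)"

definition cyl_rel :: "'a topology \<Rightarrow> ('a \<Rightarrow> 'b) \<Rightarrow> (('a \<times> real) \<times> 'b) set" where
  "cyl_rel X f = {((x, 1), f x) |x. x \<in> topspace X}"

definition mapping_cylinder ::
    "'a topology \<Rightarrow> 'b topology \<Rightarrow> ('a \<Rightarrow> 'b) \<Rightarrow> (('a \<times> real) + 'b) set topology" where
  "mapping_cylinder X Y f = glue (prod_topology X (top_of_set {0..1})) Y (cyl_rel X f)"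

text \<open>The free end, a copy of \<open>X\<close>, of the mapping cylinder.\<close>

definition cyl_end ::
    "'a topology \<Rightarrow> 'b topology \<Rightarrow> ('a \<Rightarrow> 'b) \<Rightarrow> 'a \<Rightarrow> (('a \<times> real) + 'b) set" where
  "cyl_end X Y f x =
     identify_equiv (disjoint_sum (prod_topology X (top_of_set {0..1})) Y) (glue_rel (cyl_rel X f))
       `` {Inl (x, 0)}"

text \<open>\<open>G \<times>\<^sub>H Y\<close>, for a discrete group \<open>G\<close> and a left action \<open>\<sigma>\<close> of the subgroup \<open>H\<close> on \<open>Y\<close>.\<close>

definition balanced_rel ::
    "('g, 'm) monoid_scheme \<Rightarrow> 'g set \<Rightarrow> ('g \<Rightarrow> 'y \<Rightarrow> 'y) \<Rightarrow> 'y topology \<Rightarrow> ('g \<times> 'y) rel" where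
  "balanced_rel G H \<sigma> Y =
     {((g \<otimes>\<^bsub>G\<^esub> h, y), (g, \<sigma> h y)) |g h y. g \<in> carrier G \<and> h \<in> H \<and> y \<in> topspace Y}"

definition balanced_product ::
    "('g, 'm) monoid_scheme \<Rightarrow> 'g set \<Rightarrow> ('g \<Rightarrow> 'y \<Rightarrow> 'y) \<Rightarrow> 'y topology \<Rightarrow> ('g \<times> 'y) set topology"
  where
  "balanced_product G H \<sigma> Y =
     identification_space (prod_topology (discrete_topology (carrier G)) Y) (balanced_rel G H \<sigma> Y)"

definition balanced_pair ::
    "('g, 'm) monoid_scheme \<Rightarrow> 'g set \<Rightarrow> ('g \<Rightarrow> 'y \<Rightarrow> 'y) \<Rightarrow> 'y topology \<Rightarrow> 'g \<Rightarrow> 'y \<Rightarrow> ('g \<times> 'y) set"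
  where
  "balanced_pair G H \<sigma> Y g y =
     identify_equiv (prod_topology (discrete_topology (carrier G)) Y) (balanced_rel G H \<sigma> Y)
       `` {(g, y)}"

definition orbit_space :: "'z topology \<Rightarrow> 'g set \<Rightarrow> ('g \<Rightarrow> 'z \<Rightarrow> 'z) \<Rightarrow> 'z set topology" where
  "orbit_space Z U \<alpha> = identification_space Z {(z, \<alpha> u z) |u z. u \<in> U \<and> z \<in> topspace Z}"


section \<open>Tame knots in the 3-sphere\<close>

abbreviation S3 :: "(real^4) set" where
  "S3 \<equiv> sphere 0 1"

text \<open>The embedding \<open>T\<close> is required on a solid torus strictly larger than the closure of \<open>V\<close>;
  this makes the frontier torus of \<open>V\<close> bicollared (hence \<open>S3 - V\<close> a manifold with boundary).\<close>

definition tubular_neighbourhood :: "(real^4) set \<Rightarrow> (real^4) set \<Rightarrow> bool" where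
  "tubular_neighbourhood K V \<longleftrightarrow>
     (\<exists>T :: complex \<times> complex \<Rightarrow> real^4.
        continuous_on (sphere 0 1 \<times> cball 0 2) T \<and> inj_on T (sphere 0 1 \<times> cball 0 2) \<and>
        T ` (sphere 0 1 \<times> cball 0 2) \<subseteq> S3 \<and>
        T ` (sphere 0 1 \<times> {0}) = K \<and> T ` (sphere 0 1 \<times> ball 0 1) = V)"

text \<open>A tame knot is an embedded circle which can be thickened to an embedded solid torus.\<close>

definition knot :: "(real^4) set \<Rightarrow> bool" where
  "knot K \<longleftrightarrow> (\<exists>V. tubular_neighbourhood K V)"

text \<open>Equivalence of knots is ambient isotopy.\<close>

definition knot_equivalent :: "(real^4) set \<Rightarrow> (real^4) set \<Rightarrow> bool" where
  "knot_equivalent K K' \<longleftrightarrow>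
     (\<exists>h. homotopic_with_canon (\<lambda>f. \<exists>g. homeomorphism S3 S3 f g) S3 S3 id h \<and> h ` K = K')"

definition nontrivial_knot :: "(real^4) set \<Rightarrow> bool" where
  "nontrivial_knot K \<longleftrightarrow> knot K \<and> \<not> knot_equivalent K {x \<in> S3. x$3 = 0 \<and> x$4 = 0}"

text \<open>\<open>K\<close> is a knot sum of \<open>K1\<close> and \<open>K2\<close>: a bicollared 2-sphere meets \<open>K\<close> transversally (along
  two fibres of the bicollar) in two points, and the two arcs into which it cuts \<open>K\<close>, each closed
  up by the same arc \<open>c\<close> on the sphere, are equivalent to \<open>K1\<close> and \<open>K2\<close>.  Knots are unoriented,
  so this is the sum for some choice of orientations of the summands.\<close>

definition knot_sum :: "(real^4) set \<Rightarrow> (real^4) set \<Rightarrow> (real^4) set \<Rightarrow> bool" where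
  "knot_sum K K1 K2 \<longleftrightarrow>
     (\<exists>(\<Sigma> :: (real^3) \<times> real \<Rightarrow> real^4) v w A1 A2 c.
        continuous_on (sphere 0 1 \<times> {-1..1}) \<Sigma> \<and> inj_on \<Sigma> (sphere 0 1 \<times> {-1..1}) \<and>
        \<Sigma> ` (sphere 0 1 \<times> {-1..1}) \<subseteq> S3 \<and>
        v \<in> sphere 0 1 \<and> w \<in> sphere 0 1 \<and> v \<noteq> w \<and>
        K \<inter> \<Sigma> ` (sphere 0 1 \<times> {-1..1}) = \<Sigma> ` ({v, w} \<times> {-1..1}) \<and>
        A1 \<noteq> A2 \<and> components (S3 - \<Sigma> ` (sphere 0 1 \<times> {0})) = {A1, A2} \<and>
        arc c \<and> path_image c \<subseteq> \<Sigma> ` (sphere 0 1 \<times> {0}) \<and>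
        pathstart c = \<Sigma> (v, 0) \<and> pathfinish c = \<Sigma> (w, 0) \<and>
        knot_equivalent ((K \<inter> A1) \<union> path_image c) K1 \<and>
        knot_equivalent ((K \<inter> A2) \<union> path_image c) K2)"

definition prime_knot :: "(real^4) set \<Rightarrow> bool" where
  "prime_knot K \<longleftrightarrow> nontrivial_knot K \<and>
     \<not> (\<exists>K1 K2. nontrivial_knot K1 \<and> nontrivial_knot K2 \<and> knot_sum K K1 K2)"

definition knot_exterior :: "(real^4) set \<Rightarrow> (real^4) set" where
  "knot_exterior V = S3 - V"

definition boundary_torus :: "(real^4) set \<Rightarrow> (real^4) set" where
  "boundary_torus V = closure V - V"

abbreviation knot_group :: "(real^4) set \<Rightarrow> real^4 \<Rightarrow> (real \<Rightarrow> real^4) set monoid" where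
  "knot_group V x0 \<equiv> fundamental_group (top_of_set (knot_exterior V)) x0"


section \<open>Meridians and longitudes\<close>

text \<open>A path as a singular 1-chain; the path parameter is the second barycentric coordinate.\<close>

definition loop_chain :: "(real \<Rightarrow> 'a) \<Rightarrow> 'a chain" where
  "loop_chain c = frag_of (restrict (\<lambda>x. c (x 1)) (standard_simplex 1))"

definition null_homologous :: "('a::topological_space) set \<Rightarrow> (real \<Rightarrow> 'a) \<Rightarrow> bool" where
  "null_homologous S c \<longleftrightarrow> singular_relboundary 1 (top_of_set S) {} (loop_chain c)"

definition homologous_loops ::
    "('a::topological_space) set \<Rightarrow> (real \<Rightarrow> 'a) \<Rightarrow> (real \<Rightarrow> 'a) \<Rightarrow> bool" where
  "homologous_loops S c d \<longleftrightarrow> homologous_rel 1 (top_of_set S) {} (loop_chain c) (loop_chain d)"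

text \<open>The first homology of \<open>S3 - K\<close> is infinite cyclic, and an orientation of \<open>K\<close> (in the oriented
  3-sphere) amounts to one of the two isomorphisms \<open>\<theta>\<close> to the integers; the linking number of a
  closed curve with \<open>K\<close> is the image of its class.\<close>

definition linking_orientation ::
    "(real^4) set \<Rightarrow> ((real^4) chain set \<Rightarrow> int) \<Rightarrow> bool" where
  "linking_orientation K \<theta> \<longleftrightarrow> \<theta> \<in> iso (homology_group 1 (top_of_set (S3 - K))) integer_group"

definition linking_number ::
    "(real^4) set \<Rightarrow> ((real^4) chain set \<Rightarrow> int) \<Rightarrow> (real \<Rightarrow> real^4) \<Rightarrow> int" where
  "linking_number K \<theta> c = \<theta> (homologous_rel_set 1 (top_of_set (S3 - K)) {} (loop_chain c))"

definition simple_closed_at :: "('a::topological_space) \<Rightarrow> (real \<Rightarrow> 'a) \<Rightarrow> bool" where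
  "simple_closed_at x c \<longleftrightarrow> simple_path c \<and> pathstart c = x \<and> pathfinish c = x"

definition meridian_curve ::
    "(real^4) set \<Rightarrow> (real^4) set \<Rightarrow> ((real^4) chain set \<Rightarrow> int) \<Rightarrow> real^4 \<Rightarrow> (real \<Rightarrow> real^4) \<Rightarrow> bool"
  where
  "meridian_curve K V \<theta> x0 c \<longleftrightarrow>
     simple_closed_at x0 c \<and> path_image c \<subseteq> boundary_torus V \<and>
     null_homologous (closure V) c \<and> \<not> null_homologous (boundary_torus V) c \<and>
     linking_number K \<theta> c = 1"

definition longitude_curve ::
    "(real^4) set \<Rightarrow> (real^4) set \<Rightarrow> real^4 \<Rightarrow> (real \<Rightarrow> real^4) \<Rightarrow> (real \<Rightarrow> real^4) \<Rightarrow> bool" where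
  "longitude_curve K V x0 \<mu> c \<longleftrightarrow>
     simple_closed_at x0 c \<and> path_image c \<subseteq> boundary_torus V \<and>
     path_image \<mu> \<inter> path_image c = {x0} \<and>
     (\<exists>k y. simple_closed_at y k \<and> path_image k = K \<and> homologous_loops (closure V) c k) \<and>
     null_homologous (knot_exterior V) c"

definition meridians :: "('g, 'm) monoid_scheme \<Rightarrow> 'g \<Rightarrow> 'g set" where
  "meridians G a = {inv\<^bsub>G\<^esub> g \<otimes>\<^bsub>G\<^esub> b \<otimes>\<^bsub>G\<^esub> g |g b. g \<in> carrier G \<and> b \<in> {a, inv\<^bsub>G\<^esub> a}}"

definition meridian_powers :: "('g, 'm) monoid_scheme \<Rightarrow> 'g \<Rightarrow> 'g set" where
  "meridian_powers G a = {b [^]\<^bsub>G\<^esub> (i::int) |b i. b \<in> meridians G a}"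

definition normal_closure :: "('g, 'm) monoid_scheme \<Rightarrow> 'g set \<Rightarrow> 'g set" where
  "normal_closure K S = (\<lambda>N. N \<lhd> K) hull S"


section \<open>The universal cover of the exterior and the classifying space\<close>

definition universal_cover ::
    "('e::topological_space) set \<Rightarrow> ('e \<Rightarrow> 'b::topological_space) \<Rightarrow> 'b set \<Rightarrow> bool" where
  "universal_cover E p X \<longleftrightarrow> covering_space E p X \<and> simply_connected E"

text \<open>The left action of the fundamental group of \<open>X\<close> at \<open>p e0\<close> on \<open>E\<close> by deck transformations:
  the class of a loop moves \<open>e0\<close> to the end point of the lift of the loop that starts at \<open>e0\<close>.\<close>

definition deck_action ::
    "('e::topological_space) set \<Rightarrow> ('e \<Rightarrow> 'b::topological_space) \<Rightarrow> 'b set \<Rightarrow> 'e \<Rightarrow>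
     ((real \<Rightarrow> 'b) set \<Rightarrow> 'e \<Rightarrow> 'e) \<Rightarrow> bool" where
  "deck_action E p X e0 act \<longleftrightarrow>
     group_action (fundamental_group (top_of_set X) (p e0)) E act \<and>
     (\<forall>g \<in> carrier (fundamental_group (top_of_set X) (p e0)).
        continuous_on E (act g) \<and> (\<forall>e\<in>E. p (act g e) = p e)) \<and>
     (\<forall>c. path c \<and> path_image c \<subseteq> E \<and> pathstart c = e0 \<and> p (pathfinish c) = p e0 \<longrightarrow>
        act (loop_class (top_of_set X) (p e0) (p \<circ> c)) e0 = pathfinish c)"

text \<open>An \<open>H\<close>-equivariant identification of the plane with the component of the boundary of \<open>E\<close>
  through \<open>e0\<close>, where \<open>a\<^sup>i l\<^sup>j\<close> acts on the plane by translation by \<open>(i, j)\<close>.\<close>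

definition boundary_chart ::
    "('g, 'm) monoid_scheme \<Rightarrow> 'g \<Rightarrow> 'g \<Rightarrow> ('e::topological_space) set \<Rightarrow> ('g \<Rightarrow> 'e \<Rightarrow> 'e) \<Rightarrow>
     (real \<times> real \<Rightarrow> 'e) \<Rightarrow> bool" where
  "boundary_chart G a l P act \<phi> \<longleftrightarrow>
     (\<exists>\<psi>. homeomorphism UNIV P \<phi> \<psi>) \<and>
     (\<forall>(i::int) (j::int) s t.
        \<phi> (s + of_int i, t + of_int j) = act (a [^]\<^bsub>G\<^esub> i \<otimes>\<^bsub>G\<^esub> l [^]\<^bsub>G\<^esub> j) (\<phi> (s, t)))"

text \<open>The mapping cylinder of the projection of the plane to the line.\<close>

abbreviation plane_cylinder :: "(((real \<times> real) \<times> real) + real) set topology" where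
  "plane_cylinder \<equiv> mapping_cylinder (euclidean :: (real \<times> real) topology) (euclidean :: real topology) snd"

definition peripheral_coords :: "('g, 'm) monoid_scheme \<Rightarrow> 'g \<Rightarrow> 'g \<Rightarrow> 'g \<Rightarrow> int \<times> int" where
  "peripheral_coords G a l h = (THE ij. h = a [^]\<^bsub>G\<^esub> fst ij \<otimes>\<^bsub>G\<^esub> l [^]\<^bsub>G\<^esub> snd ij)"

text \<open>Points of \<open>plane_cylinder\<close> are equivalence classes, so a transformation acts by taking images;
  likewise in \<open>egg_action\<close> below.\<close>

definition cylinder_action ::
    "('g, 'm) monoid_scheme \<Rightarrow> 'g \<Rightarrow> 'g \<Rightarrow> 'g \<Rightarrow>
     (((real \<times> real) \<times> real) + real) set \<Rightarrow> (((real \<times> real) \<times> real) + real) set" where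
  "cylinder_action G a l h =
     (let (i, j) = peripheral_coords G a l h in
      image (map_sum (\<lambda>((s, t), r). ((s + of_int i, t + of_int j), r)) (\<lambda>t. t + of_int j)))"

abbreviation peripheral_subgroup :: "('g, 'm) monoid_scheme \<Rightarrow> 'g \<Rightarrow> 'g \<Rightarrow> 'g set" where
  "peripheral_subgroup G a l \<equiv> generate G {a, l}"

text \<open>The union of \<open>E\<close> and \<open>G \<times>\<^sub>H Cyl(\<pi>)\<close>, glued \<open>G\<close>-equivariantly along the boundary planes of \<open>E\<close>.\<close>

definition egg_space ::
    "('g, 'm) monoid_scheme \<Rightarrow> 'g \<Rightarrow> 'g \<Rightarrow> ('e::topological_space) set \<Rightarrow> ('g \<Rightarrow> 'e \<Rightarrow> 'e) \<Rightarrow>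
     (real \<times> real \<Rightarrow> 'e) \<Rightarrow>
     (('g \<times> (((real \<times> real) \<times> real) + real) set) set + 'e) set topology" where
  "egg_space G a l E act \<phi> =
     glue (balanced_product G (peripheral_subgroup G a l) (cylinder_action G a l) plane_cylinder)
          (top_of_set E)
          {(balanced_pair G (peripheral_subgroup G a l) (cylinder_action G a l) plane_cylinder
              g (cyl_end euclidean euclidean snd v),
            act g (\<phi> v)) |g v. g \<in> carrier G}"

definition egg_action ::
    "('g, 'm) monoid_scheme \<Rightarrow> ('g \<Rightarrow> 'e \<Rightarrow> 'e) \<Rightarrow> 'g \<Rightarrow>
     (('g \<times> 'y) set + 'e) set \<Rightarrow> (('g \<times> 'y) set + 'e) set" where
  "egg_action G act g =
     image (map_sum (image (\<lambda>(k, y). (g \<otimes>\<^bsub>G\<^esub> k, y))) (act g))"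


section \<open>Short exact sequences\<close>

text \<open>The library's \<open>short_exact_sequence\<close> needs all groups to have the same type of elements.\<close>

definition short_exact ::
    "('a, 'm) monoid_scheme \<Rightarrow> ('b, 'n) monoid_scheme \<Rightarrow> ('c, 'k) monoid_scheme \<Rightarrow>
     ('a \<Rightarrow> 'b) \<Rightarrow> ('b \<Rightarrow> 'c) \<Rightarrow> bool" where
  "short_exact A B C f q \<longleftrightarrow>
     group A \<and> group B \<and> group C \<and> f \<in> mon A B \<and> q \<in> epi B C \<and> kernel B C q = f ` carrier A"

end

theory Submission
  imports Defs
begin

text \<open>Write \<open>Z\<close> for the model of the classifying space. The cylinders can be squeezed onto the boundary
  planes, so \<open>Z\<close> is simply connected because the universal cover \<open>E\<close> is. The deck transformations act
  freely on \<open>E\<close>, while the points of the added lines are fixed exactly by the conjugates of the powers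
  of \<open>a\<close>. As for every sufficiently nice action on a simply connected space, \<open>\<pi>\<^sub>1(Z/U)\<close> is the
  quotient of \<open>U\<close> by the normal subgroup generated by the elements with fixed points: \<open>u\<close> is sent to the
  image of a path from a base point to its translate by \<open>u\<close>; this is onto since paths in \<open>Z/U\<close> lift up
  to homotopy (small neighbourhoods of the line points have contractible images), it kills the elements
  with fixed points, and no others since \<open>Z/M \<rightarrow> Z/U\<close> is a covering.\<close>

section \<open>Homotopies of paths in general topological spaces\<close>

text \<open>The line points shape the proof. Their stabilisers in \<open>G\<close> are infinite, so
  the projection to the orbit space is no covering there, and paths lift only up to homotopy with
  fixed ends. Nor does a mapping cylinder come with a retraction onto its free end: forgetting
  \<open>s\<close> has to be undone by a section of the projection to the line, here
  \<open>s = 0\<close>. As \<open>a\<close> moves that axis, no section is equivariant under the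
  peripheral subgroup; hence one representative of each of its cosets is chosen and the squeezing is
  done in the coordinates of that representative. The resulting homotopy does not commute with
  \<open>G\<close>, which is harmless for simple connectedness. The contraction near a line point,
  in contrast, must pass to the orbit space; it leaves \<open>s\<close> alone, so that it commutes
  with translations by powers of \<open>a\<close>. Maps and homotopies are written in coordinates on
  a disjoint union of slabs and \<open>E\<close>; they descend because the product of a quotient map
  with the interval is again a quotient map. Since the points of \<open>Z\<close> are nested
  classes, without any metric, paths, homotopies and coverings are treated in arbitrary topological
  spaces.\<close>

lemma homotopic_paths_reparam:
  fixes p :: "real \<Rightarrow> 'a::topological_space"
  assumes p: "path p" "path_image p \<subseteq> S"
    and f: "path f" "path_image f \<subseteq> {0..1}" and g: "path g" "path_image g \<subseteq> {0..1}"
    and "pathstart f = pathstart g" "pathfinish f = pathfinish g"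
  shows "homotopic_paths S (p \<circ> f) (p \<circ> g)"
proof (rule homotopic_paths_continuous_image)
  \<comment> \<open>The interval is convex, so \<open>f\<close> and \<open>g\<close> are joined by a
    straight-line homotopy inside it, which \<open>p\<close> carries to \<open>S\<close>. The unit
    and inverse laws below arise by composing \<open>p\<close> with two piecewise linear paths in
    \<open>{0..1}\<close>.\<close>
  show "homotopic_paths {0..1} f g"
  proof (rule homotopic_paths_linear)
    fix t :: real assume t: "t \<in> {0..1}"
    then have "f t \<in> {0..1}" "g t \<in> {0..1}"
      using f(2) g(2) unfolding path_image_def by blast+
    then show "closed_segment (f t) (g t) \<subseteq> {0..1}"
      by (metis closed_segment_subset convex_real_interval(5))
  qed (use assms in auto)
  show "continuous_on {0..1} p" "p \<in> {0..1} \<rightarrow> S"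
    using p by (auto simp: path_def path_image_def)
qed

lemma path_constant [simp]: "path (\<lambda>_. a)"
  by (simp add: path_def)

lemma path_ends_const [simp]: "pathstart (\<lambda>_. a) = a" "pathfinish (\<lambda>_. a) = a"
  by (auto simp: pathstart_def pathfinish_def)

text \<open>Constant paths are written \<open>\<lambda>_. a\<close>, because
  \<open>linepath a a\<close> would require \<open>S\<close> to lie in a vector space;
  \<open>linepath\<close> occurs only inside the parameter interval.\<close>

lemma homotopic_paths_rid_const:
  assumes "path p" "path_image p \<subseteq> S" "pathfinish p = a"
  shows "homotopic_paths S (p +++ (\<lambda>_. a)) p"
proof -
  have "homotopic_paths S (p \<circ> (linepath 0 1 +++ linepath 1 1)) (p \<circ> linepath 0 1)"
    using assms
    by (intro homotopic_paths_reparam subset_path_image_join) (auto simp: closed_segment_eq_real_ivl)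
  moreover have "p \<circ> (linepath 0 1 +++ linepath 1 1) = p +++ (\<lambda>_. a)" "p \<circ> linepath 0 1 = p"
    using assms by (auto simp: fun_eq_iff joinpaths_def linepath_def pathfinish_def)
  ultimately show ?thesis by simp
qed

lemma homotopic_paths_lid_const:
  assumes "path p" "path_image p \<subseteq> S" "pathstart p = a"
  shows "homotopic_paths S ((\<lambda>_. a) +++ p) p"
proof -
  have "homotopic_paths S (p \<circ> (linepath 0 0 +++ linepath 0 1)) (p \<circ> linepath 0 1)"
    using assms
    by (intro homotopic_paths_reparam subset_path_image_join) (auto simp: closed_segment_eq_real_ivl)
  moreover have "p \<circ> (linepath 0 0 +++ linepath 0 1) = (\<lambda>_. a) +++ p" "p \<circ> linepath 0 1 = p"
    using assms by (auto simp: fun_eq_iff joinpaths_def linepath_def pathstart_def)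
  ultimately show ?thesis by simp
qed

lemma homotopic_paths_rinv_const:
  assumes "path p" "path_image p \<subseteq> S"
  shows "homotopic_paths S (p +++ reversepath p) (\<lambda>_. pathstart p)"
proof -
  have "homotopic_paths S (p \<circ> (linepath 0 1 +++ linepath 1 0)) (p \<circ> linepath 0 0)"
    using assms
    by (intro homotopic_paths_reparam subset_path_image_join) (auto simp: closed_segment_eq_real_ivl)
  moreover have "p \<circ> (linepath 0 1 +++ linepath 1 0) = p +++ reversepath p"
    "p \<circ> linepath 0 0 = (\<lambda>_. pathstart p)"
    by (auto simp: fun_eq_iff joinpaths_def linepath_def pathstart_def reversepath_def algebra_simps)
  ultimately show ?thesis by simp
qed

lemma homotopic_paths_linv_const:
  assumes "path p" "path_image p \<subseteq> S"
  shows "homotopic_paths S (reversepath p +++ p) (\<lambda>_. pathfinish p)"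
  using homotopic_paths_rinv_const[of "reversepath p" S] assms by simp

text \<open>Insert the reverse of \<open>q\<close> followed by \<open>q\<close> after
  \<open>p\<close>, re-bracket, and cancel \<open>p\<close> against the reverse of
  \<open>q\<close>.\<close>

lemma homotopic_paths_if_loop_null:
  assumes "path p" "path_image p \<subseteq> S" "path q" "path_image q \<subseteq> S"
    and "pathstart p = pathstart q" "pathfinish p = pathfinish q"
    and null: "homotopic_paths S (p +++ reversepath q) (\<lambda>_. pathstart p)"
  shows "homotopic_paths S p q"
proof -
  note [simp] = assms(1-6)
  have "homotopic_paths S p (p +++ (\<lambda>_. pathfinish q))"
    by (simp add: homotopic_paths_rid_const homotopic_paths_sym)
  also have "homotopic_paths S \<dots> (p +++ (reversepath q +++ q))"
    by (intro homotopic_paths_join homotopic_paths_sym[OF homotopic_paths_linv_const]) auto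
  also have "homotopic_paths S \<dots> ((p +++ reversepath q) +++ q)"
    by (intro homotopic_paths_assoc) auto
  also have "homotopic_paths S \<dots> ((\<lambda>_. pathstart p) +++ q)"
    by (intro homotopic_paths_join null) auto
  also have "homotopic_paths S \<dots> q"
    by (intro homotopic_paths_lid_const) auto
  finally show ?thesis .
qed

text \<open>The square of a free homotopy is convex, so its bottom edge is homotopic to the path along the
  other three edges; two of these are mapped to a path and its reverse, the third to a constant.\<close>

lemma homotopic_loops_const_imp_paths:
  assumes "homotopic_loops S p (\<lambda>_. a)"
  shows "homotopic_paths S p (\<lambda>_. pathstart p)"
proof -
  let ?I = "{0..1::real}"
  obtain h where conth: "continuous_on (?I \<times> ?I) h" and hs: "h \<in> ?I \<times> ?I \<rightarrow> S"
    and h0: "\<And>x. x \<in> ?I \<Longrightarrow> h (0, x) = p x" and h1: "\<And>x. x \<in> ?I \<Longrightarrow> h (1, x) = a"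
    and ends: "\<And>t. t \<in> ?I \<Longrightarrow> h (t, 1) = h (t, 0)"
    using assms unfolding homotopic_loops pathstart_def pathfinish_def o_def by metis
  \<comment> \<open>The track of the base point during the free homotopy.\<close>
  define L where "L = h \<circ> linepath (0, 0) (1, 0)"
  have seg: "closed_segment x y \<subseteq> ?I \<times> ?I" if "x \<in> ?I \<times> ?I" "y \<in> ?I \<times> ?I" for x y
    using that by (intro closed_segment_subset convex_Times) auto
  have *: "linepath x y t \<in> ?I \<times> ?I" if "x \<in> ?I \<times> ?I" "y \<in> ?I \<times> ?I" "t \<in> ?I" for x y t
    using seg[OF that(1,2)] linepath_in_path[OF that(3)] by blast
  have pathL: "path L" "path_image L \<subseteq> S"
  proof -
    show "path L" unfolding L_def
      by (intro path_continuous_image continuous_on_subset[OF conth]) (use seg[of "(0,0)" "(1,0)"] in auto)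
    have "linepath (0, 0) (1, 0) t \<in> ?I \<times> ?I" if "t \<in> ?I" for t
      by (intro *) (use that in auto)
    then show "path_image L \<subseteq> S"
      using hs unfolding path_image_def L_def by (auto simp del: mem_Times_iff)
  qed
  have 1: "homotopic_paths S (h \<circ> linepath (0, 0) (0, 1))
      (h \<circ> (linepath (0, 0) (1, 0) +++ (linepath (1, 0) (1, 1) +++ linepath (1, 1) (0, 1))))"
  proof (rule homotopic_paths_continuous_image[OF _ conth hs])
    show "homotopic_paths (?I \<times> ?I) (linepath (0, 0) (0, 1))
      (linepath (0, 0) (1, 0) +++ (linepath (1, 0) (1, 1) +++ linepath (1, 1) (0, 1)))"
    proof (rule homotopic_paths_linear)
      fix t :: real assume "t \<in> ?I"
      then show "closed_segment (linepath (0, 0) (0, 1) t)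
        ((linepath (0, 0) (1, 0) +++ (linepath (1, 0) (1, 1) +++ linepath (1, 1) (0, 1))) t) \<subseteq> ?I \<times> ?I"
        unfolding joinpaths_def by (intro seg *) (auto intro!: *)
    qed auto
  qed
  have eq0: "h (linepath (0, 0) (0, 1) x) = p x" if "x \<in> ?I" for x
    using h0[OF that] by (simp add: linepath_def)
  have 2: "homotopic_paths S p (h \<circ> linepath (0, 0) (0, 1))"
    using eq0 homotopic_loops_imp_path[OF assms] homotopic_loops_imp_subset[OF assms]
    by (intro homotopic_paths_eq) auto
  have h1': "homotopic_paths S (h \<circ> linepath (1, 0) (1, 1)) (\<lambda>_. a)"
  proof (rule homotopic_paths_sym, rule homotopic_paths_eq)
    show "a = (h \<circ> linepath (1, 0) (1, 1)) t" if "t \<in> ?I" for t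
      using h1[OF that] by (simp add: linepath_def)
    show "path_image (\<lambda>_. a) \<subseteq> S"
      using homotopic_loops_imp_subset[OF assms] by auto
  qed auto
  have rev: "homotopic_paths S (h \<circ> linepath (1, 1) (0, 1)) (reversepath L)"
  proof (rule homotopic_paths_sym, rule homotopic_paths_eq)
    show "reversepath L t = (h \<circ> linepath (1, 1) (0, 1)) t" if "t \<in> ?I" for t
      using ends[of "1 - t"] that by (simp add: linepath_def L_def reversepath_def)
  qed (use pathL in auto)
  have ends': "pathfinish L = a" "pathstart L = pathstart p"
    using h0[of 0] h1[of 0] by (auto simp: L_def pathstart_def pathfinish_def linepath_def)
  have "homotopic_paths S p (L +++ ((h \<circ> linepath (1, 0) (1, 1)) +++ (h \<circ> linepath (1, 1) (0, 1))))"
    using homotopic_paths_trans[OF 2 1] by (simp add: path_compose_join L_def)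
  also have "homotopic_paths S \<dots> (L +++ ((\<lambda>_. a) +++ reversepath L))"
    using ends' pathL ends[of 0] ends[of 1] h1[of 0] h1[of 1]
    by (intro homotopic_paths_join h1' rev)
       (auto simp: L_def pathstart_def pathfinish_def linepath_def joinpaths_def)
  also have "homotopic_paths S \<dots> (L +++ reversepath L)"
    using ends' pathL by (intro homotopic_paths_join homotopic_paths_lid_const) auto
  also have "homotopic_paths S \<dots> (\<lambda>_. pathstart L)"
    using pathL by (rule homotopic_paths_rinv_const)
  finally show ?thesis using ends' by simp
qed

lemma homotopic_paths_if_loop_freely_null:
  assumes "path p" "path_image p \<subseteq> S" "path q" "path_image q \<subseteq> S"
    and "pathstart p = pathstart q" "pathfinish p = pathfinish q"
    and "homotopic_loops S (p +++ reversepath q) (\<lambda>_. a)"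
  shows "homotopic_paths S p q"
proof (rule homotopic_paths_if_loop_null)
  show "homotopic_paths S (p +++ reversepath q) (\<lambda>_. pathstart p)"
    using homotopic_loops_const_imp_paths[OF assms(7)] by simp
qed (use assms(1-6) in auto)

lemma simply_connected_imp_homotopic_paths:
  assumes "simply_connected S" "path p" "path_image p \<subseteq> S" "path q" "path_image q \<subseteq> S"
    and "pathstart p = pathstart q" "pathfinish p = pathfinish q"
  shows "homotopic_paths S p q"
proof (rule homotopic_paths_if_loop_freely_null)
  have "pathstart p \<in> S" using assms(3) pathstart_in_path_image by blast
  then show "homotopic_loops S (p +++ reversepath q) (\<lambda>_. pathstart p)"
    using assms
    by (intro assms(1)[unfolded simply_connected_def, rule_format] conjI subset_path_image_join) auto
qed (use assms in auto)

text \<open>\<open>simply_connected\<close> speaks of any two loops, also of constant loops at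
  different points; the track of the base point under a free homotopy between two constants is a
  path joining them.\<close>

lemma simply_connected_imp_path_connected_gen:
  assumes "simply_connected S"
  shows "path_connected S"
  unfolding path_connected_def
proof (intro ballI)
  fix x y assume "x \<in> S" "y \<in> S"
  then have "homotopic_loops S (\<lambda>_. x) (\<lambda>_. y)"
    by (intro assms[unfolded simply_connected_def, rule_format]) auto
  then obtain h where conth: "continuous_on ({0..1::real} \<times> {0..1::real}) h"
    and h: "h \<in> {0..1} \<times> {0..1} \<rightarrow> S" "h (0, 0) = x" "h (1, 0) = y"
    unfolding homotopic_loops by (metis atLeastAtMost_iff le_numeral_extra(1,3,4))
  have "path (\<lambda>t. h (t, 0))"
    unfolding path_def
    by (intro continuous_on_compose2[OF conth] continuous_intros) auto
  then show "\<exists>g. path g \<and> path_image g \<subseteq> S \<and> pathstart g = x \<and> pathfinish g = y"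
    using h(2,3) funcset_mem[OF h(1)]
    by (intro exI[of _ "\<lambda>t. h (t, 0)"] conjI) (auto simp: path_image_def pathstart_def pathfinish_def)
qed

lemma homotopic_loops_compose:
  assumes "homotopic_with_canon (\<lambda>_. True) W S f g" "path c" "path_image c \<subseteq> W" "pathfinish c = pathstart c"
  shows "homotopic_loops S (f \<circ> c) (g \<circ> c)"
  unfolding homotopic_loops_def
  by (rule homotopic_with_compose_continuous_map_right[OF assms(1)])
     (use assms in \<open>auto simp: path_def path_image_def pathstart_def pathfinish_def continuous_map_in_subtopology\<close>)

text \<open>Every loop of \<open>Z\<close> is freely homotopic to its image under
  \<open>j \<circ> R\<close>, and \<open>R\<close> takes any two loops to freely homotopic loops of
  \<open>E\<close>. Thus simple connectedness passes from \<open>E\<close> to a space that it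
  dominates.\<close>

lemma simply_connected_if_retracts_up_to_homotopy:
  assumes E: "simply_connected E" and R: "continuous_on Z R" "R \<in> Z \<rightarrow> E"
    and j: "continuous_on E j" "j \<in> E \<rightarrow> Z"
    and hom: "homotopic_with_canon (\<lambda>_. True) Z Z id (j \<circ> R)"
  shows "simply_connected Z"
  unfolding simply_connected_def
proof (intro allI impI, elim conjE)
  fix p q assume p: "path p" "pathfinish p = pathstart p" "path_image p \<subseteq> Z"
    and q: "path q" "pathfinish q = pathstart q" "path_image q \<subseteq> Z"
  have RE: "path (R \<circ> c)" "path_image (R \<circ> c) \<subseteq> E" if "path c" "path_image c \<subseteq> Z" for c
    using that R by (auto simp: path_continuous_image continuous_on_subset path_image_compose)
  have "homotopic_loops E (R \<circ> p) (R \<circ> q)"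
    using RE p q by (intro E[unfolded simply_connected_def, rule_format])
      (auto simp: pathstart_compose pathfinish_compose)
  then have "homotopic_loops Z (j \<circ> (R \<circ> p)) (j \<circ> (R \<circ> q))"
    using j by (rule homotopic_loops_continuous_image)
  moreover have "homotopic_loops Z p (j \<circ> (R \<circ> p))" "homotopic_loops Z q (j \<circ> (R \<circ> q))"
    using homotopic_loops_compose[OF hom] p q by (simp_all add: o_assoc)
  ultimately show "homotopic_loops Z p q"
    by (meson homotopic_loops_sym homotopic_loops_trans)
qed

text \<open>The set \<open>W\<close> contracts inside \<open>S\<close>, not necessarily within
  itself: the loop along \<open>p\<close> and back along \<open>q\<close> is then freely
  null-homotopic in \<open>S\<close>.\<close>

lemma null_homotopic_imp_homotopic_paths:
  assumes hom: "homotopic_with_canon (\<lambda>_. True) W S id (\<lambda>_. a)"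
    and p: "path p" "path_image p \<subseteq> W" and q: "path q" "path_image q \<subseteq> W"
    and ends: "pathstart p = pathstart q" "pathfinish p = pathfinish q"
  shows "homotopic_paths S p q"
proof (rule homotopic_paths_if_loop_freely_null)
  have "W \<subseteq> S" using homotopic_with_imp_subset1[OF hom] by auto
  then show "path_image p \<subseteq> S" "path_image q \<subseteq> S" using p q by auto
  show "homotopic_loops S (p +++ reversepath q) (\<lambda>_. a)"
    using homotopic_loops_compose[OF hom, of "p +++ reversepath q"] p q ends
    by (simp add: subset_path_image_join o_def)
qed (use p q ends in auto)

section \<open>Lifting through coverings\<close>

text \<open>One evenly covered neighbourhood of the common image provides a sheet around each point.
  Sheets coincide or are disjoint, which takes the place of a Hausdorff condition on
  \<open>C\<close>; the case \<open>y = x\<close> gives local injectivity of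
  \<open>p\<close>.\<close>

lemma covering_space_sheet:
  assumes "covering_space C p S" "x \<in> C" "y \<in> C" "p y = p x"
  obtains u v where "openin (top_of_set C) u" "x \<in> u" "openin (top_of_set C) v" "y \<in> v"
    "inj_on p u" "u = v \<or> u \<inter> v = {}"
proof -
  have "p x \<in> S" using assms(1,2) by (auto simp: covering_space_def)
  then obtain T V where T: "p x \<in> T" and V: "\<Union>V = C \<inter> p -` T" "\<forall>u\<in>V. openin (top_of_set C) u"
    "pairwise disjnt V" "\<forall>u\<in>V. \<exists>q. homeomorphism u T p q"
    using assms(1) unfolding covering_space_def by metis
  have "x \<in> \<Union>V" "y \<in> \<Union>V" using T assms V(1) by auto
  then obtain u v where uv: "u \<in> V" "v \<in> V" "x \<in> u" "y \<in> v" by auto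
  moreover have "inj_on p u" using V(4) uv(1) by (metis homeomorphism_def inj_on_inverseI)
  moreover have "u = v \<or> u \<inter> v = {}" using V(3) uv by (metis pairwiseD disjnt_def)
  ultimately show ?thesis using V(2) by (intro that[of u v]) auto
qed

text \<open>Near any point both lifts stay in one sheet each. If they agree somewhere there, the two
  sheets coincide and injectivity of \<open>p\<close> forces agreement throughout, so agreement
  spreads along the connected set \<open>T\<close>.\<close>

lemma covering_space_lift_unique_connected:
  assumes cov: "covering_space C p S" and T: "connected T"
    and f: "continuous_on T f" "f \<in> T \<rightarrow> C" and g: "continuous_on T g" "g \<in> T \<rightarrow> C"
    and eq: "\<And>x. x \<in> T \<Longrightarrow> p (f x) = p (g x)"
    and ab: "a \<in> T" "b \<in> T" "f a = g a"
  shows "f b = g b"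
proof (rule connected_induction_simple[OF T ab(1,2), where P = "\<lambda>x. f x = g x"])
  fix x assume x: "x \<in> T"
  then have "f x \<in> C" "g x \<in> C" "p (g x) = p (f x)" using f g eq by auto
  then obtain u v where uv: "openin (top_of_set C) u" "f x \<in> u" "openin (top_of_set C) v" "g x \<in> v"
    "inj_on p u" "u = v \<or> u \<inter> v = {}"
    using covering_space_sheet[OF cov, of "f x" "g x"] by metis
  let ?N = "(T \<inter> f -` u) \<inter> (T \<inter> g -` v)"
  have "openin (top_of_set T) ?N"
    using uv f g by (intro openin_Int continuous_openin_preimage[where T = C]) auto
  moreover have "f z = g z" if "y \<in> ?N" "z \<in> ?N" "f y = g y" for y z
  proof -
    have "u = v" using that uv(6) by auto
    then show ?thesis using that inj_onD[OF uv(5) eq[of z]] by auto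
  qed
  ultimately show "\<exists>N. openin (top_of_set T) N \<and> x \<in> N \<and> (\<forall>y\<in>N. \<forall>z\<in>N. f y = g y \<longrightarrow> f z = g z)"
    using x uv by (intro exI[of _ ?N]) auto
qed (rule ab)

text \<open>Lifts are constructed over small rectangles and glued along common edges by two applications
  of the bisection principle.\<close>

lemma covering_space_lift_square:
  fixes H :: "real \<times> real \<Rightarrow> 'b::topological_space" and p :: "'a::topological_space \<Rightarrow> 'b"
  assumes cov: "covering_space C p S"
    and H: "continuous_on ({0..1} \<times> {0..1}) H" "H \<in> {0..1} \<times> {0..1} \<rightarrow> S"
    and a: "a \<in> C" "p a = H (0, 0)"
  obtains L where "continuous_on ({0..1} \<times> {0..1}) L" "L \<in> {0..1} \<times> {0..1} \<rightarrow> C"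
    "\<And>x. x \<in> {0..1} \<times> {0..1} \<Longrightarrow> p (L x) = H x" "L (0, 0) = a"
proof -
  let ?I = "{0..1::real}"
  \<comment> \<open>A lift is required through every point over every point of \<open>R\<close>, not
    only over a corner, so that rectangles can be joined in either order.\<close>
  define Sec where "Sec R \<longleftrightarrow> (\<forall>x\<in>R. \<forall>c\<in>C. p c = H x \<longrightarrow>
      (\<exists>L. continuous_on R L \<and> L \<in> R \<rightarrow> C \<and> (\<forall>y\<in>R. p (L y) = H y) \<and> L x = c))" for R
  have glue_aux: "\<exists>L. continuous_on (R1 \<union> R2) L \<and> L \<in> R1 \<union> R2 \<rightarrow> C \<and> (\<forall>y\<in>R1 \<union> R2. p (L y) = H y) \<and> L x = c"
    if R: "Sec R1" "Sec R2" "closed R1" "closed R2" "connected (R1 \<inter> R2)" "x0 \<in> R1 \<inter> R2"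
      and xc: "x \<in> R1" "c \<in> C" "p c = H x" for R1 R2 x0 x c
  proof -
    obtain L1 where L1: "continuous_on R1 L1" "L1 \<in> R1 \<rightarrow> C" "\<And>y. y \<in> R1 \<Longrightarrow> p (L1 y) = H y" "L1 x = c"
      using R(1) xc unfolding Sec_def by metis
    have "L1 x0 \<in> C" "p (L1 x0) = H x0" using R(6) L1 by auto
    then obtain L2 where L2: "continuous_on R2 L2" "L2 \<in> R2 \<rightarrow> C" "\<And>y. y \<in> R2 \<Longrightarrow> p (L2 y) = H y"
      "L2 x0 = L1 x0"
      using R(2,6) unfolding Sec_def by (metis IntD2)
    \<comment> \<open>The lifts agree at \<open>x0\<close>, hence on the whole connected overlap; as
      both parts are closed, the union of the two lifts is continuous.\<close>
    have eq: "L1 y = L2 y" if "y \<in> R1 \<inter> R2" for y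
      using L1 L2 R(6) that
      by (intro covering_space_lift_unique_connected[OF cov R(5), of L1 L2 x0 y])
         (auto intro: continuous_on_subset)
    show ?thesis
    proof (intro exI[of _ "\<lambda>y. if y \<in> R1 then L1 y else L2 y"] conjI)
      show "continuous_on (R1 \<union> R2) (\<lambda>y. if y \<in> R1 then L1 y else L2 y)"
        using R L1 L2 eq by (intro continuous_on_cases) auto
    qed (use L1 L2 xc in auto)
  qed
  have glue: "Sec (R1 \<union> R2)"
    if R: "Sec R1" "Sec R2" "closed R1" "closed R2" "connected (R1 \<inter> R2)" "x0 \<in> R1 \<inter> R2" for R1 R2 x0
    unfolding Sec_def
  proof (intro ballI impI)
    fix x c assume x: "x \<in> R1 \<union> R2" and c: "c \<in> C" "p c = H x"
    show "\<exists>L. continuous_on (R1 \<union> R2) L \<and> L \<in> R1 \<union> R2 \<rightarrow> C \<and> (\<forall>y\<in>R1 \<union> R2. p (L y) = H y) \<and> L x = c"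
    proof (cases "x \<in> R1")
      case True then show ?thesis using glue_aux[OF R] c by blast
    next
      case False then show ?thesis
        using glue_aux[of R2 R1 x0 x c] R x c by (simp add: Un_commute Int_commute)
    qed
  qed
  \<comment> \<open>A set small enough to be mapped into one evenly covered \<open>T\<close> is
    lifted by the inverse of the sheet that contains the prescribed point.\<close>
  have local: "\<exists>e>0. \<forall>R. R \<subseteq> ?I \<times> ?I \<and> R \<subseteq> ball z e \<longrightarrow> Sec R" if z: "z \<in> ?I \<times> ?I" for z
  proof -
    have "H z \<in> S" using H z by auto
    then obtain T V where T: "H z \<in> T" "openin (top_of_set S) T" and V: "\<Union>V = C \<inter> p -` T"
      "\<forall>u\<in>V. \<exists>q. homeomorphism u T p q"
      using cov unfolding covering_space_def by metis
    have "openin (top_of_set (?I \<times> ?I)) (?I \<times> ?I \<inter> H -` T)"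
      using H T by (intro continuous_openin_preimage[where T = S]) auto
    moreover have "z \<in> ?I \<times> ?I \<inter> H -` T" using z T(1) by simp
    ultimately obtain e where e: "e > 0" "ball z e \<inter> (?I \<times> ?I) \<subseteq> ?I \<times> ?I \<inter> H -` T"
      unfolding openin_contains_ball by metis
    have "Sec R" if R: "R \<subseteq> ?I \<times> ?I" "R \<subseteq> ball z e" for R
      unfolding Sec_def
    proof (intro ballI impI)
      fix x c assume x: "x \<in> R" "c \<in> C" "p c = H x"
      have HR: "H y \<in> T" if "y \<in> R" for y
      proof -
        have "y \<in> ball z e \<inter> (?I \<times> ?I)" using that R by blast
        then show ?thesis using e(2) by blast
      qed
      have "c \<in> \<Union>V" using x HR V by auto
      then obtain u q where u: "u \<in> V" "c \<in> u" and q: "homeomorphism u T p q" using V(2) by blast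
      have "u \<subseteq> C" using u V(1) by auto
      show "\<exists>L. continuous_on R L \<and> L \<in> R \<rightarrow> C \<and> (\<forall>y\<in>R. p (L y) = H y) \<and> L x = c"
      proof (intro exI[of _ "q \<circ> H"] conjI)
        show "continuous_on R (q \<circ> H)"
        proof (rule continuous_on_compose)
          show "continuous_on R H" using R H(1) continuous_on_subset by blast
          have "H ` R \<subseteq> T" using HR by auto
          moreover have "continuous_on T q" using q by (simp add: homeomorphism_def)
          ultimately show "continuous_on (H ` R) q" by (rule continuous_on_subset[rotated])
        qed
        show "q \<circ> H \<in> R \<rightarrow> C" using HR q \<open>u \<subseteq> C\<close> by (auto simp: homeomorphism_def)
        show "\<forall>y\<in>R. p ((q \<circ> H) y) = H y" using HR q by (auto simp: homeomorphism_def)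
        show "(q \<circ> H) x = c" using x u q by (simp add: homeomorphism_def flip: x(3))
      qed
    qed
    then show ?thesis using e by auto
  qed
  \<comment> \<open>For fixed \<open>s\<close> the second coordinate is bisected; each gluing takes
    the minimum of the two admissible widths \<open>\<delta>\<close>. The later bisection in the
    first coordinate then glues whole strips.\<close>
  have strip: "\<exists>\<delta>>0. \<forall>a b. 0 \<le> a \<and> a \<le> s \<and> s \<le> b \<and> b \<le> 1 \<and> b - a < \<delta> \<longrightarrow> Sec ({a..b} \<times> ?I)"
    if s: "s \<in> ?I" for s
  proof -
    define Q where "Q c d \<longleftrightarrow> (0 \<le> c \<and> d \<le> 1 \<longrightarrow>
        (\<exists>\<delta>>0. \<forall>a b. 0 \<le> a \<and> a \<le> s \<and> s \<le> b \<and> b \<le> 1 \<and> b - a < \<delta> \<longrightarrow> Sec ({a..b} \<times> {c..d})))" for c d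
    have "(0::real) \<le> 1" by simp
    then have "Q 0 1"
    proof (induction rule: Bolzano)
      case (trans c d e)
      show ?case unfolding Q_def
      proof
        assume ce: "0 \<le> c \<and> e \<le> 1"
        obtain \<delta>1 where d1: "\<delta>1 > 0" "\<And>a b. 0 \<le> a \<and> a \<le> s \<and> s \<le> b \<and> b \<le> 1 \<and> b - a < \<delta>1 \<Longrightarrow> Sec ({a..b} \<times> {c..d})"
          using trans ce unfolding Q_def by force
        obtain \<delta>2 where d2: "\<delta>2 > 0" "\<And>a b. 0 \<le> a \<and> a \<le> s \<and> s \<le> b \<and> b \<le> 1 \<and> b - a < \<delta>2 \<Longrightarrow> Sec ({a..b} \<times> {d..e})"
          using trans ce unfolding Q_def by force
        have "Sec ({a..b} \<times> {c..e})" if ab: "0 \<le> a" "a \<le> s" "s \<le> b" "b \<le> 1" "b - a < min \<delta>1 \<delta>2" for a b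
        proof -
          have un: "{a..b} \<times> {c..e} = ({a..b} \<times> {c..d}) \<union> ({a..b} \<times> {d..e})" using trans(3,4) by auto
          have int: "({a..b} \<times> {c..d}) \<inter> ({a..b} \<times> {d..e}) = {a..b} \<times> {d}" using trans(3,4) by auto
          show ?thesis unfolding un
            by (rule glue[of _ _ "(s, d)"])
               (use d1 d2 ab trans(3,4) in \<open>auto simp: int intro: closed_Times connected_Times\<close>)
        qed
        then show "\<exists>\<delta>>0. \<forall>a b. 0 \<le> a \<and> a \<le> s \<and> s \<le> b \<and> b \<le> 1 \<and> b - a < \<delta> \<longrightarrow> Sec ({a..b} \<times> {c..e})"
          using d1(1) d2(1) by (intro exI[of _ "min \<delta>1 \<delta>2"]) auto
      qed
    next
      case (local t)
      obtain e where e: "e > 0" "\<And>R. R \<subseteq> ?I \<times> ?I \<Longrightarrow> R \<subseteq> ball (s, t) e \<Longrightarrow> Sec R"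
        using \<open>\<And>z. z \<in> ?I \<times> ?I \<Longrightarrow> _\<close>[of "(s, t)"] s local by auto
      \<comment> \<open>The distance is at most the sum of the two coordinate deviations, whence the
        bound \<open>e / 2\<close> for each.\<close>
      have "{a..b} \<times> {c..d} \<subseteq> ball (s, t) e"
        if "a \<le> s" "s \<le> b" "b - a < e / 2" "c \<le> t" "t \<le> d" "d - c < e / 2" for a b c d
      proof
        fix x assume "x \<in> {a..b} \<times> {c..d}"
        then have "a \<le> fst x" "fst x \<le> b" "c \<le> snd x" "snd x \<le> d" by auto
        then have "\<bar>fst x - s\<bar> < e / 2" "\<bar>snd x - t\<bar> < e / 2" using that by linarith+
        moreover have "dist x (s, t) \<le> \<bar>fst x - s\<bar> + \<bar>snd x - t\<bar>"
          by (cases x) (simp add: dist_Pair_Pair dist_real_def sqrt_sum_squares_le_sum_abs)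
        ultimately show "x \<in> ball (s, t) e" by (simp add: dist_commute)
      qed
      moreover have "{a..b} \<times> {c..d} \<subseteq> ?I \<times> ?I" if "0 \<le> a" "b \<le> 1" "0 \<le> c" "d \<le> 1" for a b c d :: real
        using that by auto
      ultimately show ?case
        unfolding Q_def using e
        by (intro exI[of _ "e / 2"] conjI allI impI) auto
    qed
    then show ?thesis by (simp add: Q_def)
  qed
  define P where "P a b \<longleftrightarrow> (0 \<le> a \<and> b \<le> 1 \<longrightarrow> Sec ({a..b} \<times> ?I))" for a b
  have "(0::real) \<le> 1" by simp
  then have "P 0 1"
  proof (induction rule: Bolzano)
    case (trans a b c)
    show ?case unfolding P_def
    proof
      assume ac: "0 \<le> a \<and> c \<le> 1"
      have un: "{a..c} \<times> ?I = ({a..b} \<times> ?I) \<union> ({b..c} \<times> ?I)" using trans(3,4) by auto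
      have int: "({a..b} \<times> ?I) \<inter> ({b..c} \<times> ?I) = {b} \<times> ?I" using trans(3,4) by auto
      show "Sec ({a..c} \<times> ?I)" unfolding un
        by (rule glue[of _ _ "(b, 0)"])
           (use trans ac in \<open>auto simp: P_def int intro: closed_Times connected_Times\<close>)
    qed
  next
    case (local s)
    obtain \<delta> where "\<delta> > 0" "\<And>a b. 0 \<le> a \<and> a \<le> s \<and> s \<le> b \<and> b \<le> 1 \<and> b - a < \<delta> \<Longrightarrow> Sec ({a..b} \<times> ?I)"
      using strip[of s] local by auto
    then show ?case unfolding P_def by (intro exI[of _ \<delta>]) auto
  qed
  then have "Sec (?I \<times> ?I)" by (simp add: P_def)
  then show ?thesis
    using that a unfolding Sec_def by (metis atLeastAtMost_iff le_numeral_extra(1,3) mem_Sigma_iff)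
qed

text \<open>The path is spread over the square, constant in the first coordinate, and its lift is
  read off along the edge of points \<open>(0, t)\<close>.\<close>

lemma covering_space_path_lift:
  assumes cov: "covering_space C p S" and g: "path g" "path_image g \<subseteq> S" and a: "a \<in> C" "p a = pathstart g"
  obtains h where "path h" "path_image h \<subseteq> C" "pathstart h = a" "\<And>t. t \<in> {0..1} \<Longrightarrow> p (h t) = g t"
proof -
  have g': "continuous_on ({0..1} \<times> {0..1}) (\<lambda>x :: real \<times> real. g (snd x))"
    "(\<lambda>x. g (snd x)) \<in> {0..1} \<times> {0..1} \<rightarrow> S"
    using g by (auto intro!: continuous_on_compose2[OF g(1)[unfolded path_def]] continuous_intros
        simp: path_image_def)
  have a': "p a = g (snd (0::real, 0))" using a by (simp add: pathstart_def)
  obtain L where L: "continuous_on ({0..1::real} \<times> {0..1::real}) L" "L \<in> {0..1} \<times> {0..1} \<rightarrow> C"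
    "\<And>x. x \<in> {0..1} \<times> {0..1} \<Longrightarrow> p (L x) = g (snd x)" "L (0, 0) = a"
    using covering_space_lift_square[OF cov g' a(1) a'] by metis
  have "path (\<lambda>t. L (0, t))"
    unfolding path_def by (intro continuous_on_compose2[OF L(1)] continuous_intros) auto
  then show ?thesis
    using L(2-4) by (intro that[of "\<lambda>t. L (0, t)"]) (auto simp: path_image_def pathstart_def)
qed

text \<open>Lift the null-homotopy to the square. One edge carries \<open>h\<close> by uniqueness;
  the other three edges are mapped to the single point \<open>b\<close> below, so the lift is
  constant along them and joins the two ends of \<open>h\<close>.\<close>

lemma covering_space_null_homotopic_lift_closed:
  assumes cov: "covering_space C p S" and h: "path h" "path_image h \<subseteq> C"
    and null: "homotopic_paths S (p \<circ> h) (\<lambda>_. b)"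
  shows "pathfinish h = pathstart h"
proof -
  let ?I = "{0..1::real}"
  obtain H where H: "continuous_on (?I \<times> ?I) H" "H \<in> ?I \<times> ?I \<rightarrow> S"
    "\<And>x. x \<in> ?I \<Longrightarrow> H (0, x) = p (h x)" "\<And>x. x \<in> ?I \<Longrightarrow> H (1, x) = b"
    "\<And>t. t \<in> ?I \<Longrightarrow> H (t, 0) = p (h 0)" "\<And>t. t \<in> ?I \<Longrightarrow> H (t, 1) = p (h 1)"
    using null unfolding homotopic_paths pathstart_def pathfinish_def o_def by metis
  have pb: "p (h 0) = b" "p (h 1) = b" using H(4,5,6)[of 1] H(4)[of 0] by auto
  have hC: "h t \<in> C" if "t \<in> ?I" for t using h(2) that by (auto simp: path_image_def)
  have "p (h 0) = H (0, 0)" using H(5)[of 0] by simp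
  then obtain L where L: "continuous_on (?I \<times> ?I) L" "L \<in> ?I \<times> ?I \<rightarrow> C"
    "\<And>x. x \<in> ?I \<times> ?I \<Longrightarrow> p (L x) = H x" "L (0, 0) = h 0"
    using covering_space_lift_square[OF cov H(1,2) hC[of 0]] by auto
  have conn: "connected ?I" by simp
  note unique = covering_space_lift_unique_connected[OF cov conn]
  have cont: "continuous_on ?I (\<lambda>t. L (s, t))" "continuous_on ?I (\<lambda>t. L (t, s))" if "s \<in> ?I" for s
    using that by (auto intro!: continuous_on_compose2[OF L(1)] continuous_intros)
  have "L (0, 1) = h 1"
    using h L hC H(3) cont[of 0]
    by (intro unique[of "\<lambda>t. L (0, t)" h 0 1]) (auto simp: path_def)
  moreover have "L (1, 0) = h 0"
    using h L hC H(5) cont[of 0] by (intro unique[of "\<lambda>t. L (t, 0)" "\<lambda>_. h 0" 0 1]) auto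
  moreover have "L (1, 1) = h 0"
    using h L hC H(4) pb cont[of 1] \<open>L (1, 0) = h 0\<close>
    by (intro unique[of "\<lambda>t. L (1, t)" "\<lambda>_. h 0" 0 1]) auto
  moreover have "L (1, 1) = h 1"
    using h L hC H(6) cont[of 1] \<open>L (0, 1) = h 1\<close>
    by (intro unique[of "\<lambda>t. L (t, 1)" "\<lambda>_. h 1" 0 1]) auto
  ultimately show ?thesis by (simp add: pathstart_def pathfinish_def)
qed

text \<open>The initial pieces of \<open>c\<close> that lift up to homotopy are extended by
  connectedness of the parameter interval. Each extension starts at the end of the lift found so
  far, so the local hypothesis has to allow every point \<open>w\<close> over the start of the small
  path.\<close>

lemma path_lifting_up_to_homotopy:
  assumes f: "continuous_on A f" "f \<in> A \<rightarrow> B"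
    and local: "\<And>b. b \<in> B \<Longrightarrow> \<exists>W. openin (top_of_set B) W \<and> b \<in> W \<and>
      (\<forall>c w. path c \<and> path_image c \<subseteq> W \<and> w \<in> A \<and> f w = pathstart c \<longrightarrow>
        (\<exists>d. path d \<and> path_image d \<subseteq> A \<and> pathstart d = w \<and> homotopic_paths B (f \<circ> d) c))"
    and c: "path c" "path_image c \<subseteq> B" and w: "w \<in> A" "f w = pathstart c"
  obtains d where "path d" "path_image d \<subseteq> A" "pathstart d = w" "homotopic_paths B (f \<circ> d) c"
proof -
  define P where "P t \<longleftrightarrow> (\<exists>d. path d \<and> path_image d \<subseteq> A \<and> pathstart d = w \<and>
      homotopic_paths B (f \<circ> d) (c \<circ> linepath 0 t))" for t
  have "P 1"
  proof (rule connected_induction_simple[of "{0..1}" 0 1 P])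
    show "P 0" unfolding P_def
    proof (intro exI[of _ "\<lambda>_. w"] conjI)
      show "homotopic_paths B (f \<circ> (\<lambda>_. w)) (c \<circ> linepath 0 0)"
        using w c f by (auto simp: o_def pathstart_def)
    qed (use w in auto)
    fix a :: real assume a: "a \<in> {0..1}"
    then have "c a \<in> B" using c by (auto simp: path_image_def)
    from local[OF this] obtain W where W: "openin (top_of_set B) W" "c a \<in> W"
      and lift: "\<And>c w. path c \<Longrightarrow> path_image c \<subseteq> W \<Longrightarrow> w \<in> A \<Longrightarrow> f w = pathstart c \<Longrightarrow>
        \<exists>d. path d \<and> path_image d \<subseteq> A \<and> pathstart d = w \<and> homotopic_paths B (f \<circ> d) c"
      by metis
    have "openin (top_of_set {0..1}) ({0..1} \<inter> c -` W)"
      using c W by (intro continuous_openin_preimage[where T = B]) (auto simp: path_def path_image_def)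
    moreover have "a \<in> {0..1} \<inter> c -` W" using a W(2) by simp
    ultimately obtain e where e: "e > 0" "ball a e \<inter> {0..1} \<subseteq> {0..1} \<inter> c -` W"
      unfolding openin_contains_ball by metis
    \<comment> \<open>The parameter \<open>y\<close> may lie on either side of \<open>x\<close>. In
      the backward case the appended segment retraces \<open>c\<close>, and the detour is removed by
      reparametrisation.\<close>
    have step: "P y" if x: "x \<in> {0..1} \<inter> ball a e" and y: "y \<in> {0..1} \<inter> ball a e" and "P x" for x y
    proof -
      obtain d where d: "path d" "path_image d \<subseteq> A" "pathstart d = w"
        "homotopic_paths B (f \<circ> d) (c \<circ> linepath 0 x)"
        using \<open>P x\<close> unfolding P_def by auto
      have seg: "closed_segment u v \<subseteq> {0..1}" if "u \<in> {0..1}" "v \<in> {0..1}" for u v :: real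
        using that by (intro closed_segment_subset) auto
      have "closed_segment x y \<subseteq> {0..1} \<inter> ball a e"
        using x y by (intro closed_segment_subset convex_Int) auto
      then have "path_image (c \<circ> linepath x y) \<subseteq> W"
        using e(2) unfolding path_image_compose path_image_linepath by blast
      moreover have "path (c \<circ> linepath x y)"
        using c x y seg[of x y] by (intro path_continuous_image) (auto simp: path_def intro: continuous_on_subset)
      moreover have "pathfinish d \<in> A" using d pathfinish_in_path_image by blast
      moreover have fd: "f (pathfinish d) = c x"
        using homotopic_paths_imp_pathfinish[OF d(4)] by (simp add: pathfinish_def linepath_def)
      ultimately obtain d' where d': "path d'" "path_image d' \<subseteq> A" "pathstart d' = pathfinish d"
        "homotopic_paths B (f \<circ> d') (c \<circ> linepath x y)"
        using lift[of "c \<circ> linepath x y" "pathfinish d"] by (auto simp: pathstart_compose)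
      have "homotopic_paths B (f \<circ> (d +++ d')) ((c \<circ> linepath 0 x) +++ (c \<circ> linepath x y))"
        unfolding path_compose_join using d d' fd
        by (intro homotopic_paths_join) (auto simp: pathstart_compose pathfinish_compose)
      also have "homotopic_paths B \<dots> (c \<circ> linepath 0 y)"
        unfolding path_compose_join[symmetric] using c x y
        by (intro homotopic_paths_reparam subset_path_image_join) (simp_all add: seg)
      finally show ?thesis
        unfolding P_def using d d' by (intro exI[of _ "d +++ d'"]) (simp add: subset_path_image_join)
    qed
    show "\<exists>T. openin (top_of_set {0..1}) T \<and> a \<in> T \<and> (\<forall>x\<in>T. \<forall>y\<in>T. P x \<longrightarrow> P y)"
    proof (intro exI[of _ "{0..1} \<inter> ball a e"] conjI ballI impI)
      show "openin (top_of_set {0..1}) ({0..1} \<inter> ball a e)" by auto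
      show "a \<in> {0..1} \<inter> ball a e" using a e(1) by simp
    qed (rule step)
  qed simp_all
  moreover have "c \<circ> linepath 0 1 = c" by (auto simp: linepath_def)
  ultimately show ?thesis using that unfolding P_def by auto
qed

section \<open>Abstract topologies as subspaces of a type\<close>

text \<open>Tagging every point with a topology puts disjoint copies of all topologies on
  \<open>'a\<close> into one type. Open sets are those with open trace on each copy, as in a
  topological disjoint union.\<close>

datatype 'a pointed = Pointed "'a topology" (point: 'a)

instantiation pointed :: (type) topological_space
begin

definition open_pointed :: "'a pointed set \<Rightarrow> bool" where
  "open_pointed W \<longleftrightarrow> (\<forall>T. openin T {x \<in> topspace T. Pointed T x \<in> W})"

instance
proof
  show "open (UNIV :: 'a pointed set)" by (simp add: open_pointed_def)
next
  fix V W :: "'a pointed set" assume VW: "open V" "open W"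
  have "{x \<in> topspace T. Pointed T x \<in> V \<inter> W} =
      {x \<in> topspace T. Pointed T x \<in> V} \<inter> {x \<in> topspace T. Pointed T x \<in> W}" for T
    by auto
  then show "open (V \<inter> W)" using VW unfolding open_pointed_def by auto
next
  fix K :: "'a pointed set set" assume K: "\<forall>V\<in>K. open V"
  have "{x \<in> topspace T. Pointed T x \<in> \<Union>K} = \<Union>((\<lambda>V. {x \<in> topspace T. Pointed T x \<in> V}) ` K)" for T
    by auto
  then show "open (\<Union>K)" using K unfolding open_pointed_def by auto
qed

end

text \<open>Every abstract topology is the subspace topology of a set in a type of class
  \<open>topological_space\<close>, so that the library of paths and homotopies applies to it.\<close>

definition realise :: "'a topology \<Rightarrow> 'a pointed set" where
  "realise T = Pointed T ` topspace T"

lemma openin_realise: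
  "openin (top_of_set (realise T)) W \<longleftrightarrow> W \<subseteq> realise T \<and> openin T {x \<in> topspace T. Pointed T x \<in> W}"
proof
  assume "openin (top_of_set (realise T)) W"
  then obtain V where V: "open V" "W = realise T \<inter> V" by (auto simp: openin_open)
  have "{x \<in> topspace T. Pointed T x \<in> W} = {x \<in> topspace T. Pointed T x \<in> V}"
    using V by (auto simp: realise_def)
  then show "W \<subseteq> realise T \<and> openin T {x \<in> topspace T. Pointed T x \<in> W}"
    using V by (simp add: open_pointed_def)
next
  assume W: "W \<subseteq> realise T \<and> openin T {x \<in> topspace T. Pointed T x \<in> W}"
  have "openin T' {x \<in> topspace T'. Pointed T' x \<in> W}" for T'
  proof (cases "T' = T")
    \<comment> \<open>Copies with different tags are disjoint, so the trace on any other copy is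
      empty.\<close>
    case False
    then have "{x \<in> topspace T'. Pointed T' x \<in> W} = {}" using W by (auto simp: realise_def)
    then show ?thesis by (simp only: openin_empty)
  qed (use W in simp)
  then have "open W" by (simp add: open_pointed_def)
  then show "openin (top_of_set (realise T)) W" using W by (auto simp: openin_open)
qed

lemma Pointed_in_realise [simp]: "Pointed T x \<in> realise T \<longleftrightarrow> x \<in> topspace T"
  by (auto simp: realise_def)

lemma point_realise: "x \<in> realise T \<Longrightarrow> point x \<in> topspace T \<and> Pointed T (point x) = x"
  by (auto simp: realise_def)

lemma homeomorphic_maps_Pointed: "homeomorphic_maps T (top_of_set (realise T)) (Pointed T) point"
proof -
  have "{x \<in> realise T. point x \<in> W} = Pointed T ` W" "Pointed T ` W \<subseteq> realise T"
    "{x \<in> topspace T. Pointed T x \<in> Pointed T ` W} = W" if "W \<subseteq> topspace T" for W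
    using that by (auto simp: realise_def image_iff)
  then show ?thesis
    unfolding homeomorphic_maps_def continuous_map_def
    by (auto simp: openin_realise point_realise openin_subset simp del: vimage_Collect_eq)
qed

lemma continuous_map_Pointed: "continuous_map T (top_of_set (realise T)) (Pointed T)"
  and continuous_map_point: "continuous_map (top_of_set (realise T)) T point"
  using homeomorphic_maps_Pointed[of T] by (auto simp: homeomorphic_maps_def)

lemma continuous_map_Pointed_iff:
  "continuous_map X (top_of_set (realise T)) (Pointed T \<circ> f) \<longleftrightarrow> continuous_map X T f"
proof
  assume "continuous_map X (top_of_set (realise T)) (Pointed T \<circ> f)"
  from continuous_map_compose[OF this continuous_map_point] show "continuous_map X T f"
    by (simp add: o_def)
qed (rule continuous_map_compose[OF _ continuous_map_Pointed])

definition realise_map :: "'b topology \<Rightarrow> ('a \<Rightarrow> 'b) \<Rightarrow> 'a pointed \<Rightarrow> 'b pointed" where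
  "realise_map Y f x = Pointed Y (f (point x))"

lemma realise_map_Pointed [simp]: "realise_map Y f (Pointed X x) = Pointed Y (f x)"
  by (simp add: realise_map_def)

lemma realise_map_comp_Pointed: "realise_map Y f \<circ> (Pointed X \<circ> c) = Pointed Y \<circ> (f \<circ> c)"
  by (auto simp: fun_eq_iff)

lemma continuous_on_realise_map:
  assumes "continuous_map X Y f"
  shows "continuous_on (realise X) (realise_map Y f)" "realise_map Y f \<in> realise X \<rightarrow> realise Y"
proof -
  have "continuous_map (top_of_set (realise X)) (top_of_set (realise Y)) (Pointed Y \<circ> (f \<circ> point))"
    unfolding continuous_map_Pointed_iff
    by (rule continuous_map_compose[OF continuous_map_point assms])
  moreover have "Pointed Y \<circ> (f \<circ> point) = realise_map Y f" by (auto simp: realise_map_def)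
  ultimately show "continuous_on (realise X) (realise_map Y f)" "realise_map Y f \<in> realise X \<rightarrow> realise Y"
    by (auto simp: continuous_map_subtopology_eu)
qed

lemma pathin_realise: "pathin T c \<longleftrightarrow> path (Pointed T \<circ> c) \<and> path_image (Pointed T \<circ> c) \<subseteq> realise T"
  unfolding pathin_def path_def path_image_def continuous_map_Pointed_iff[symmetric, of _ T c]
  by (simp add: continuous_map_in_subtopology image_subset_iff_funcset o_def)

abbreviation path_homotopic :: "'a topology \<Rightarrow> (real \<Rightarrow> 'a) \<Rightarrow> (real \<Rightarrow> 'a) \<Rightarrow> bool" where
  "path_homotopic T c d \<equiv> homotopic_paths (realise T) (Pointed T \<circ> c) (Pointed T \<circ> d)"

text \<open>This links the relation used in \<open>loop_class\<close> to
  \<open>homotopic_paths\<close>; composing with \<open>Pointed T\<close> and with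
  \<open>point\<close> translates homotopies in both directions.\<close>

lemma path_homotopic_iff:
  assumes "c 0 = x" "c 1 = y"
  shows "path_homotopic T c d \<longleftrightarrow> homotopic_with (\<lambda>r. r 0 = x \<and> r 1 = y) (top_of_set {0..1}) T c d"
proof
  assume "path_homotopic T c d"
  then have "homotopic_with (\<lambda>r. r 0 = x \<and> r 1 = y) (top_of_set {0..1}) T
      (point \<circ> (Pointed T \<circ> c)) (point \<circ> (Pointed T \<circ> d))"
    unfolding homotopic_paths_def
    by (rule homotopic_with_compose_continuous_map_left[OF _ continuous_map_point])
       (auto simp: pathstart_def pathfinish_def assms)
  then show "homotopic_with (\<lambda>r. r 0 = x \<and> r 1 = y) (top_of_set {0..1}) T c d"
    by (simp add: o_def)
next
  assume "homotopic_with (\<lambda>r. r 0 = x \<and> r 1 = y) (top_of_set {0..1}) T c d"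
  then show "path_homotopic T c d"
    unfolding homotopic_paths_def
    by (rule homotopic_with_compose_continuous_map_left[OF _ continuous_map_Pointed])
       (auto simp: pathstart_def pathfinish_def assms)
qed

lemma Pointed_concat_loops: "Pointed T \<circ> concat_loops c d = (Pointed T \<circ> c) +++ (Pointed T \<circ> d)"
  by (auto simp: concat_loops_def joinpaths_def)

section \<open>Identification spaces and orbit spaces\<close>

definition ident_class :: "'a topology \<Rightarrow> 'a rel \<Rightarrow> 'a \<Rightarrow> 'a set" where
  "ident_class X S x = identify_equiv X S `` {x}"

lemma topspace_identification_space: "topspace (identification_space X S) = topspace X // identify_equiv X S"
proof (rule antisym)
  show "topspace (identification_space X S) \<subseteq> topspace X // identify_equiv X S"
    using openin_topspace[of "identification_space X S"] unfolding openin_identification_space by blast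
  have "openin (identification_space X S) (topspace X // identify_equiv X S)"
    by (simp add: openin_identification_space Union_quotient[OF equiv_identify_equiv])
  then show "topspace X // identify_equiv X S \<subseteq> topspace (identification_space X S)"
    by (rule openin_subset)
qed

lemma ident_class_eq_iff:
  "x \<in> topspace X \<Longrightarrow> y \<in> topspace X \<Longrightarrow> ident_class X S x = ident_class X S y \<longleftrightarrow> (x, y) \<in> identify_equiv X S"
  unfolding ident_class_def by (rule eq_equiv_class_iff[OF equiv_identify_equiv])

text \<open>A set of classes is open when its union is, and this union is precisely the preimage
  under the projection.\<close>

lemma quotient_map_ident_class: "quotient_map X (identification_space X S) (ident_class X S)"
  unfolding quotient_map_def topspace_identification_space
proof (intro conjI allI impI)
  show "ident_class X S ` topspace X = topspace X // identify_equiv X S"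
    by (auto simp: quotient_def ident_class_def)
  fix W assume W: "W \<subseteq> topspace X // identify_equiv X S"
  have "{x \<in> topspace X. ident_class X S x \<in> W} = \<Union>W"
  proof (intro equalityI subsetI)
    fix x assume "x \<in> {x \<in> topspace X. ident_class X S x \<in> W}"
    then show "x \<in> \<Union>W"
      using equiv_class_self[OF equiv_identify_equiv, of x X S] by (auto simp: ident_class_def)
  next
    fix x assume "x \<in> \<Union>W"
    then obtain C where C: "C \<in> W" "x \<in> C" by auto
    then obtain y where y: "C = identify_equiv X S `` {y}" "y \<in> topspace X"
      using W by (auto simp: quotient_def)
    then have "(y, x) \<in> identify_equiv X S" "x \<in> topspace X"
      using C by (auto simp: identify_equiv_def)
    then have "ident_class X S x = C"
      unfolding y(1) ident_class_def by (metis equiv_class_eq equiv_identify_equiv)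
    then show "x \<in> {x \<in> topspace X. ident_class X S x \<in> W}" using C \<open>x \<in> topspace X\<close> by auto
  qed
  then show "openin X {x \<in> topspace X. ident_class X S x \<in> W} = openin (identification_space X S) W"
    using W by (simp add: openin_identification_space)
qed

lemma ident_class_eqI:
  "(x, y) \<in> S \<Longrightarrow> x \<in> topspace X \<Longrightarrow> y \<in> topspace X \<Longrightarrow> ident_class X S x = ident_class X S y"
  by (auto simp: ident_class_eq_iff identify_equiv_def)

text \<open>Two points of one class are joined by a chain of generating pairs and their converses,
  so invariance is checked on the generators.\<close>

lemma ident_class_invariant:
  assumes inv: "\<And>x y. (x, y) \<in> S \<Longrightarrow> f x = f y"
    and "ident_class X S x = ident_class X S y" "x \<in> topspace X" "y \<in> topspace X"
  shows "f x = f y"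
proof -
  have "(x, y) \<in> (S \<union> S\<inverse>)\<^sup>*"
    using assms by (simp add: ident_class_eq_iff identify_equiv_def)
  then show ?thesis
  proof induction
    case (step y z)
    then show ?case using inv[of y z] inv[of z y] by auto
  qed simp
qed

text \<open>Actions on spaces of classes are given by images, and this turns the image of a class
  into the class of the image. Preservation of the generators by \<open>b\<close> gives one
  inclusion; the other pulls back along the inverse \<open>b'\<close>, which has to preserve them as
  well.\<close>

lemma image_ident_class:
  assumes S: "\<And>x y. (x, y) \<in> S \<Longrightarrow> (b x, b y) \<in> S" "\<And>x y. (x, y) \<in> S \<Longrightarrow> (b' x, b' y) \<in> S"
    and X: "\<And>x. x \<in> topspace X \<Longrightarrow> b x \<in> topspace X" "\<And>x. x \<in> topspace X \<Longrightarrow> b' x \<in> topspace X"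
    and inverse: "\<And>x. x \<in> topspace X \<Longrightarrow> b' (b x) = x" "\<And>x. x \<in> topspace X \<Longrightarrow> b (b' x) = x"
    and x: "x \<in> topspace X"
  shows "b ` ident_class X S x = ident_class X S (b x)"
proof -
  have *: "(f y, f z) \<in> identify_equiv X S"
    if yz: "(y, z) \<in> identify_equiv X S" and f: "\<And>x y. (x, y) \<in> S \<Longrightarrow> (f x, f y) \<in> S"
      "\<And>x. x \<in> topspace X \<Longrightarrow> f x \<in> topspace X" for f y z
  proof -
    have "(y, z) \<in> (S \<union> S\<inverse>)\<^sup>*" using yz by (simp add: identify_equiv_def)
    then have "(f y, f z) \<in> (S \<union> S\<inverse>)\<^sup>*"
      by induction (auto intro: rtrancl_into_rtrancl f(1))
    then show ?thesis using yz f(2) by (auto simp: identify_equiv_def)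
  qed
  show ?thesis
  proof (intro equalityI subsetI)
    fix y assume "y \<in> b ` ident_class X S x"
    then show "y \<in> ident_class X S (b x)"
      using *[of x _ b] S(1) X(1) by (auto simp: ident_class_def)
  next
    fix y assume "y \<in> ident_class X S (b x)"
    then have y: "(b x, y) \<in> identify_equiv X S" by (simp add: ident_class_def)
    then have "(b' (b x), b' y) \<in> identify_equiv X S" by (rule *) (use S(2) X(2) in auto)
    moreover have "y \<in> topspace X" using y by (simp add: identify_equiv_def)
    ultimately show "y \<in> b ` ident_class X S x"
      using inverse x by (intro image_eqI[of _ _ "b' y"]) (auto simp: ident_class_def)
  qed
qed

section \<open>Loop classes and their products\<close>

lemma in_loop_class_iff:
  assumes "c \<in> loops_at X x"
  shows "d \<in> loop_class X x c \<longleftrightarrow> d \<in> loops_at X x \<and> path_homotopic X c d"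
  using assms path_homotopic_iff[of c x x X d] by (auto simp: loop_class_def loops_at_def)

lemma loop_class_eq_iff:
  assumes "c \<in> loops_at X x" "d \<in> loops_at X x"
  shows "loop_class X x c = loop_class X x d \<longleftrightarrow> path_homotopic X c d"
proof
  assume "loop_class X x c = loop_class X x d"
  moreover have "d \<in> loop_class X x d"
    using assms by (auto simp: in_loop_class_iff loops_at_def pathin_realise)
  ultimately show "path_homotopic X c d" using assms by (auto simp: in_loop_class_iff)
next
  assume "path_homotopic X c d"
  then show "loop_class X x c = loop_class X x d"
    using assms by (auto simp: in_loop_class_iff) (metis homotopic_paths_sym homotopic_paths_trans)+
qed

lemma concat_loops_in_loops_at:
  "c \<in> loops_at X x \<Longrightarrow> d \<in> loops_at X x \<Longrightarrow> concat_loops c d \<in> loops_at X x"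
  unfolding loops_at_def mem_Collect_eq pathin_realise Pointed_concat_loops
  by (simp add: subset_path_image_join pathstart_def pathfinish_def) (simp add: concat_loops_def)

text \<open>The product is a union over all representatives of both classes; every pair of
  representatives contributes the same class, so the union collapses.\<close>

lemma mult_loop_class:
  assumes "c \<in> loops_at X x" "d \<in> loops_at X x"
  shows "loop_class X x c \<otimes>\<^bsub>fundamental_group X x\<^esub> loop_class X x d = loop_class X x (concat_loops c d)"
proof -
  have "loop_class X x (concat_loops c' d') = loop_class X x (concat_loops c d)"
    if "c' \<in> loop_class X x c" "d' \<in> loop_class X x d" for c' d'
  proof -
    have c': "c' \<in> loops_at X x" "path_homotopic X c c'" and d': "d' \<in> loops_at X x" "path_homotopic X d d'"
      using that assms by (auto simp: in_loop_class_iff)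
    then have "path_homotopic X (concat_loops c d) (concat_loops c' d')"
      unfolding Pointed_concat_loops using assms
      by (intro homotopic_paths_join) (auto simp: loops_at_def pathstart_def pathfinish_def)
    then show ?thesis
      using assms c' d' by (metis concat_loops_in_loops_at loop_class_eq_iff)
  qed
  moreover have "c \<in> loop_class X x c" "d \<in> loop_class X x d"
    using assms by (auto simp: in_loop_class_iff loops_at_def pathin_realise)
  ultimately show ?thesis
    unfolding fundamental_group_def monoid.select_convs by blast
qed

lemma openin_realise_image:
  assumes "A \<subseteq> topspace T"
  shows "openin (top_of_set (realise T)) (Pointed T ` A) \<longleftrightarrow> openin T A"
proof -
  have "{x \<in> topspace T. Pointed T x \<in> Pointed T ` A} = A" using assms by auto
  then show ?thesis using assms by (auto simp: openin_realise)
qed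

text \<open>The laws are asked only on \<open>topspace Z\<close>: points may be classes and a
  transformation an image map, which is not extensional as \<open>group_action\<close> would
  demand.\<close>

locale topological_action = group K for K (structure) +
  fixes Z :: "'z topology" and \<alpha> :: "'a \<Rightarrow> 'z \<Rightarrow> 'z"
  assumes continuous_action: "g \<in> carrier K \<Longrightarrow> continuous_map Z Z (\<alpha> g)"
    and action_one: "z \<in> topspace Z \<Longrightarrow> \<alpha> \<one> z = z"
    and action_mult: "g \<in> carrier K \<Longrightarrow> h \<in> carrier K \<Longrightarrow> z \<in> topspace Z \<Longrightarrow> \<alpha> (g \<otimes> h) z = \<alpha> g (\<alpha> h z)"
begin

lemma action_closed: "g \<in> carrier K \<Longrightarrow> z \<in> topspace Z \<Longrightarrow> \<alpha> g z \<in> topspace Z"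
  using continuous_action[of g] by (auto simp: continuous_map_def)

lemma action_inv [simp]:
  assumes "g \<in> carrier K" "z \<in> topspace Z"
  shows "\<alpha> (inv g) (\<alpha> g z) = z" "\<alpha> g (\<alpha> (inv g) z) = z"
  using assms by (simp_all flip: action_mult add: action_one)

definition orbit_proj :: "'a set \<Rightarrow> 'z \<Rightarrow> 'z set" where
  "orbit_proj M z = (\<lambda>u. \<alpha> u z) ` M"

text \<open>Chains of generating pairs collapse to a single step, because \<open>M\<close> is closed
  under products and inverses.\<close>

lemma orbit_proj_eq_ident_class:
  assumes M: "subgroup M K" and z: "z \<in> topspace Z"
  shows "orbit_proj M z = ident_class Z {(z, \<alpha> u z) |u z. u \<in> M \<and> z \<in> topspace Z} z"
proof -
  let ?S = "{(z, \<alpha> u z) |u z. u \<in> M \<and> z \<in> topspace Z}"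
  have MK: "M \<subseteq> carrier K" using M by (simp add: subgroup.subset)
  have "y \<in> orbit_proj M z" if "(z, y) \<in> (?S \<union> ?S\<inverse>)\<^sup>*" for y
    using that
  proof induction
    case base
    show ?case using subgroup.one_closed[OF M] action_one[OF z] by (force simp: orbit_proj_def)
  next
    case (step y y')
    then obtain u where u: "u \<in> M" "y = \<alpha> u z" by (auto simp: orbit_proj_def)
    from step(2) consider v where "v \<in> M" "y' = \<alpha> v y" | v where "v \<in> M" "y = \<alpha> v y'" "y' \<in> topspace Z"
      by auto
    then show ?case
    proof cases
      case 1
      then have "y' = \<alpha> (v \<otimes> u) z" using u z MK by (auto simp: action_mult subsetD)
      then show ?thesis using 1 u subgroup.m_closed[OF M] by (auto simp: orbit_proj_def)
    next
      case 2
      then have "y' = \<alpha> (inv v) y" using MK by auto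
      then have "y' = \<alpha> (inv v \<otimes> u) z" using u z MK 2 by (auto simp: action_mult subsetD)
      then show ?thesis
        using 2 u subgroup.m_closed[OF M] subgroup.m_inv_closed[OF M] by (auto simp: orbit_proj_def)
    qed
  qed
  moreover have "(z, \<alpha> u z) \<in> identify_equiv Z ?S" if "u \<in> M" for u
    using that z MK action_closed by (auto simp: identify_equiv_def)
  ultimately show ?thesis
    by (auto simp: ident_class_def orbit_proj_def identify_equiv_def)
qed

lemma quotient_map_orbit_proj:
  assumes "subgroup M K"
  shows "quotient_map Z (orbit_space Z M \<alpha>) (orbit_proj M)"
  using quotient_map_ident_class orbit_proj_eq_ident_class[OF assms]
  unfolding orbit_space_def by (metis (no_types, lifting) quotient_map_eq)

lemma topspace_orbit_space:
  assumes "subgroup M K"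
  shows "topspace (orbit_space Z M \<alpha>) = orbit_proj M ` topspace Z"
  using quotient_map_orbit_proj[OF assms] by (simp add: quotient_map_def)

lemma orbit_proj_eq_iff:
  assumes M: "subgroup M K" and z: "z \<in> topspace Z" "y \<in> topspace Z"
  shows "orbit_proj M z = orbit_proj M y \<longleftrightarrow> (\<exists>u\<in>M. y = \<alpha> u z)"
proof
  assume "orbit_proj M z = orbit_proj M y"
  moreover have "y \<in> orbit_proj M y"
    using subgroup.one_closed[OF M] action_one[OF z(2)] by (force simp: orbit_proj_def)
  ultimately show "\<exists>u\<in>M. y = \<alpha> u z" by (auto simp: orbit_proj_def)
next
  assume "\<exists>u\<in>M. y = \<alpha> u z"
  then show "orbit_proj M z = orbit_proj M y"
    unfolding orbit_proj_eq_ident_class[OF M z(1)] orbit_proj_eq_ident_class[OF M z(2)]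
    by (intro ident_class_eqI) (use z in auto)
qed

lemma orbit_proj_action:
  assumes "subgroup M K" "u \<in> M" "z \<in> topspace Z"
  shows "orbit_proj M (\<alpha> u z) = orbit_proj M z"
  using assms orbit_proj_eq_iff[of M z "\<alpha> u z"] action_closed subgroup.mem_carrier by metis

lemma openin_action_image:
  assumes "g \<in> carrier K" "openin Z N"
  shows "openin Z (\<alpha> g ` N)"
proof -
  have N: "N \<subseteq> topspace Z" using assms(2) by (rule openin_subset)
  have "\<alpha> g ` N = {z \<in> topspace Z. \<alpha> (inv g) z \<in> N}"
  proof (intro equalityI subsetI)
    fix z assume "z \<in> {z \<in> topspace Z. \<alpha> (inv g) z \<in> N}"
    then show "z \<in> \<alpha> g ` N" using assms(1) by (metis (mono_tags, lifting) action_inv(2) image_iff mem_Collect_eq)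
  qed (use assms N action_closed in auto)
  then show ?thesis
    using assms continuous_action[of "inv g"] by (simp add: openin_continuous_map_preimage)
qed

text \<open>The saturation of \<open>N\<close> is the union of its translates by \<open>M\<close>,
  so the projection to orbits is open.\<close>

lemma openin_orbit_proj_image:
  assumes M: "subgroup M K" and N: "openin Z N"
  shows "openin (orbit_space Z M \<alpha>) (orbit_proj M ` N)"
proof -
  have NZ: "N \<subseteq> topspace Z" using N by (rule openin_subset)
  have "{z \<in> topspace Z. orbit_proj M z \<in> orbit_proj M ` N} = (\<Union>u\<in>M. \<alpha> u ` N)"
  proof (intro equalityI subsetI)
    fix z assume "z \<in> {z \<in> topspace Z. orbit_proj M z \<in> orbit_proj M ` N}"
    then obtain n where "z \<in> topspace Z" "n \<in> N" "orbit_proj M n = orbit_proj M z" by force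
    then show "z \<in> (\<Union>u\<in>M. \<alpha> u ` N)"
      using NZ orbit_proj_eq_iff[OF M, of n z] by auto
  next
    fix z assume "z \<in> (\<Union>u\<in>M. \<alpha> u ` N)"
    then obtain u n where un: "u \<in> M" "n \<in> N" "z = \<alpha> u n" by auto
    then have "orbit_proj M z = orbit_proj M n" "z \<in> topspace Z"
      using NZ orbit_proj_action[OF M] action_closed subgroup.mem_carrier[OF M] by auto
    then show "z \<in> {z \<in> topspace Z. orbit_proj M z \<in> orbit_proj M ` N}" using un by auto
  qed
  moreover have "openin Z (\<Union>u\<in>M. \<alpha> u ` N)"
    using openin_action_image N subgroup.mem_carrier[OF M] by auto
  moreover have "orbit_proj M ` N \<subseteq> topspace (orbit_space Z M \<alpha>)"
    using NZ topspace_orbit_space[OF M] by auto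
  ultimately show ?thesis
    using quotient_map_orbit_proj[OF M] unfolding quotient_map_def by metis
qed

lemma continuous_map_orbit_proj:
  "subgroup M K \<Longrightarrow> continuous_map Z (orbit_space Z M \<alpha>) (orbit_proj M)"
  by (simp add: quotient_imp_continuous_map quotient_map_orbit_proj)

text \<open>Translates of a sufficiently small open set by elements in different cosets of \<open>M\<close> are disjoint,
  so they are the sheets over its image.\<close>

lemma covering_space_orbit_spaces:
  assumes M: "M \<lhd> K"
    and wander: "\<And>z. z \<in> topspace Z \<Longrightarrow> \<exists>N. openin Z N \<and> z \<in> N \<and> (\<forall>u\<in>carrier K. \<alpha> u ` N \<inter> N \<noteq> {} \<longrightarrow> u \<in> M)"
  defines "r \<equiv> \<lambda>C. \<Union>z\<in>C. orbit_proj (carrier K) z"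
  shows "covering_space (realise (orbit_space Z M \<alpha>)) (realise_map (orbit_space Z (carrier K) \<alpha>) r)
    (realise (orbit_space Z (carrier K) \<alpha>))"
    and "z \<in> topspace Z \<Longrightarrow> r (orbit_proj M z) = orbit_proj (carrier K) z"
proof -
  let ?U = "carrier K"
  let ?Y = "orbit_space Z M \<alpha>" and ?Q = "orbit_space Z ?U \<alpha>"
  let ?p = "realise_map ?Q r"
  have subM: "subgroup M K" using M by (rule normal_imp_subgroup)
  have subU: "subgroup ?U K" by (rule subgroup_self)
  have MU: "M \<subseteq> ?U" using subM by (rule subgroup.subset)
  have r: "r (orbit_proj M z) = orbit_proj ?U z" if z: "z \<in> topspace Z" for z
  proof -
    have "orbit_proj ?U y = orbit_proj ?U z" if "y \<in> orbit_proj M z" for y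
      using that z MU orbit_proj_action[OF subU] by (auto simp: orbit_proj_def[of M])
    moreover have "orbit_proj M z \<noteq> {}" using subgroup.one_closed[OF subM] by (auto simp: orbit_proj_def)
    ultimately show ?thesis unfolding r_def by auto
  qed
  then show "z \<in> topspace Z \<Longrightarrow> r (orbit_proj M z) = orbit_proj ?U z" .
  note topY = topspace_orbit_space[OF subM] and topQ = topspace_orbit_space[OF subU]
  have contr: "continuous_map ?Y ?Q r"
  proof -
    have "continuous_map Z ?Q (r \<circ> orbit_proj M)"
      by (rule continuous_map_eq[OF continuous_map_orbit_proj[OF subU]]) (simp add: r)
    then show ?thesis using quotient_map_orbit_proj[OF subM] continuous_compose_quotient_map by blast
  qed
  have contp: "continuous_on (realise ?Y) ?p" by (rule continuous_on_realise_map[OF contr])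
  have openr: "openin ?Q (r ` A)" if A: "openin ?Y A" for A
  proof -
    let ?B = "{z \<in> topspace Z. orbit_proj M z \<in> A}"
    have "openin Z ?B"
      using continuous_map_orbit_proj[OF subM] A by (rule openin_continuous_map_preimage)
    moreover have "r ` A = orbit_proj ?U ` ?B"
      using openin_subset[OF A] unfolding topY by (force simp flip: r)
    ultimately show ?thesis using openin_orbit_proj_image[OF subU] by simp
  qed
  have openp: "openin (top_of_set (realise ?Q)) (?p ` W)" if W: "openin (top_of_set (realise ?Y)) W" for W
  proof -
    define A where "A = {x \<in> topspace ?Y. Pointed ?Y x \<in> W}"
    have "openin ?Y A" and W': "W = Pointed ?Y ` A"
      using W unfolding openin_realise A_def by (auto simp: realise_def)
    then have "openin ?Q (r ` A)" using openr by blast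
    moreover have "?p ` W = Pointed ?Q ` (r ` A)" unfolding W' by (auto simp: image_image)
    ultimately show ?thesis using openin_subset openin_realise_image by metis
  qed
  show "covering_space (realise ?Y) ?p (realise ?Q)"
  proof
    show "?p ` realise ?Y = realise ?Q"
      unfolding realise_def topY topQ image_image by (rule image_cong) (auto simp: r)
    fix x assume "x \<in> realise ?Q"
    then obtain z where z: "z \<in> topspace Z" "x = Pointed ?Q (orbit_proj ?U z)"
      by (auto simp: realise_def topQ)
    obtain N where N: "openin Z N" "z \<in> N" and NM: "\<And>u. u \<in> ?U \<Longrightarrow> \<alpha> u ` N \<inter> N \<noteq> {} \<Longrightarrow> u \<in> M"
      using wander[OF z(1)] by blast
    have NZ: "N \<subseteq> topspace Z" using N(1) by (rule openin_subset)
    define sheet where "sheet u = Pointed ?Y ` orbit_proj M ` \<alpha> u ` N" for u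
    have sheet_open: "openin (top_of_set (realise ?Y)) (sheet u)" if "u \<in> ?U" for u
    proof -
      have "openin ?Y (orbit_proj M ` \<alpha> u ` N)"
        using openin_orbit_proj_image[OF subM] openin_action_image N that by blast
      then show ?thesis using openin_subset openin_realise_image unfolding sheet_def by metis
    qed
    have conj: "u \<otimes> (m \<otimes> inv u) \<in> M" if "u \<in> ?U" "m \<in> M" for u m
      using normal.inv_op_closed2[OF M, of u m] that MU by (simp add: m_assoc subsetD)
    \<comment> \<open>Points \<open>n\<close> and \<open>n'\<close> with a common image yield
      \<open>m\<close> in \<open>M\<close> such that \<open>inv v \<otimes> (m \<otimes> u)\<close>
      maps \<open>n\<close> to \<open>n'\<close>; this element lies in \<open>M\<close> by the
      choice of \<open>N\<close>. Conjugating it by \<open>v\<close>, inverting and multiplying by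
      \<open>m\<close> leaves \<open>v \<otimes> inv u\<close>.\<close>
    have same: "v \<otimes> inv u \<in> M"
      if uv: "u \<in> ?U" "v \<in> ?U" "n \<in> N" "n' \<in> N" "orbit_proj M (\<alpha> u n) = orbit_proj M (\<alpha> v n')" for u v n n'
    proof -
      have nZ: "\<alpha> u n \<in> topspace Z" "\<alpha> v n' \<in> topspace Z" "n \<in> topspace Z" "n' \<in> topspace Z"
        using uv NZ action_closed by auto
      obtain m where m: "m \<in> M" "\<alpha> v n' = \<alpha> m (\<alpha> u n)"
        using uv(5) orbit_proj_eq_iff[OF subM nZ(1,2)] by auto
      have mU: "m \<in> ?U" using m MU by auto
      have "\<alpha> (inv v \<otimes> (m \<otimes> u)) n = n'"
        using uv(1,2) nZ mU m(2)[symmetric] by (simp add: action_mult)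
      then have k: "inv v \<otimes> (m \<otimes> u) \<in> M" (is "?k \<in> M") using uv(1-4) mU by (intro NM) auto
      have cancel: "x \<otimes> (inv x \<otimes> y) = y" "inv x \<otimes> (x \<otimes> y) = y" if "x \<in> ?U" "y \<in> ?U" for x y
        using that by (simp_all flip: m_assoc)
      have "inv (v \<otimes> (?k \<otimes> inv v)) \<otimes> m \<in> M"
        by (rule subgroup.m_closed[OF subM subgroup.m_inv_closed[OF subM conj[OF uv(2) k]] m(1)])
      moreover have "inv (v \<otimes> (?k \<otimes> inv v)) \<otimes> m = v \<otimes> inv u"
        using uv mU by (simp add: m_assoc inv_mult_group cancel)
      ultimately show ?thesis by simp
    qed
    have sheet_eq: "sheet u = sheet v" if uv: "u \<in> ?U" "v \<in> ?U" "v \<otimes> inv u \<in> M" for u v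
    proof -
      have "orbit_proj M (\<alpha> v n) = orbit_proj M (\<alpha> u n)" if "n \<in> N" for n
      proof -
        have n: "n \<in> topspace Z" using that NZ by auto
        have "\<alpha> v n = \<alpha> (v \<otimes> inv u) (\<alpha> u n)"
          using uv n by (simp add: m_assoc action_closed flip: action_mult)
        then show ?thesis using orbit_proj_action[OF subM uv(3)] uv n action_closed by simp
      qed
      then show ?thesis unfolding sheet_def image_image by (intro image_cong) auto
    qed
    have p_sheet: "?p (Pointed ?Y (orbit_proj M (\<alpha> u n))) = Pointed ?Q (orbit_proj ?U n)"
      if "u \<in> ?U" "n \<in> N" for u n
      using that NZ action_closed orbit_proj_action[OF subU] by (auto simp: r)
    let ?T = "Pointed ?Q ` orbit_proj ?U ` N"
    have p_image: "?p ` sheet u = ?T" if "u \<in> ?U" for u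
      unfolding sheet_def image_image using p_sheet that by (intro image_cong) auto
    show "\<exists>T. x \<in> T \<and> openin (top_of_set (realise ?Q)) T \<and>
        (\<exists>v. \<Union>v = realise ?Y \<inter> ?p -` T \<and> (\<forall>u\<in>v. openin (top_of_set (realise ?Y)) u) \<and>
          pairwise disjnt v \<and> (\<forall>u\<in>v. \<exists>q. homeomorphism u T ?p q))"
    proof (intro exI[of _ ?T] exI[of _ "sheet ` ?U"] conjI)
      show "x \<in> ?T" using z N by auto
      have "openin ?Q (orbit_proj ?U ` N)" using openin_orbit_proj_image[OF subU N(1)] .
      then show "openin (top_of_set (realise ?Q)) ?T" using openin_subset openin_realise_image by metis
      show "\<Union>(sheet ` ?U) = realise ?Y \<inter> ?p -` ?T"
      proof (intro equalityI subsetI)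
        fix y assume "y \<in> \<Union>(sheet ` ?U)"
        then obtain u where u: "u \<in> ?U" "y \<in> sheet u" by auto
        have "y \<in> realise ?Y" using openin_subset[OF sheet_open[OF u(1)]] u(2) by auto
        moreover have "?p y \<in> ?T" using u p_image by blast
        ultimately show "y \<in> realise ?Y \<inter> ?p -` ?T" by auto
      next
        fix y assume y: "y \<in> realise ?Y \<inter> ?p -` ?T"
        then obtain w where w: "w \<in> topspace Z" "y = Pointed ?Y (orbit_proj M w)"
          by (auto simp: realise_def topY)
        then obtain n where n: "n \<in> N" "orbit_proj ?U n = orbit_proj ?U w" using y by (auto simp: r)
        then obtain u where u: "u \<in> ?U" "w = \<alpha> u n"
          using orbit_proj_eq_iff[OF subU, of n w] w(1) NZ by auto
        then show "y \<in> \<Union>(sheet ` ?U)" using w n by (auto simp: sheet_def)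
      qed
      show "\<forall>u\<in>sheet ` ?U. openin (top_of_set (realise ?Y)) u" using sheet_open by auto
      show "pairwise disjnt (sheet ` ?U)"
      proof (rule pairwiseI)
        fix s t assume st: "s \<in> sheet ` ?U" "t \<in> sheet ` ?U" "s \<noteq> t"
        then obtain u v where uv: "u \<in> ?U" "v \<in> ?U" "s = sheet u" "t = sheet v" by auto
        show "disjnt s t"
        proof (rule ccontr)
          assume "\<not> disjnt s t"
          then obtain n n' where "n \<in> N" "n' \<in> N" "orbit_proj M (\<alpha> u n) = orbit_proj M (\<alpha> v n')"
            using uv by (auto simp: disjnt_iff sheet_def)
          then show False using same[OF uv(1,2)] sheet_eq[OF uv(1,2)] uv st by blast
        qed
      qed
      show "\<forall>s\<in>sheet ` ?U. \<exists>q. homeomorphism s ?T ?p q"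
      proof
        fix s assume "s \<in> sheet ` ?U"
        then obtain u where u: "u \<in> ?U" "s = sheet u" by auto
        have sY: "s \<subseteq> realise ?Y" using openin_subset[OF sheet_open[OF u(1)]] u(2) by auto
        \<comment> \<open>Two points of one sheet over the same orbit differ by some
          \<open>v\<close> under which \<open>N\<close> meets its translate, so \<open>v\<close>
          lies in \<open>M\<close>; its conjugate by \<open>u\<close> identifies them in the orbit
          space of \<open>M\<close>.\<close>
        have inj: "inj_on ?p s"
        proof (rule inj_onI)
          fix y y' assume y: "y \<in> s" "y' \<in> s" "?p y = ?p y'"
          then obtain n n' where n: "n \<in> N" "y = Pointed ?Y (orbit_proj M (\<alpha> u n))"
            "n' \<in> N" "y' = Pointed ?Y (orbit_proj M (\<alpha> u n'))"
            using u by (auto simp: sheet_def)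
          then have "orbit_proj ?U n = orbit_proj ?U n'" using y(3) p_sheet u(1) by auto
          then obtain v where v: "v \<in> ?U" "n' = \<alpha> v n"
            using orbit_proj_eq_iff[OF subU, of n n'] n NZ by auto
          then have "v \<in> M" using n by (intro NM) auto
          have nZ: "n \<in> topspace Z" using n NZ by auto
          have "\<alpha> u n' = \<alpha> (u \<otimes> (v \<otimes> inv u)) (\<alpha> u n)"
            using u v nZ by (simp add: action_mult action_closed)
          then have "orbit_proj M (\<alpha> u n') = orbit_proj M (\<alpha> u n)"
            using orbit_proj_action[OF subM conj[OF u(1) \<open>v \<in> M\<close>]] u nZ action_closed by simp
          then show "y = y'" using n by simp
        qed
        show "\<exists>q. homeomorphism s ?T ?p q"
        proof (rule homeomorphism_injective_open_map[OF _ _ inj])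
          show "continuous_on s ?p" using contp sY by (rule continuous_on_subset)
          show "?p ` s = ?T" using p_image u by simp
          fix W assume "openin (top_of_set s) W"
          then have "openin (top_of_set (realise ?Y)) W"
            using sheet_open[OF u(1)] unfolding u(2) by (rule openin_trans)
          then have "openin (top_of_set (realise ?Q)) (?p ` W)" by (rule openp)
          moreover have "?p ` W \<subseteq> ?T"
            using image_mono[OF openin_imp_subset[OF \<open>openin (top_of_set s) W\<close>], of ?p] p_image[OF u(1)]
            unfolding u(2) by simp
          moreover have "?T \<subseteq> realise ?Q"
            using NZ by (auto simp: topQ)
          ultimately show "openin (top_of_set ?T) (?p ` W)"
            by (rule openin_subset_trans)
        qed blast
      qed
    qed
  qed (rule contp)
qed

end

section \<open>The fundamental group of an orbit space\<close>

lemma path_connected_realise_pathin: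
  assumes "path_connected (realise T)" "x \<in> topspace T" "y \<in> topspace T"
  obtains c where "pathin T c" "c 0 = x" "c 1 = y"
proof -
  obtain g where g: "path g" "path_image g \<subseteq> realise T" "pathstart g = Pointed T x" "pathfinish g = Pointed T y"
    using assms unfolding path_connected_def by (metis Pointed_in_realise)
  have "continuous_map (top_of_set {0..1}) (top_of_set (realise T)) g"
    using g(1,2) by (simp add: path_def path_image_def continuous_map_in_subtopology image_subset_iff_funcset)
  then have "pathin T (point \<circ> g)"
    unfolding pathin_def by (rule continuous_map_compose[OF _ continuous_map_point])
  then show ?thesis using g(3,4) by (intro that[of "point \<circ> g"]) (auto simp: pathstart_def pathfinish_def)
qed

lemma path_homotopic_continuous_image:
  assumes "path_homotopic X c d" "continuous_map X Y f"
  shows "path_homotopic Y (f \<circ> c) (f \<circ> d)"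
  using homotopic_paths_continuous_image[OF assms(1) continuous_on_realise_map[OF assms(2)]]
  by (simp add: realise_map_comp_Pointed)

lemma simply_connected_realise_path_homotopic:
  assumes "simply_connected (realise X)" "pathin X c" "pathin X d" "c 0 = d 0" "c 1 = d 1"
  shows "path_homotopic X c d"
  using assms unfolding pathin_realise
  by (intro simply_connected_imp_homotopic_paths) (auto simp: pathstart_def pathfinish_def)

lemma pathin_concat_loops:
  assumes "pathin X c" "pathin X d" "c 1 = d 0"
  shows "pathin X (concat_loops c d)"
  using assms unfolding pathin_realise Pointed_concat_loops
  by (simp add: subset_path_image_join pathstart_def pathfinish_def)

lemma concat_loops_ends [simp]: "concat_loops c d 0 = c 0" "concat_loops c d 1 = d 1"
  by (auto simp: concat_loops_def)

lemma reversepath_Pointed: "reversepath (Pointed X \<circ> c) = Pointed X \<circ> (c \<circ> (\<lambda>t. 1 - t))"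
  by (auto simp: reversepath_def)

lemma pathin_reverse: "pathin X c \<Longrightarrow> pathin X (c \<circ> (\<lambda>t. 1 - t))"
  unfolding pathin_realise reversepath_Pointed[symmetric] by simp

lemma homotopic_with_realise:
  assumes hom: "homotopic_with (\<lambda>_. True) (subtopology X W) Y f g" and W: "W \<subseteq> topspace X"
  shows "homotopic_with_canon (\<lambda>_. True) (Pointed X ` W) (realise Y) (realise_map Y f) (realise_map Y g)"
proof -
  have "Pointed X ` W \<subseteq> realise X" using W by (auto simp: realise_def)
  then have "continuous_map (top_of_set (Pointed X ` W)) (subtopology X W) point"
    using continuous_map_from_subtopology[OF continuous_map_point[of X], of "Pointed X ` W"]
    by (auto simp: continuous_map_in_subtopology subtopology_subtopology Int_absorb1)
  then have "homotopic_with_canon (\<lambda>_. True) (Pointed X ` W) (realise Y)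
      (Pointed Y \<circ> (f \<circ> point)) (Pointed Y \<circ> (g \<circ> point))"
    by (intro homotopic_with_compose_continuous_map_left[OF _ continuous_map_Pointed]
        homotopic_with_compose_continuous_map_right[OF hom]) auto
  moreover have "realise_map Y f = Pointed Y \<circ> (f \<circ> point)" for f :: "'a \<Rightarrow> 'b"
    by (auto simp: realise_map_def)
  ultimately show ?thesis by simp
qed

section \<open>Lifting paths from an orbit space, and the fundamental group\<close>

context topological_action
begin

text \<open>Only paths inside the image of \<open>N\<close> are considered, but the lift starts at
  any given point over their start and may leave \<open>N\<close>. The homotopy takes place in the
  whole orbit space, and the end of the lift is determined at most up to \<open>M\<close>.\<close>

definition lifts_paths_over :: "'a set \<Rightarrow> 'z set \<Rightarrow> bool" where
  "lifts_paths_over M N \<longleftrightarrow>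
     (\<forall>c w. pathin (orbit_space Z M \<alpha>) c \<longrightarrow> c ` {0..1} \<subseteq> orbit_proj M ` N \<longrightarrow>
        w \<in> topspace Z \<longrightarrow> orbit_proj M w = c 0 \<longrightarrow>
        (\<exists>d. pathin Z d \<and> d 0 = w \<and> path_homotopic (orbit_space Z M \<alpha>) (orbit_proj M \<circ> d) c))"

lemma path_lifting_orbit_space:
  assumes M: "subgroup M K"
    and lift: "\<And>z. z \<in> topspace Z \<Longrightarrow> \<exists>N. openin Z N \<and> z \<in> N \<and> lifts_paths_over M N"
    and c: "pathin (orbit_space Z M \<alpha>) c" and w: "w \<in> topspace Z" "orbit_proj M w = c 0"
  obtains d where "pathin Z d" "d 0 = w" "path_homotopic (orbit_space Z M \<alpha>) (orbit_proj M \<circ> d) c"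
proof -
  let ?Q = "orbit_space Z M \<alpha>"
  let ?f = "realise_map ?Q (orbit_proj M)"
  note f = continuous_on_realise_map[OF continuous_map_orbit_proj[OF M]]
  \<comment> \<open>Outside \<open>{0..1}\<close> a path may leave the copy of \<open>T\<close>, so
    \<open>e\<close> and its round trip through \<open>point\<close> agree only on the interval; for
    homotopy of paths this suffices.\<close>
  have point_path: "path_homotopic T (point \<circ> e) (point \<circ> e) \<and> homotopic_paths (realise T) (Pointed T \<circ> (point \<circ> e)) e"
    if "path e" "path_image e \<subseteq> realise T" for e and T :: "'t topology"
  proof -
    have "e t = (Pointed T \<circ> (point \<circ> e)) t" if "t \<in> {0..1}" for t
    proof -
      have "e t \<in> realise T" using \<open>path_image e \<subseteq> realise T\<close> that by (auto simp: path_image_def)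
      then show ?thesis by (simp add: point_realise)
    qed
    then have "homotopic_paths (realise T) e (Pointed T \<circ> (point \<circ> e))"
      using that by (intro homotopic_paths_eq) auto
    then show ?thesis by (meson homotopic_paths_sym homotopic_paths_trans)
  qed
  obtain d where d: "path d" "path_image d \<subseteq> realise Z" "pathstart d = Pointed Z w"
    "homotopic_paths (realise ?Q) (?f \<circ> d) (Pointed ?Q \<circ> c)"
  proof (rule path_lifting_up_to_homotopy[OF f])
    fix b assume "b \<in> realise ?Q"
    then obtain z where z: "z \<in> topspace Z" "b = Pointed ?Q (orbit_proj M z)"
      by (auto simp: realise_def topspace_orbit_space[OF M])
    obtain N where N: "openin Z N" "z \<in> N" "lifts_paths_over M N" using lift[OF z(1)] by blast
    show "\<exists>W. openin (top_of_set (realise ?Q)) W \<and> b \<in> W \<and>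
      (\<forall>c w. path c \<and> path_image c \<subseteq> W \<and> w \<in> realise Z \<and> ?f w = pathstart c \<longrightarrow>
        (\<exists>d. path d \<and> path_image d \<subseteq> realise Z \<and> pathstart d = w \<and> homotopic_paths (realise ?Q) (?f \<circ> d) c))"
    proof (intro exI[of _ "Pointed ?Q ` orbit_proj M ` N"] conjI allI impI; (elim conjE)?)
      have "openin ?Q (orbit_proj M ` N)" using openin_orbit_proj_image[OF M N(1)] .
      then show "openin (top_of_set (realise ?Q)) (Pointed ?Q ` orbit_proj M ` N)"
        using openin_subset openin_realise_image by metis
      show "b \<in> Pointed ?Q ` orbit_proj M ` N" using z N by auto
      fix e y assume e: "path e" "path_image e \<subseteq> Pointed ?Q ` orbit_proj M ` N"
        and y: "y \<in> realise Z" "?f y = pathstart e"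
      have "orbit_proj M ` N \<subseteq> topspace ?Q"
        using openin_subset[OF N(1)] topspace_orbit_space[OF M] by auto
      then have eQ: "path_image e \<subseteq> realise ?Q" using e(2) unfolding realise_def by blast
      note hom = point_path[OF e(1) eQ]
      have "pathin ?Q (point \<circ> e)" using hom unfolding pathin_realise by simp
      moreover have "(point \<circ> e) ` {0..1} \<subseteq> orbit_proj M ` N"
        using image_mono[OF e(2), of point] by (simp add: path_image_def image_image)
      moreover have "orbit_proj M (point y) = (point \<circ> e) 0"
        using arg_cong[OF y(2), of point] by (simp add: pathstart_def realise_map_def)
      ultimately obtain d where d: "pathin Z d" "d 0 = point y" "path_homotopic ?Q (orbit_proj M \<circ> d) (point \<circ> e)"
        using N(3) point_realise[OF y(1)] unfolding lifts_paths_over_def by metis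
      show "\<exists>d. path d \<and> path_image d \<subseteq> realise Z \<and> pathstart d = y \<and> homotopic_paths (realise ?Q) (?f \<circ> d) e"
        using d(1,2) homotopic_paths_trans[OF d(3) conjunct2[OF hom]] point_realise[OF y(1)]
        by (intro exI[of _ "Pointed Z \<circ> d"])
           (auto simp: pathin_realise pathstart_def realise_map_comp_Pointed)
    qed
  next
    show "path (Pointed ?Q \<circ> c)" "path_image (Pointed ?Q \<circ> c) \<subseteq> realise ?Q"
      using c by (auto simp: pathin_realise)
    show "Pointed Z w \<in> realise Z" "?f (Pointed Z w) = pathstart (Pointed ?Q \<circ> c)"
      using w by (auto simp: pathstart_def)
  qed (rule that)
  note hom = point_path[OF d(1,2)]
  have "homotopic_paths (realise ?Q) (?f \<circ> (Pointed Z \<circ> (point \<circ> d))) (?f \<circ> d)"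
    by (rule homotopic_paths_continuous_image[OF conjunct2[OF hom] f])
  from homotopic_paths_trans[OF this d(4)] have "path_homotopic ?Q (orbit_proj M \<circ> (point \<circ> d)) c"
    unfolding realise_map_comp_Pointed .
  moreover have "pathin Z (point \<circ> d)" using hom unfolding pathin_realise by simp
  moreover have "(point \<circ> d) 0 = w" using d(3) by (simp add: pathstart_def)
  ultimately show ?thesis by (intro that)
qed

text \<open>On such an \<open>N\<close> the projection is injective and open, hence a homeomorphism
  onto an open set. Its inverse lifts the path into \<open>N\<close>, and an element of
  \<open>M\<close> moves the lift to the prescribed start.\<close>

lemma lifts_paths_over_if_free:
  assumes M: "subgroup M K" and N: "openin Z N"
    and free: "\<And>u. u \<in> M \<Longrightarrow> \<alpha> u ` N \<inter> N \<noteq> {} \<Longrightarrow> u = \<one>"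
  shows "lifts_paths_over M N"
  unfolding lifts_paths_over_def
proof (intro allI impI)
  let ?Q = "orbit_space Z M \<alpha>" and ?k = "orbit_proj M"
  have MK: "u \<in> carrier K" if "u \<in> M" for u using M that by (rule subgroup.mem_carrier)
  have NZ: "N \<subseteq> topspace Z" using N by (rule openin_subset)
  have kN: "openin ?Q (?k ` N)" using M N by (rule openin_orbit_proj_image)
  have "homeomorphic_map (subtopology Z N) (subtopology ?Q (?k ` N)) ?k"
  proof (rule bijective_open_imp_homeomorphic_map)
    show "continuous_map (subtopology Z N) (subtopology ?Q (?k ` N)) ?k"
      using continuous_map_orbit_proj[OF M]
      by (auto simp: continuous_map_in_subtopology continuous_map_from_subtopology)
    show "open_map (subtopology Z N) (subtopology ?Q (?k ` N)) ?k"
      unfolding open_map_def openin_open_subtopology[OF N] openin_open_subtopology[OF kN]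
      using openin_orbit_proj_image[OF M] by auto
    show "?k ` topspace (subtopology Z N) = topspace (subtopology ?Q (?k ` N))"
      using NZ openin_subset[OF kN] by (simp add: Int_absorb1)
    show "inj_on ?k (topspace (subtopology Z N))"
    proof (rule inj_onI)
      fix x y assume xy: "x \<in> topspace (subtopology Z N)" "y \<in> topspace (subtopology Z N)" "?k x = ?k y"
      then obtain u where "u \<in> M" "y = \<alpha> u x" using orbit_proj_eq_iff[OF M] by auto
      moreover from this have "\<alpha> u ` N \<inter> N \<noteq> {}" using xy by auto
      ultimately show "x = y" using free[of u] xy action_one by auto
    qed
  qed
  then obtain g where g: "continuous_map (subtopology ?Q (?k ` N)) (subtopology Z N) g"
    "\<And>n. n \<in> N \<Longrightarrow> g (?k n) = n"
    unfolding homeomorphic_map_maps homeomorphic_maps_def using NZ by (auto simp: Int_absorb1)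
  fix c w assume c: "pathin ?Q c" "c ` {0..1} \<subseteq> ?k ` N" and w: "w \<in> topspace Z" "?k w = c 0"
  have "c 0 \<in> ?k ` N" using c(2) by auto
  then obtain n where n: "n \<in> N" "c 0 = ?k n" by auto
  then obtain u where u: "u \<in> M" "w = \<alpha> u n" using orbit_proj_eq_iff[OF M, of n w] w NZ by auto
  let ?d = "\<alpha> u \<circ> (g \<circ> c)"
  have "continuous_map (top_of_set {0..1}) (subtopology ?Q (?k ` N)) c"
    using c by (auto simp: pathin_def continuous_map_in_subtopology)
  then have "continuous_map (top_of_set {0..1}) (subtopology Z N) (g \<circ> c)"
    using g(1) by (rule continuous_map_compose)
  then have gc: "continuous_map (top_of_set {0..1}) Z (g \<circ> c)"
    by (simp add: continuous_map_in_subtopology)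
  have "pathin Z ?d"
    unfolding pathin_def using gc continuous_action[OF MK[OF u(1)]] by (rule continuous_map_compose)
  moreover have "?d 0 = w" using n u g(2) by simp
  moreover have "path_homotopic ?Q (?k \<circ> ?d) c"
  proof (rule homotopic_paths_sym, rule homotopic_paths_eq)
    show "path (Pointed ?Q \<circ> c)" "path_image (Pointed ?Q \<circ> c) \<subseteq> realise ?Q"
      using c by (auto simp: pathin_realise)
    fix t :: real assume "t \<in> {0..1}"
    then have "c t \<in> ?k ` N" using c(2) by blast
    then obtain m where m: "m \<in> N" "c t = ?k m" by auto
    then show "(Pointed ?Q \<circ> c) t = (Pointed ?Q \<circ> (?k \<circ> ?d)) t"
      using g(2) orbit_proj_action[OF M u(1), of m] NZ by auto
  qed
  ultimately show "\<exists>d. pathin Z d \<and> d 0 = w \<and> path_homotopic ?Q (?k \<circ> d) c" by blast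
qed

text \<open>Only the two ends of the path are lifted; they are joined inside \<open>N\<close>, and
  the joining path is translated to the prescribed start. Its projection has the same ends as
  \<open>c\<close> and lies, like \<open>c\<close>, in a set that contracts in the orbit
  space.\<close>

lemma lifts_paths_over_if_null_homotopic:
  assumes M: "subgroup M K" and N: "N \<subseteq> topspace Z"
    and conn: "\<And>x y. x \<in> N \<Longrightarrow> y \<in> N \<Longrightarrow> \<exists>e. pathin Z e \<and> e ` {0..1} \<subseteq> N \<and> e 0 = x \<and> e 1 = y"
    and null: "homotopic_with (\<lambda>_. True) (subtopology (orbit_space Z M \<alpha>) (orbit_proj M ` N)) (orbit_space Z M \<alpha>)
      id (\<lambda>_. b)"
  shows "lifts_paths_over M N"
  unfolding lifts_paths_over_def
proof (intro allI impI)
  let ?Q = "orbit_space Z M \<alpha>" and ?k = "orbit_proj M"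
  have MK: "u \<in> carrier K" if "u \<in> M" for u using M that by (rule subgroup.mem_carrier)
  have kN: "?k ` N \<subseteq> topspace ?Q" using N topspace_orbit_space[OF M] by auto
  fix c w assume c: "pathin ?Q c" "c ` {0..1} \<subseteq> ?k ` N" and w: "w \<in> topspace Z" "?k w = c 0"
  have "c 0 \<in> ?k ` N" "c 1 \<in> ?k ` N" using c(2) by auto
  then obtain n n' where n: "n \<in> N" "c 0 = ?k n" and n': "n' \<in> N" "c 1 = ?k n'" by auto
  have "n \<in> topspace Z" using n N by auto
  then obtain u where u: "u \<in> M" "w = \<alpha> u n" using orbit_proj_eq_iff[OF M, of n w] w n by auto
  obtain e where e: "pathin Z e" "e ` {0..1} \<subseteq> N" "e 0 = n" "e 1 = n'" using conn n n' by blast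
  let ?d = "\<alpha> u \<circ> e"
  have d: "pathin Z ?d"
    using e(1) continuous_action[OF MK[OF u(1)]] unfolding pathin_def by (rule continuous_map_compose)
  have kd: "(?k \<circ> ?d) t = ?k (e t)" if "t \<in> {0..1}" for t
  proof -
    have "e t \<in> topspace Z" using that e(2) N by blast
    then show ?thesis using orbit_proj_action[OF M u(1), of "e t"] by simp
  qed
  have path_d: "pathin ?Q (?k \<circ> ?d)"
    using d continuous_map_orbit_proj[OF M] unfolding pathin_def by (rule continuous_map_compose)
  have "path_homotopic ?Q (?k \<circ> ?d) c"
  proof (rule null_homotopic_imp_homotopic_paths)
    have "homotopic_with_canon (\<lambda>_. True) (Pointed ?Q ` ?k ` N) (realise ?Q)
        (realise_map ?Q id) (realise_map ?Q (\<lambda>_. b))"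
      using null kN by (rule homotopic_with_realise)
    then show "homotopic_with_canon (\<lambda>_. True) (Pointed ?Q ` ?k ` N) (realise ?Q) id (\<lambda>_. Pointed ?Q b)"
      by (rule homotopic_with_eq) auto
    show "path_image (Pointed ?Q \<circ> c) \<subseteq> Pointed ?Q ` ?k ` N"
      using image_mono[OF c(2), of "Pointed ?Q"] by (simp add: path_image_def image_image)
    show "path_image (Pointed ?Q \<circ> (?k \<circ> ?d)) \<subseteq> Pointed ?Q ` ?k ` N"
    proof
      fix x assume "x \<in> path_image (Pointed ?Q \<circ> (?k \<circ> ?d))"
      then obtain t where t: "t \<in> {0..1}" "x = Pointed ?Q ((?k \<circ> ?d) t)" by (auto simp: path_image_def)
      moreover have "e t \<in> N" using e(2) t(1) by blast
      ultimately show "x \<in> Pointed ?Q ` ?k ` N" unfolding kd[OF t(1)] by simp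
    qed
    show "pathstart (Pointed ?Q \<circ> (?k \<circ> ?d)) = pathstart (Pointed ?Q \<circ> c)"
      "pathfinish (Pointed ?Q \<circ> (?k \<circ> ?d)) = pathfinish (Pointed ?Q \<circ> c)"
      using kd[of 0] kd[of 1] e n n' by (auto simp: pathstart_def pathfinish_def)
  qed (use c(1) path_d in \<open>auto simp: pathin_realise\<close>)
  then show "\<exists>d. pathin Z d \<and> d 0 = w \<and> path_homotopic ?Q (?k \<circ> d) c"
    using d u e(3) by (intro exI[of _ ?d]) auto
qed

text \<open>The class of \<open>u\<close> is represented by the image of any path from \<open>z0\<close> to \<open>u z0\<close>. An element with a
  fixed point \<open>w\<close> is trivial because the path can be chosen to run through \<open>w\<close> and back along its own
  translate; conversely the covering of the orbit space by the orbit space of \<open>M\<close> detects all elements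
  outside \<open>M\<close>.\<close>

theorem fundamental_group_orbit_space:
  assumes sc: "simply_connected (realise Z)" and M: "M \<lhd> K" and z0: "z0 \<in> topspace Z"
    and wander: "\<And>z. z \<in> topspace Z \<Longrightarrow> \<exists>N. openin Z N \<and> z \<in> N \<and> (\<forall>u\<in>carrier K. \<alpha> u ` N \<inter> N \<noteq> {} \<longrightarrow> u \<in> M)"
    and lift: "\<And>z. z \<in> topspace Z \<Longrightarrow> \<exists>N. openin Z N \<and> z \<in> N \<and> lifts_paths_over (carrier K) N"
    and fixed: "\<And>s. s \<in> S \<Longrightarrow> s \<in> carrier K \<and> (\<exists>z\<in>topspace Z. \<alpha> s z = z)"
    and generated: "\<And>N. N \<lhd> K \<Longrightarrow> S \<subseteq> N \<Longrightarrow> M \<subseteq> N"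
  obtains q where "q \<in> epi K (fundamental_group (orbit_space Z (carrier K) \<alpha>) (orbit_proj (carrier K) z0))"
    "group (fundamental_group (orbit_space Z (carrier K) \<alpha>) (orbit_proj (carrier K) z0))"
    "kernel K (fundamental_group (orbit_space Z (carrier K) \<alpha>) (orbit_proj (carrier K) z0)) q = M"
proof -
  let ?U = "carrier K"
  let ?Q = "orbit_space Z ?U \<alpha>" and ?k = "orbit_proj ?U"
  let ?y = "?k z0"
  let ?F = "fundamental_group ?Q ?y"
  have subU: "subgroup ?U K" by (rule subgroup_self)
  have subM: "subgroup M K" using M by (rule normal_imp_subgroup)
  have pc: "path_connected (realise Z)" using sc by (rule simply_connected_imp_path_connected_gen)
  note contk = continuous_map_orbit_proj[OF subU]
  have k_action: "?k \<circ> (\<alpha> u \<circ> c) = ?k \<circ> c" if "u \<in> ?U" "\<And>t. c t \<in> topspace Z" for u and c :: "real \<Rightarrow> 'z"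
    using that orbit_proj_action[OF subU] by (auto simp: fun_eq_iff)
  have pathin_k: "pathin ?Q (?k \<circ> c)" if "pathin Z c" for c
    using that contk unfolding pathin_def by (rule continuous_map_compose)
  define conn where "conn u c \<longleftrightarrow> pathin Z c \<and> c 0 = z0 \<and> c 1 = \<alpha> u z0" for u c
  define p where "p u = (SOME c. conn u c)" for u
  have p: "conn u (p u)" if u: "u \<in> ?U" for u
  proof -
    obtain c where "pathin Z c" "c 0 = z0" "c 1 = \<alpha> u z0"
      using path_connected_realise_pathin[OF pc z0 action_closed[OF u z0]] by metis
    then show ?thesis unfolding p_def conn_def by (intro someI_ex[of "\<lambda>c. pathin Z c \<and> c 0 = z0 \<and> c 1 = \<alpha> u z0"]) blast
  qed
  have k_loop: "?k \<circ> c \<in> loops_at ?Q ?y" if "conn u c" "u \<in> ?U" for u c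
    using that pathin_k orbit_proj_action[OF subU _ z0] by (auto simp: loops_at_def conn_def)
  define q where "q u = loop_class ?Q ?y (?k \<circ> p u)" for u
  have q_eq: "q u = loop_class ?Q ?y (?k \<circ> c)" if "conn u c" "u \<in> ?U" for u c
  proof -
    have "path_homotopic Z (p u) c"
      using p[OF that(2)] that(1) by (intro simply_connected_realise_path_homotopic[OF sc]) (auto simp: conn_def)
    then have "path_homotopic ?Q (?k \<circ> p u) (?k \<circ> c)" using contk by (rule path_homotopic_continuous_image)
    then show ?thesis
      unfolding q_def loop_class_eq_iff[OF k_loop[OF p[OF that(2)] that(2)] k_loop[OF that]] .
  qed
  have carrier_F: "carrier ?F = loop_class ?Q ?y ` loops_at ?Q ?y" and one_F: "\<one>\<^bsub>?F\<^esub> = loop_class ?Q ?y (\<lambda>_. ?y)"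
    by (auto simp: fundamental_group_def)
  have const_loop: "(\<lambda>_. ?y) \<in> loops_at ?Q ?y"
    using k_loop[of \<one> "\<lambda>_. z0"] z0 by (auto simp: conn_def action_one o_def)
  have act_pathin: "pathin Z (\<alpha> u \<circ> c)" if "u \<in> ?U" "pathin Z c" for u c
    using that continuous_action unfolding pathin_def by (metis continuous_map_compose)
  have hom: "q \<in> hom K ?F"
  proof (rule homI)
    fix u assume u: "u \<in> ?U"
    then show "q u \<in> carrier ?F" unfolding carrier_F q_def using k_loop[OF p] by blast
    fix v assume v: "v \<in> ?U"
    let ?c = "concat_loops (p u) (\<alpha> u \<circ> p v)"
    have pp: "conn u (p u)" "conn v (p v)" using p u v by auto
    have "conn (u \<otimes> v) ?c"
      unfolding conn_def
    proof (intro conjI)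
      show "pathin Z ?c"
        using pp act_pathin[OF u] by (intro pathin_concat_loops) (simp_all add: conn_def)
      show "?c 0 = z0" "?c 1 = \<alpha> (u \<otimes> v) z0"
        using pp action_mult[OF u v z0] by (simp_all add: conn_def)
    qed
    then have "q (u \<otimes> v) = loop_class ?Q ?y (?k \<circ> ?c)" using q_eq u v by blast
    also have "\<dots> = loop_class ?Q ?y (concat_loops (?k \<circ> p u) (?k \<circ> p v))"
    proof -
      have "concat_loops (?k \<circ> p u) (?k \<circ> p v) \<in> loops_at ?Q ?y"
        using k_loop[OF pp(1) u] k_loop[OF pp(2) v] by (rule concat_loops_in_loops_at)
      \<comment> \<open>On the second half the translation by \<open>u\<close> disappears under the
        projection. This uses that \<open>p v\<close> lies in \<open>topspace Z\<close>, which is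
        known for parameters in \<open>{0..1}\<close>.\<close>
      moreover have eq: "(?k \<circ> ?c) t = concat_loops (?k \<circ> p u) (?k \<circ> p v) t" if "t \<in> {0..1}" for t
      proof -
        have "p v (2 * t - 1) \<in> topspace Z" if "\<not> t \<le> 1/2"
          using pp(2) \<open>t \<in> {0..1}\<close> that unfolding conn_def pathin_def continuous_map_def by (auto simp: Pi_iff)
        then show ?thesis using orbit_proj_action[OF subU u] by (auto simp: concat_loops_def)
      qed
      moreover have "?k \<circ> ?c \<in> loops_at ?Q ?y" using k_loop[OF \<open>conn (u \<otimes> v) ?c\<close>] u v by simp
      moreover have "path_homotopic ?Q (?k \<circ> ?c) (concat_loops (?k \<circ> p u) (?k \<circ> p v))"
        using eq \<open>?k \<circ> ?c \<in> loops_at ?Q ?y\<close> by (intro homotopic_paths_eq) (auto simp: loops_at_def pathin_realise)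
      ultimately show ?thesis by (simp add: loop_class_eq_iff)
    qed
    also have "\<dots> = q u \<otimes>\<^bsub>?F\<^esub> q v"
      unfolding q_def by (rule mult_loop_class[symmetric, OF k_loop[OF pp(1) u] k_loop[OF pp(2) v]])
    finally show "q (u \<otimes> v) = q u \<otimes>\<^bsub>?F\<^esub> q v" .
  qed
  have surj: "q ` ?U = carrier ?F"
  proof
    show "q ` ?U \<subseteq> carrier ?F" using hom by (auto simp: hom_def)
    show "carrier ?F \<subseteq> q ` ?U"
    proof
      fix x assume "x \<in> carrier ?F"
      then obtain c where c: "c \<in> loops_at ?Q ?y" "x = loop_class ?Q ?y c" by (auto simp: carrier_F)
      then have "pathin ?Q c" "?k z0 = c 0" by (auto simp: loops_at_def)
      then obtain d where d: "pathin Z d" "d 0 = z0" "path_homotopic ?Q (?k \<circ> d) c"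
        using path_lifting_orbit_space[OF subU lift _ z0] by metis
      have "?k (d 1) = ?y"
        using homotopic_paths_imp_pathfinish[OF d(3)] c(1) by (auto simp: pathfinish_def loops_at_def)
      moreover have "d 1 \<in> topspace Z" using d(1) by (auto simp: pathin_def continuous_map_def)
      ultimately obtain u where u: "u \<in> ?U" "d 1 = \<alpha> u z0"
        using orbit_proj_eq_iff[OF subU z0, of "d 1"] by auto
      then have "conn u d" using d by (simp add: conn_def)
      then have "q u = x" using q_eq u(1) k_loop c d(3) by (simp add: loop_class_eq_iff)
      then show "x \<in> q ` ?U" using u by auto
    qed
  qed
  have q_one: "q \<one> = \<one>\<^bsub>?F\<^esub>"
    unfolding one_F using q_eq[of \<one> "\<lambda>_. z0"] z0 by (simp add: conn_def action_one o_def)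
  \<comment> \<open>The image of a group under a multiplicative map is a group, so surjectivity of
    \<open>q\<close> yields associativity and inverses in the fundamental group without any
    homotopies of loops.\<close>
  have groupF: "group ?F"
  proof -
    have "group (?F\<lparr>carrier := q ` ?U, one := q \<one>\<rparr>)" using hom by (rule hom_imp_img_group)
    then show ?thesis unfolding surj q_one by simp
  qed
  interpret q: group_hom K ?F q
    using groupF hom is_group by (simp add: group_hom_def group_hom_axioms_def)
  have one_iff: "q u = \<one>\<^bsub>?F\<^esub> \<longleftrightarrow> path_homotopic ?Q (?k \<circ> c) (\<lambda>_. ?y)" if "conn u c" "u \<in> ?U" for u c
    unfolding one_F q_eq[OF that] by (rule loop_class_eq_iff[OF k_loop[OF that] const_loop])
  have "M \<subseteq> kernel K ?F q"
  proof (rule generated)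
    show "kernel K ?F q \<lhd> K" by (rule q.normal_kernel)
    show "S \<subseteq> kernel K ?F q"
    proof
      fix s assume "s \<in> S"
      then obtain w where s: "s \<in> ?U" and w: "w \<in> topspace Z" "\<alpha> s w = w" using fixed by blast
      obtain c where c: "pathin Z c" "c 0 = z0" "c 1 = w"
        using path_connected_realise_pathin[OF pc z0 w(1)] by metis
      \<comment> \<open>Out along \<open>c\<close> to the fixed point \<open>w\<close>, then back
        along the translate of \<open>c\<close> by \<open>s\<close>: the path ends at
        \<open>\<alpha> s z0\<close>, while in the orbit space it runs along one path and
        back.\<close>
      let ?d = "concat_loops c (\<alpha> s \<circ> (c \<circ> (\<lambda>t. 1 - t)))"
      have rev: "pathin Z (\<alpha> s \<circ> (c \<circ> (\<lambda>t. 1 - t)))" using act_pathin[OF s pathin_reverse[OF c(1)]] .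
      have d: "conn s ?d"
        using c rev w by (auto simp: conn_def intro!: pathin_concat_loops)
      have kc: "pathin ?Q (?k \<circ> c)" using pathin_k[OF c(1)] .
      have "path_homotopic ?Q (?k \<circ> ?d) (concat_loops (?k \<circ> c) (?k \<circ> c \<circ> (\<lambda>t. 1 - t)))"
      proof (rule homotopic_paths_eq)
        show "path (Pointed ?Q \<circ> (?k \<circ> ?d))" "path_image (Pointed ?Q \<circ> (?k \<circ> ?d)) \<subseteq> realise ?Q"
          using k_loop[OF d s] by (auto simp: loops_at_def pathin_realise)
        fix t :: real assume t: "t \<in> {0..1}"
        have "c (1 - (2 * t - 1)) \<in> topspace Z" if "\<not> t \<le> 1/2"
          using c(1) t that unfolding pathin_def continuous_map_def by (auto simp: Pi_iff)
        then show "(Pointed ?Q \<circ> (?k \<circ> ?d)) t =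
            (Pointed ?Q \<circ> concat_loops (?k \<circ> c) (?k \<circ> c \<circ> (\<lambda>t. 1 - t))) t"
          using orbit_proj_action[OF subU s] by (auto simp: concat_loops_def)
      qed
      also have "path_homotopic ?Q (concat_loops (?k \<circ> c) (?k \<circ> c \<circ> (\<lambda>t. 1 - t))) (\<lambda>_. ?y)"
      proof -
        have "homotopic_paths (realise ?Q) ((Pointed ?Q \<circ> (?k \<circ> c)) +++ reversepath (Pointed ?Q \<circ> (?k \<circ> c)))
            (\<lambda>_. pathstart (Pointed ?Q \<circ> (?k \<circ> c)))"
          using kc unfolding pathin_realise by (intro homotopic_paths_rinv_const) auto
        then show ?thesis
          unfolding Pointed_concat_loops reversepath_Pointed using c(2) by (simp add: pathstart_def o_def)
      qed
      finally have "path_homotopic ?Q (?k \<circ> ?d) (\<lambda>_. ?y)" .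
      then show "s \<in> kernel K ?F q" using one_iff[OF d s] s by (simp add: kernel_def)
    qed
  qed
  moreover have "kernel K ?F q \<subseteq> M"
  proof
    fix u assume "u \<in> kernel K ?F q"
    then have u: "u \<in> ?U" "q u = \<one>\<^bsub>?F\<^esub>" by (auto simp: kernel_def)
    let ?Y = "orbit_space Z M \<alpha>" and ?r = "\<lambda>C. \<Union>z\<in>C. ?k z"
    let ?h = "Pointed ?Y \<circ> (orbit_proj M \<circ> p u)"
    note pu = p[OF u(1)]
    have topp: "p u t \<in> topspace Z" if "t \<in> {0..1}" for t
      using pu that by (auto simp: conn_def pathin_def continuous_map_def Pi_iff)
    have r: "?r (orbit_proj M z) = ?k z" if "z \<in> topspace Z" for z
      using covering_space_orbit_spaces(2)[OF M wander that] .
    have "pathin ?Y (orbit_proj M \<circ> p u)"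
      using pu continuous_map_orbit_proj[OF subM] unfolding conn_def pathin_def by (metis continuous_map_compose)
    then have h: "path ?h" "path_image ?h \<subseteq> realise ?Y" by (auto simp: pathin_realise)
    have cov: "covering_space (realise ?Y) (realise_map ?Q ?r) (realise ?Q)"
      by (rule covering_space_orbit_spaces(1)[OF M]) (rule wander)
    have "homotopic_paths (realise ?Q) (Pointed ?Q \<circ> (?k \<circ> p u)) (realise_map ?Q ?r \<circ> ?h)"
      using k_loop[OF pu u(1)] topp r by (intro homotopic_paths_eq) (auto simp: loops_at_def pathin_realise)
    moreover have "homotopic_paths (realise ?Q) (Pointed ?Q \<circ> (?k \<circ> p u)) (\<lambda>_. Pointed ?Q ?y)"
      using one_iff[OF pu u(1)] u(2) by (simp add: o_def)
    ultimately have "homotopic_paths (realise ?Q) (realise_map ?Q ?r \<circ> ?h) (\<lambda>_. Pointed ?Q ?y)"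
      by (rule homotopic_paths_trans[OF homotopic_paths_sym])
    \<comment> \<open>The projection of \<open>p u\<close> to the orbit space of \<open>M\<close>
      lifts a null-homotopic loop, so it closes up there.\<close>
    then have "pathfinish ?h = pathstart ?h"
      by (rule covering_space_null_homotopic_lift_closed[OF cov h])
    then have "orbit_proj M z0 = orbit_proj M (\<alpha> u z0)"
      using pu by (auto simp: conn_def pathstart_def pathfinish_def)
    then obtain m where m: "m \<in> M" "\<alpha> u z0 = \<alpha> m z0"
      using orbit_proj_eq_iff[OF subM z0 action_closed[OF u(1) z0]] by auto
    then have mU: "m \<in> ?U" using subM subgroup.mem_carrier by metis
    obtain N where N: "z0 \<in> N" "\<And>u. u \<in> ?U \<Longrightarrow> \<alpha> u ` N \<inter> N \<noteq> {} \<Longrightarrow> u \<in> M" using wander[OF z0] by blast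
    \<comment> \<open>The action need not be free at \<open>z0\<close>, but \<open>wander\<close>
      places the whole stabiliser of \<open>z0\<close> in \<open>M\<close>.\<close>
    have "\<alpha> (inv m \<otimes> u) z0 = z0" using u mU z0 m by (simp add: action_mult)
    then have "inv m \<otimes> u \<in> M" using N u mU by (intro N(2)) (auto simp: image_iff disjoint_iff intro!: bexI[of _ z0])
    then have "m \<otimes> (inv m \<otimes> u) \<in> M" using subgroup.m_closed[OF subM m(1)] by blast
    then show "u \<in> M" using u mU by (simp flip: m_assoc)
  qed
  ultimately show ?thesis using that[of q] hom surj groupF by (auto simp: epi_def)
qed

end

section \<open>The classifying space as a quotient\<close>

lemma vimage_Inl_Inr [simp]: "Inl -` (Inl ` A \<union> Inr ` B) = A" "Inr -` (Inl ` A \<union> Inr ` B) = B"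
  by auto

lemma topspace_disjoint_sum: "topspace (disjoint_sum X Y) = Inl ` topspace X \<union> Inr ` topspace Y"
proof (rule antisym)
  have "openin X (Inl -` topspace (disjoint_sum X Y)) \<and> openin Y (Inr -` topspace (disjoint_sum X Y))"
    using openin_topspace unfolding openin_disjoint_sum[symmetric] .
  then have *: "Inl -` topspace (disjoint_sum X Y) \<subseteq> topspace X" "Inr -` topspace (disjoint_sum X Y) \<subseteq> topspace Y"
    by (auto dest: openin_subset)
  show "topspace (disjoint_sum X Y) \<subseteq> Inl ` topspace X \<union> Inr ` topspace Y"
  proof
    fix x assume "x \<in> topspace (disjoint_sum X Y)"
    then show "x \<in> Inl ` topspace X \<union> Inr ` topspace Y" using * by (cases x) auto
  qed
  have "openin (disjoint_sum X Y) (Inl ` topspace X \<union> Inr ` topspace Y)"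
    unfolding openin_disjoint_sum vimage_Inl_Inr by simp
  then show "Inl ` topspace X \<union> Inr ` topspace Y \<subseteq> topspace (disjoint_sum X Y)"
    by (rule openin_subset)
qed

lemma continuous_map_from_disjoint_sum:
  "continuous_map (disjoint_sum X Y) T f \<longleftrightarrow>
     continuous_map X T (\<lambda>x. f (Inl x)) \<and> continuous_map Y T (\<lambda>y. f (Inr y))"
proof -
  have "openin (disjoint_sum X Y) {x \<in> topspace (disjoint_sum X Y). f x \<in> W} \<longleftrightarrow>
      openin X {x \<in> topspace X. f (Inl x) \<in> W} \<and> openin Y {y \<in> topspace Y. f (Inr y) \<in> W}" for W
  proof -
    have "{x \<in> topspace (disjoint_sum X Y). f x \<in> W} =
        Inl ` {x \<in> topspace X. f (Inl x) \<in> W} \<union> Inr ` {y \<in> topspace Y. f (Inr y) \<in> W}"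
      by (auto simp: topspace_disjoint_sum)
    then show ?thesis by (simp only: openin_disjoint_sum vimage_Inl_Inr)
  qed
  then show ?thesis
    unfolding continuous_map_def by (auto simp: topspace_disjoint_sum Pi_iff)
qed

lemma continuous_map_Inl: "continuous_map X (disjoint_sum X Y) Inl"
  and continuous_map_Inr: "continuous_map Y (disjoint_sum X Y) Inr"
  using continuous_map_from_disjoint_sum[of X Y "disjoint_sum X Y" "\<lambda>x. x"] by auto

lemma quotient_map_id_self: "quotient_map X X id"
proof -
  have "{x \<in> topspace X. x \<in> W} = W" if "W \<subseteq> topspace X" for W using that by auto
  then show ?thesis by (simp add: quotient_map_def)
qed

lemma quotient_map_map_sum:
  assumes f: "quotient_map X X' f" and g: "quotient_map Y Y' g"
  shows "quotient_map (disjoint_sum X Y) (disjoint_sum X' Y') (map_sum f g)"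
  unfolding quotient_map_def
proof (intro conjI allI impI)
  show "map_sum f g ` topspace (disjoint_sum X Y) = topspace (disjoint_sum X' Y')"
    using f g by (simp add: quotient_map_def topspace_disjoint_sum image_Un image_image flip: image_image[of Inl f] image_image[of Inr g])
  fix W assume W: "W \<subseteq> topspace (disjoint_sum X' Y')"
  then have W': "Inl -` W \<subseteq> topspace X'" "Inr -` W \<subseteq> topspace Y'" by (auto simp: topspace_disjoint_sum)
  have "{x \<in> topspace (disjoint_sum X Y). map_sum f g x \<in> W} =
      Inl ` {x \<in> topspace X. f x \<in> Inl -` W} \<union> Inr ` {y \<in> topspace Y. g y \<in> Inr -` W}"
    by (auto simp: topspace_disjoint_sum)
  moreover have "openin X {x \<in> topspace X. f x \<in> Inl -` W} = openin X' (Inl -` W)"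
    using f W' unfolding quotient_map_def by blast
  moreover have "openin Y {y \<in> topspace Y. g y \<in> Inr -` W} = openin Y' (Inr -` W)"
    using g W' unfolding quotient_map_def by blast
  ultimately show "openin (disjoint_sum X Y) {x \<in> topspace (disjoint_sum X Y). map_sum f g x \<in> W} =
      openin (disjoint_sum X' Y') W"
    by (simp only: openin_disjoint_sum vimage_Inl_Inr)
qed

text \<open>The slice over each \<open>g\<close> is open because the first factor is discrete, so
  continuity is a matter of the slices.\<close>

lemma continuous_map_from_discrete_prod:
  "continuous_map (prod_topology (discrete_topology D) X) T f \<longleftrightarrow>
     (\<forall>g\<in>D. continuous_map X T (\<lambda>x. f (g, x)))"
proof
  assume f: "continuous_map (prod_topology (discrete_topology D) X) T f"
  have "continuous_map X (prod_topology (discrete_topology D) X) (\<lambda>x. (g, x))" if "g \<in> D" for g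
    using that by (simp add: continuous_map_pairwise o_def)
  from continuous_map_compose[OF this f] show "\<forall>g\<in>D. continuous_map X T (\<lambda>x. f (g, x))"
    by (simp add: o_def)
next
  assume f: "\<forall>g\<in>D. continuous_map X T (\<lambda>x. f (g, x))"
  show "continuous_map (prod_topology (discrete_topology D) X) T f"
    unfolding continuous_map_def
  proof (intro conjI allI impI)
    show "f \<in> topspace (prod_topology (discrete_topology D) X) \<rightarrow> topspace T"
      using f by (auto simp: continuous_map_def Pi_iff)
    fix W assume W: "openin T W"
    have "openin X {x \<in> topspace X. f (g, x) \<in> W}" if "g \<in> D" for g
      using f that W by (auto simp: continuous_map_def)
    then show "openin (prod_topology (discrete_topology D) X)
        {x \<in> topspace (prod_topology (discrete_topology D) X). f x \<in> W}"
      unfolding openin_prod_topology_alt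
    proof (intro allI impI)
      fix g x
      assume W': "\<And>g. g \<in> D \<Longrightarrow> openin X {x \<in> topspace X. f (g, x) \<in> W}"
        and "(g, x) \<in> {x \<in> topspace (prod_topology (discrete_topology D) X). f x \<in> W}"
      then show "\<exists>U V. openin (discrete_topology D) U \<and> openin X V \<and> g \<in> U \<and> x \<in> V \<and>
          U \<times> V \<subseteq> {x \<in> topspace (prod_topology (discrete_topology D) X). f x \<in> W}"
        by (intro exI[of _ "{g}"] exI[of _ "{x \<in> topspace X. f (g, x) \<in> W}"]) auto
    qed
  qed
qed

text \<open>The data from which the classifying space is built, detached from knots: a covering
  space action on \<open>E\<close> and an injective plane in \<open>E\<close> on which the powers of
  \<open>a\<close> and \<open>l\<close> act as the integer translations.\<close>

locale egg = group_action G E act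
  for G :: "('g, 'm) monoid_scheme" (structure) and E :: "'e::topological_space set" and act +
  fixes a l :: 'g and \<phi> :: "real \<times> real \<Rightarrow> 'e"
  assumes continuous_act: "g \<in> carrier G \<Longrightarrow> continuous_on E (act g)"
    and wandering: "e \<in> E \<Longrightarrow> \<exists>N. openin (top_of_set E) N \<and> e \<in> N \<and> (\<forall>g\<in>carrier G. act g ` N \<inter> N \<noteq> {} \<longrightarrow> g = \<one>)"
    and a_l [simp]: "a \<in> carrier G" "l \<in> carrier G"
    and continuous_phi: "continuous_on UNIV \<phi>" and phi_in [simp]: "\<phi> v \<in> E" and inj_phi: "inj \<phi>"
    and phi_chart: "\<phi> (s + of_int i, t + of_int j) = act (a [^] (i::int) \<otimes> l [^] (j::int)) (\<phi> (s, t))"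
begin

section \<open>The peripheral subgroup as a free abelian group on \<open>a\<close> and
  \<open>l\<close>\<close>

sublocale group G using group_hom by (simp add: group_hom_def)

definition per :: "int \<Rightarrow> int \<Rightarrow> 'g" where
  "per i j = a [^] i \<otimes> l [^] j"

lemma per_closed [simp]: "per i j \<in> carrier G"
  by (simp add: per_def)

lemma act_closed [simp]: "g \<in> carrier G \<Longrightarrow> e \<in> E \<Longrightarrow> act g e \<in> E"
  by (rule element_image) auto

lemma act_one [simp]: "e \<in> E \<Longrightarrow> act \<one> e = e"
  using id_eq_one by (metis restrict_apply')

lemma act_mult: "g \<in> carrier G \<Longrightarrow> h \<in> carrier G \<Longrightarrow> e \<in> E \<Longrightarrow> act (g \<otimes> h) e = act g (act h e)"
  by (rule composition_rule)

lemma act_inv [simp]: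
  "g \<in> carrier G \<Longrightarrow> e \<in> E \<Longrightarrow> act (inv g) (act g e) = e" "g \<in> carrier G \<Longrightarrow> e \<in> E \<Longrightarrow> act g (act (inv g) e) = e"
  by (simp_all flip: act_mult)

lemma act_free:
  assumes "g \<in> carrier G" "h \<in> carrier G" "e \<in> E" "act g e = act h e"
  shows "g = h"
proof -
  obtain N where N: "e \<in> N" "\<And>g. g \<in> carrier G \<Longrightarrow> act g ` N \<inter> N \<noteq> {} \<Longrightarrow> g = \<one>"
    using wandering[OF assms(3)] by blast
  have "act (inv h \<otimes> g) e = e" using assms by (simp add: act_mult)
  then have "inv h \<otimes> g = \<one>" using N assms by (intro N(2)) force+
  then show ?thesis using assms by (metis inv_closed inv_equality inv_inv)
qed

lemma phi_per: "\<phi> (s + of_int i, t + of_int j) = act (per i j) (\<phi> (s, t))"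
  unfolding per_def by (rule phi_chart)

text \<open>That \<open>a\<close> and \<open>l\<close> commute is read off the plane: both sides
  move \<open>\<phi> (0, 0)\<close> to the same point, and the action is free.\<close>

lemma per_mult: "per i j \<otimes> per i' j' = per (i + i') (j + j')"
proof (rule act_free)
  have "act (per i j \<otimes> per i' j') (\<phi> (0, 0)) = \<phi> (of_int i' + of_int i, of_int j' + of_int j)"
    using phi_per[of 0 i' 0 j'] by (simp add: act_mult phi_per)
  also have "\<dots> = act (per (i + i') (j + j')) (\<phi> (0, 0))"
    using phi_per[of 0 "i + i'" 0 "j + j'"] by (simp add: add.commute)
  finally show "act (per i j \<otimes> per i' j') (\<phi> (0, 0)) = act (per (i + i') (j + j')) (\<phi> (0, 0))" .
qed auto

lemma per_zero [simp]: "per 0 0 = \<one>"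
  by (simp add: per_def)

lemma inv_per: "inv (per i j) = per (- i) (- j)"
  by (rule inv_equality) (auto simp: per_mult)

text \<open>Injectivity of \<open>\<phi>\<close> separates the translates of the origin, so
  \<open>per\<close> embeds the integer lattice. This is what makes \<open>peripheral_coords\<close>
  well defined.\<close>

lemma per_inject: "per i j = per i' j' \<longleftrightarrow> i = i' \<and> j = j'"
proof
  assume "per i j = per i' j'"
  then have "\<phi> (of_int i, of_int j) = \<phi> (of_int i', of_int j')"
    using phi_per[of 0 i 0 j] phi_per[of 0 i' 0 j'] by simp
  then have "(real_of_int i, real_of_int j) = (real_of_int i', real_of_int j')" by (rule injD[OF inj_phi])
  then show "i = i' \<and> j = j'" by simp
qed auto

lemma generate_eq_range_per: "generate G {a, l} = range (\<lambda>(i, j). per i j)"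
proof (intro equalityI subsetI)
  fix x assume "x \<in> generate G {a, l}"
  then have "\<exists>i j. x = per i j"
  proof induction
    case one then show ?case using per_zero by metis
  next
    case (incl h)
    have "a = per 1 0" "l = per 0 1" by (auto simp: per_def)
    then show ?case using incl by blast
  next
    case (inv h)
    have "a = per 1 0" "l = per 0 1" by (auto simp: per_def)
    then show ?case using inv inv_per by (metis empty_iff insert_iff)
  next
    case (eng x y) then show ?case using per_mult by metis
  qed
  then show "x \<in> range (\<lambda>(i, j). per i j)" by auto
next
  fix x assume "x \<in> range (\<lambda>(i, j). per i j)"
  then obtain i j where "x = per i j" by auto
  then have x: "x = a [^] i \<otimes> l [^] j" by (simp add: per_def)
  have "subgroup (generate G {a, l}) G" by (rule generate_is_subgroup) auto
  then show "x \<in> generate G {a, l}"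
    unfolding x by (intro subgroup.m_closed subgroup_int_pow_closed) (auto intro: generate.incl)
qed

lemma peripheral_coords_per: "peripheral_coords G a l (per i j) = (i, j)"
  unfolding peripheral_coords_def
  by (rule the_equality) (auto simp: per_inject simp flip: per_def)

section \<open>The mapping cylinder as a quotient of a slab\<close>

abbreviation slab :: "((real \<times> real) \<times> real) topology" where
  "slab \<equiv> prod_topology euclidean (top_of_set {0..1})"

abbreviation translate :: "int \<Rightarrow> int \<Rightarrow> (real \<times> real) \<times> real \<Rightarrow> (real \<times> real) \<times> real" where
  "translate i j \<equiv> \<lambda>((s, t), r). ((s + of_int i, t + of_int j), r)"

definition cyl_class :: "((real \<times> real) \<times> real) + real \<Rightarrow> (((real \<times> real) \<times> real) + real) set" where
  "cyl_class = ident_class (disjoint_sum slab euclidean) (glue_rel (cyl_rel euclidean snd))"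

lemma plane_cylinder_eq:
  "plane_cylinder = identification_space (disjoint_sum slab euclidean) (glue_rel (cyl_rel euclidean snd))"
  by (simp add: mapping_cylinder_def glue_def)

lemma cyl_end_eq: "cyl_end euclidean euclidean snd v = cyl_class (Inl (v, 0))"
  by (simp add: cyl_end_def cyl_class_def ident_class_def)

lemma quotient_map_cyl_class: "quotient_map (disjoint_sum slab euclidean) plane_cylinder cyl_class"
  unfolding plane_cylinder_eq cyl_class_def by (rule quotient_map_ident_class)

lemma cyl_class_line: "cyl_class (Inl ((s, t), 1)) = cyl_class (Inr t)"
  unfolding cyl_class_def
  by (rule ident_class_eqI) (auto simp: glue_rel_def cyl_rel_def topspace_disjoint_sum)

text \<open>Since the projection of the plane to the line is itself a quotient map, the line need not be
  mentioned in the description of the mapping cylinder.\<close>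

lemma quotient_map_slab: "quotient_map slab plane_cylinder (\<lambda>y. cyl_class (Inl y))"
  unfolding quotient_map_def
proof (intro conjI allI impI)
  have line: "cyl_class (Inr t) \<in> (\<lambda>y. cyl_class (Inl y)) ` topspace slab" for t
    using cyl_class_line[of 0 t] by (intro image_eqI[of _ _ "((0, t), 1)"]) auto
  have "topspace plane_cylinder = cyl_class ` (Inl ` topspace slab \<union> Inr ` topspace euclidean)"
    using quotient_map_cyl_class unfolding quotient_map_def topspace_disjoint_sum by simp
  also have "\<dots> = (\<lambda>y. cyl_class (Inl y)) ` topspace slab"
    unfolding image_Un image_image using line by blast
  finally show "(\<lambda>y. cyl_class (Inl y)) ` topspace slab = topspace plane_cylinder" ..
  fix W assume W: "W \<subseteq> topspace plane_cylinder"
  let ?P = "{y \<in> topspace slab. cyl_class (Inl y) \<in> W}"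
  \<comment> \<open>Openness on the line is tested along a section of the projection, taking
    \<open>t\<close> to \<open>((0, t), 1)\<close>; any other constant in place of 0 would
    do.\<close>
  have "openin (euclidean :: real topology) {t. cyl_class (Inr t) \<in> W}" if P: "openin slab ?P"
  proof -
    have "continuous_map euclidean slab (\<lambda>t::real. ((0, t), 1))"
      by (auto simp: continuous_map_pairwise o_def intro!: continuous_intros)
    then have "openin euclidean {t \<in> topspace euclidean. ((0, t), 1) \<in> ?P}"
      using P by (rule openin_continuous_map_preimage)
    then show ?thesis by (simp add: cyl_class_line)
  qed
  moreover have "openin plane_cylinder W \<longleftrightarrow> openin slab ?P \<and> openin euclidean {t. cyl_class (Inr t) \<in> W}"
  proof -
    have "{x \<in> topspace (disjoint_sum slab euclidean). cyl_class x \<in> W} = Inl ` ?P \<union> Inr ` {t. cyl_class (Inr t) \<in> W}"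
      by (auto simp: topspace_disjoint_sum)
    then have "openin (disjoint_sum slab euclidean) {x \<in> topspace (disjoint_sum slab euclidean). cyl_class x \<in> W} \<longleftrightarrow>
        openin slab ?P \<and> openin euclidean {t. cyl_class (Inr t) \<in> W}"
      by (simp only: openin_disjoint_sum vimage_Inl_Inr)
    then show ?thesis using quotient_map_cyl_class W unfolding quotient_map_def by blast
  qed
  ultimately show "openin slab ?P = openin plane_cylinder W" by blast
qed

lemma topspace_plane_cylinder: "topspace plane_cylinder = (\<lambda>y. cyl_class (Inl y)) ` topspace slab"
  using quotient_map_slab by (simp add: quotient_map_def)

lemma cylinder_action_per:
  assumes "r \<in> {0..1}"
  shows "cylinder_action G a l (per i j) (cyl_class (Inl ((s, t), r))) = cyl_class (Inl (translate i j ((s, t), r)))"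
proof -
  let ?b = "\<lambda>i j. map_sum (translate i j) (\<lambda>t. t + of_int j)"
  have "?b i j ` cyl_class (Inl ((s, t), r)) = cyl_class (?b i j (Inl ((s, t), r)))"
    unfolding cyl_class_def
    by (rule image_ident_class[where b' = "?b (- i) (- j)"])
       (use assms in \<open>auto simp: glue_rel_def cyl_rel_def topspace_disjoint_sum\<close>)
  then show ?thesis by (simp add: cylinder_action_def peripheral_coords_per)
qed

section \<open>The balanced product, the gluing, and common coordinates for both\<close>

abbreviation cyl_act where "cyl_act \<equiv> cylinder_action G a l"

abbreviation per_group where "per_group \<equiv> peripheral_subgroup G a l"

abbreviation bal_rel where "bal_rel \<equiv> balanced_rel G per_group cyl_act plane_cylinder"

abbreviation bal_prod where "bal_prod \<equiv> balanced_product G per_group cyl_act plane_cylinder"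

definition bal_class where
  "bal_class = ident_class (prod_topology (discrete_topology (carrier G)) plane_cylinder) bal_rel"

definition egg_rel where
  "egg_rel = glue_rel {(bal_class (g, cyl_class (Inl (v, 0))), act g (\<phi> v)) |g v. g \<in> carrier G}"

definition egg_class where
  "egg_class = ident_class (disjoint_sum bal_prod (top_of_set E)) egg_rel"

abbreviation Z where "Z \<equiv> egg_space G a l E act \<phi>"

text \<open>One map replaces three nested quotients. In \<open>Inl (g, ((s, t), r))\<close> the
  label \<open>g\<close> picks a slab, \<open>(s, t)\<close> a point of the plane and
  \<open>r\<close> the height: height 0 is glued to \<open>E\<close>, height 1 is pressed to the
  line. In these coordinates the identifications are \<open>kappa_line\<close>,
  \<open>kappa_per\<close> and \<open>kappa_boundary\<close>.\<close>

definition \<kappa> :: "('g \<times> (real \<times> real) \<times> real) + 'e \<Rightarrow> (('g \<times> (((real \<times> real) \<times> real) + real) set) set + 'e) set" where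
  "\<kappa> x = egg_class (map_sum (\<lambda>(g, y). bal_class (g, cyl_class (Inl y))) id x)"

abbreviation \<Omega> :: "(('g \<times> (real \<times> real) \<times> real) + 'e) topology" where
  "\<Omega> \<equiv> disjoint_sum (prod_topology (discrete_topology (carrier G)) slab) (top_of_set E)"

lemma Z_eq: "Z = identification_space (disjoint_sum bal_prod (top_of_set E)) egg_rel"
  unfolding egg_space_def glue_def egg_rel_def bal_class_def ident_class_def balanced_pair_def cyl_end_eq ..

lemma quotient_map_bal_class:
  "quotient_map (prod_topology (discrete_topology (carrier G)) plane_cylinder) bal_prod bal_class"
  unfolding balanced_product_def bal_class_def by (rule quotient_map_ident_class)

lemma quotient_map_bal_slab:
  "quotient_map (prod_topology (discrete_topology (carrier G)) slab) bal_prod (\<lambda>(g, y). bal_class (g, cyl_class (Inl y)))"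
proof -
  \<comment> \<open>A discrete space is locally compact and Hausdorff, so the product of its
    identity with a quotient map remains a quotient map.\<close>
  have "quotient_map (prod_topology (discrete_topology (carrier G)) slab)
      (prod_topology (discrete_topology (carrier G)) plane_cylinder) (\<lambda>(g, y). (g, cyl_class (Inl y)))"
    by (rule quotient_map_prod_right[OF _ _ quotient_map_slab])
       (auto simp: locally_compact_space_discrete_topology Hausdorff_space_discrete_topology)
  from quotient_map_compose[OF this quotient_map_bal_class] show ?thesis
    by (simp add: o_def case_prod_unfold)
qed

lemma quotient_map_kappa: "quotient_map \<Omega> Z \<kappa>"
proof -
  have "quotient_map \<Omega> (disjoint_sum bal_prod (top_of_set E)) (map_sum (\<lambda>(g, y). bal_class (g, cyl_class (Inl y))) id)"
    by (intro quotient_map_map_sum quotient_map_bal_slab) (rule quotient_map_id_self)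
  moreover have "quotient_map (disjoint_sum bal_prod (top_of_set E)) Z egg_class"
    unfolding Z_eq egg_class_def by (rule quotient_map_ident_class)
  ultimately have "quotient_map \<Omega> Z (egg_class \<circ> map_sum (\<lambda>(g, y). bal_class (g, cyl_class (Inl y))) id)"
    by (rule quotient_map_compose)
  then show ?thesis by (simp add: \<kappa>_def[abs_def] o_def)
qed

lemma topspace_\<Omega>: "topspace \<Omega> = Inl ` (carrier G \<times> (UNIV \<times> {0..1})) \<union> Inr ` E"
  by (simp add: topspace_disjoint_sum)

lemma topspace_Z: "topspace Z = \<kappa> ` topspace \<Omega>"
  using quotient_map_kappa by (simp add: quotient_map_def)

lemma openin_Z_iff: "W \<subseteq> topspace Z \<Longrightarrow> openin Z W \<longleftrightarrow> openin \<Omega> {x \<in> topspace \<Omega>. \<kappa> x \<in> W}"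
  using quotient_map_kappa by (simp add: quotient_map_def)

lemma bal_class_in [simp]:
  "g \<in> carrier G \<Longrightarrow> r \<in> {0..1} \<Longrightarrow> bal_class (g, cyl_class (Inl (v, r))) \<in> topspace bal_prod"
proof -
  assume "g \<in> carrier G" "r \<in> {0..1}"
  then have "(g, (v, r)) \<in> topspace (prod_topology (discrete_topology (carrier G)) slab)" by simp
  then have "(\<lambda>(g, y). bal_class (g, cyl_class (Inl y))) (g, (v, r)) \<in> topspace bal_prod"
    using quotient_map_bal_slab unfolding quotient_map_def by blast
  then show ?thesis by simp
qed

lemma kappa_line:
  "\<kappa> (Inl (g, ((s, t), 1))) = \<kappa> (Inl (g, ((s', t), 1)))"
  by (simp add: \<kappa>_def cyl_class_line)

lemma kappa_per:
  assumes "g \<in> carrier G" "r \<in> {0..1}"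
  shows "\<kappa> (Inl (g \<otimes> per i j, ((s, t), r))) = \<kappa> (Inl (g, translate i j ((s, t), r)))"
proof -
  have cyl: "cyl_class (Inl (v, r)) \<in> topspace plane_cylinder" for v
    using assms unfolding topspace_plane_cylinder by auto
  have "per i j \<in> per_group" by (auto simp: generate_eq_range_per)
  then have "((g \<otimes> per i j, cyl_class (Inl ((s, t), r))), (g, cyl_act (per i j) (cyl_class (Inl ((s, t), r))))) \<in> bal_rel"
    unfolding balanced_rel_def using assms(1) cyl by blast
  then have "bal_class (g \<otimes> per i j, cyl_class (Inl ((s, t), r))) = bal_class (g, cyl_class (Inl (translate i j ((s, t), r))))"
    unfolding bal_class_def cylinder_action_per[OF assms(2)] using assms(1) cyl
    by (intro ident_class_eqI) auto
  then show ?thesis by (simp add: \<kappa>_def)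
qed

lemma kappa_boundary:
  assumes "g \<in> carrier G"
  shows "\<kappa> (Inl (g, (v, 0))) = \<kappa> (Inr (act g (\<phi> v)))"
proof -
  have "(Inl (bal_class (g, cyl_class (Inl (v, 0)))), Inr (act g (\<phi> v))) \<in> egg_rel"
    unfolding egg_rel_def glue_rel_def using assms by blast
  then have "egg_class (Inl (bal_class (g, cyl_class (Inl (v, 0))))) = egg_class (Inr (act g (\<phi> v)))"
    unfolding egg_class_def using assms by (intro ident_class_eqI) (auto simp: topspace_disjoint_sum)
  then show ?thesis by (simp add: \<kappa>_def)
qed

text \<open>The converse of the three identities above: a function respecting them factors through
  \<open>\<kappa>\<close>. With truth values for \<open>f\<close> it shows that sets are saturated,
  so equality of nested classes is not unravelled again. The proof descends through the cylinder,
  the balanced product and the gluing in turn.\<close>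

lemma kappa_invariant:
  assumes line: "\<And>g s s' t. g \<in> carrier G \<Longrightarrow> f (Inl (g, ((s, t), 1))) = f (Inl (g, ((s', t), 1)))"
    and per: "\<And>g i j s t r. g \<in> carrier G \<Longrightarrow> r \<in> {0..1} \<Longrightarrow>
        f (Inl (g \<otimes> per i j, ((s, t), r))) = f (Inl (g, translate i j ((s, t), r)))"
    and boundary: "\<And>g v. g \<in> carrier G \<Longrightarrow> f (Inl (g, (v, 0))) = f (Inr (act g (\<phi> v)))"
    and eq: "\<kappa> x = \<kappa> y" and xy: "x \<in> topspace \<Omega>" "y \<in> topspace \<Omega>"
  shows "f x = f y"
proof -
  have "f (Inl x) = f (Inl y)"
    if x: "x \<in> carrier G \<times> topspace slab" and y: "y \<in> carrier G \<times> topspace slab"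
      and eq: "(fst x, cyl_class (Inl (snd x))) = (fst y, cyl_class (Inl (snd y)))" for x y
  proof -
    \<comment> \<open>A point of the line receives the value at first coordinate 0; by
      \<open>line\<close> every other choice gives the same value.\<close>
    define k where "k = (\<lambda>w. case w of Inl z \<Rightarrow> f (Inl (fst x, z)) | Inr t \<Rightarrow> f (Inl (fst x, ((0, t), 1))))"
    have "k (Inl (snd x)) = k (Inl (snd y))"
    proof (rule ident_class_invariant[where f = k])
      show "ident_class (disjoint_sum slab euclidean) (glue_rel (cyl_rel euclidean snd)) (Inl (snd x)) =
          ident_class (disjoint_sum slab euclidean) (glue_rel (cyl_rel euclidean snd)) (Inl (snd y))"
        using eq by (simp add: cyl_class_def)
      show "k v = k w" if "(v, w) \<in> glue_rel (cyl_rel euclidean snd)" for v w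
        using that x line[of "fst x"] by (auto simp: glue_rel_def cyl_rel_def k_def)
    qed (use x y in \<open>auto simp: topspace_disjoint_sum\<close>)
    then have "f (Inl (fst x, snd x)) = f (Inl (fst x, snd y))" by (simp only: k_def sum.case)
    moreover have "fst x = fst y" using eq by simp
    ultimately show ?thesis by (metis prod.collapse)
  qed
  then have "\<exists>F1. \<forall>x. x \<in> carrier G \<times> topspace slab \<longrightarrow> f (Inl x) = F1 (fst x, cyl_class (Inl (snd x)))"
    by (intro function_factors_left_gen[of "\<lambda>x. x \<in> carrier G \<times> topspace slab"
          "\<lambda>x. (fst x, cyl_class (Inl (snd x)))" "\<lambda>x. f (Inl x)", THEN iffD1]) blast
  then obtain F1 where F1: "\<And>g y. g \<in> carrier G \<Longrightarrow> y \<in> topspace slab \<Longrightarrow> f (Inl (g, y)) = F1 (g, cyl_class (Inl y))"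
    by (metis SigmaI fst_conv snd_conv)
  have "F1 x = F1 y"
    if x: "x \<in> carrier G \<times> topspace plane_cylinder" and y: "y \<in> carrier G \<times> topspace plane_cylinder"
      and eq: "bal_class x = bal_class y" for x y
  proof (rule ident_class_invariant[OF _ eq[unfolded bal_class_def]])
    fix v w assume "(v, w) \<in> bal_rel"
    then obtain g h c where ghc: "v = (g \<otimes> h, c)" "w = (g, cyl_act h c)" "g \<in> carrier G" "h \<in> per_group"
      "c \<in> topspace plane_cylinder"
      by (auto simp: balanced_rel_def)
    obtain i j where h: "h = per i j" using ghc(4) by (auto simp: generate_eq_range_per)
    obtain s t r where c: "c = cyl_class (Inl ((s, t), r))" "r \<in> {0..1}"
      using ghc(5) unfolding topspace_plane_cylinder by auto
    have "F1 v = f (Inl (g \<otimes> per i j, ((s, t), r)))" using F1 ghc(3) c h ghc(1) by simp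
    also have "\<dots> = f (Inl (g, translate i j ((s, t), r)))" using per ghc(3) c(2) .
    also have "\<dots> = F1 w" using F1 ghc(3) c h ghc(2) by (simp add: cylinder_action_per[OF c(2)])
    finally show "F1 v = F1 w" .
  qed (use x y in auto)
  then have "\<exists>F2. \<forall>x. x \<in> carrier G \<times> topspace plane_cylinder \<longrightarrow> F1 x = F2 (bal_class x)"
    by (intro function_factors_left_gen[of "\<lambda>x. x \<in> carrier G \<times> topspace plane_cylinder" bal_class F1, THEN iffD1]) blast
  then obtain F2 where F2: "\<And>g c. g \<in> carrier G \<Longrightarrow> c \<in> topspace plane_cylinder \<Longrightarrow> F1 (g, c) = F2 (bal_class (g, c))"
    by blast
  have cyl: "cyl_class (Inl y) \<in> topspace plane_cylinder" if "y \<in> topspace slab" for y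
    using that unfolding topspace_plane_cylinder by blast
  define k where "k = (\<lambda>w. case w of Inl B \<Rightarrow> F2 B | Inr e \<Rightarrow> f (Inr e))"
  let ?m = "map_sum (\<lambda>(g, y). bal_class (g, cyl_class (Inl y))) id"
  have k: "k (?m x) = f x" if "x \<in> topspace \<Omega>" for x
    using that F1 F2 cyl by (auto simp: k_def topspace_disjoint_sum)
  have "k (?m x) = k (?m y)"
  proof (rule ident_class_invariant[where f = k])
    show "ident_class (disjoint_sum bal_prod (top_of_set E)) egg_rel (?m x) =
        ident_class (disjoint_sum bal_prod (top_of_set E)) egg_rel (?m y)"
      using eq by (simp add: \<kappa>_def egg_class_def)
    show "k v = k w" if vw: "(v, w) \<in> egg_rel" for v w
    proof -
      obtain g u where "g \<in> carrier G" "v = ?m (Inl (g, (u, 0)))" "w = ?m (Inr (act g (\<phi> u)))"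
        using vw by (force simp: egg_rel_def glue_rel_def)
      then show ?thesis using boundary[of g u] k[of "Inl (g, (u, 0))"] k[of "Inr (act g (\<phi> u))"]
        by (auto simp: topspace_disjoint_sum)
    qed
    show "?m x \<in> topspace (disjoint_sum bal_prod (top_of_set E))"
      "?m y \<in> topspace (disjoint_sum bal_prod (top_of_set E))"
      using xy by (auto simp: topspace_disjoint_sum)
  qed
  then show ?thesis using k xy by simp
qed

section \<open>The action in coordinates\<close>

definition act\<Omega> :: "'g \<Rightarrow> ('g \<times> (real \<times> real) \<times> real) + 'e \<Rightarrow> ('g \<times> (real \<times> real) \<times> real) + 'e" where
  "act\<Omega> u = map_sum (\<lambda>(g, y). (u \<otimes> g, y)) (act u)"

lemma act\<Omega>_closed: "u \<in> carrier G \<Longrightarrow> x \<in> topspace \<Omega> \<Longrightarrow> act\<Omega> u x \<in> topspace \<Omega>"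
  by (auto simp: act\<Omega>_def topspace_disjoint_sum)

lemma image_bal_class:
  assumes u: "u \<in> carrier G" and x: "g \<in> carrier G" "c \<in> topspace plane_cylinder"
  shows "(\<lambda>(k, y). (u \<otimes> k, y)) ` bal_class (g, c) = bal_class (u \<otimes> g, c)"
proof -
  have perG: "h \<in> carrier G" if "h \<in> per_group" for h using that by (auto simp: generate_eq_range_per)
  have rel: "((\<lambda>(k, y). (v \<otimes> k, y)) x, (\<lambda>(k, y). (v \<otimes> k, y)) y) \<in> bal_rel"
    if v: "v \<in> carrier G" and xy: "(x, y) \<in> bal_rel" for v x y
  proof -
    obtain g h c where "x = (g \<otimes> h, c)" "y = (g, cyl_act h c)" "g \<in> carrier G" "h \<in> per_group" "c \<in> topspace plane_cylinder"
      using xy by (auto simp: balanced_rel_def)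
    moreover from this have "v \<otimes> (g \<otimes> h) = (v \<otimes> g) \<otimes> h" using v perG by (simp add: m_assoc)
    moreover have "v \<otimes> g \<in> carrier G" using calculation v by simp
    ultimately show ?thesis unfolding balanced_rel_def by auto
  qed
  have "(\<lambda>(k, y). (u \<otimes> k, y)) ` bal_class (g, c) = bal_class ((\<lambda>(k, y). (u \<otimes> k, y)) (g, c))"
    unfolding bal_class_def
    by (rule image_ident_class[where b' = "\<lambda>(k, y). (inv u \<otimes> k, y)"])
       (use u x rel in \<open>auto simp flip: m_assoc\<close>)
  then show ?thesis by simp
qed

text \<open>Left multiplication changes only the label of a slab and commutes with the right
  multiplications in \<open>bal_rel\<close>. Hence \<open>u\<close> and its inverse preserve all
  generating pairs, and images of classes are classes.\<close>

lemma egg_action_kappa: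
  assumes u: "u \<in> carrier G" and x: "x \<in> topspace \<Omega>"
  shows "egg_action G act u (\<kappa> x) = \<kappa> (act\<Omega> u x)"
proof -
  let ?m = "map_sum (\<lambda>(g, y). bal_class (g, cyl_class (Inl y))) id"
  let ?b = "\<lambda>u. map_sum (image (\<lambda>(k, y). (u \<otimes> k, y))) (act u)"
  have bal: "image (\<lambda>(k, y). (u \<otimes> k, y)) (bal_class (g, cyl_class (Inl y))) = bal_class (u \<otimes> g, cyl_class (Inl y))"
    if "u \<in> carrier G" "g \<in> carrier G" "y \<in> topspace slab" for u g y
  proof -
    have "cyl_class (Inl y) \<in> topspace plane_cylinder" using that(3) unfolding topspace_plane_cylinder by blast
    then show ?thesis using that by (intro image_bal_class)
  qed
  have b_m: "?b u (?m x) = ?m (act\<Omega> u x)" if "u \<in> carrier G" "x \<in> topspace \<Omega>" for u x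
    using that bal by (auto simp: act\<Omega>_def topspace_disjoint_sum)
  have m_surj: "topspace (disjoint_sum bal_prod (top_of_set E)) = ?m ` topspace \<Omega>"
  proof -
    have "topspace bal_prod = (\<lambda>(g, y). bal_class (g, cyl_class (Inl y))) ` (carrier G \<times> topspace slab)"
      using quotient_map_bal_slab unfolding quotient_map_def by simp
    then show ?thesis by (simp add: topspace_disjoint_sum image_Un image_image)
  qed
  have act\<Omega>_inv: "act\<Omega> (inv u) (act\<Omega> u x) = x" "act\<Omega> u (act\<Omega> (inv u) x) = x"
    if "u \<in> carrier G" "x \<in> topspace \<Omega>" for u x
    using that by (auto simp: act\<Omega>_def topspace_disjoint_sum simp flip: m_assoc)
  have rel: "(?b v x, ?b v y) \<in> egg_rel" if v: "v \<in> carrier G" and xy: "(x, y) \<in> egg_rel" for v x y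
  proof -
    obtain g w where g: "g \<in> carrier G" "x = Inl (bal_class (g, cyl_class (Inl (w, 0))))" "y = Inr (act g (\<phi> w))"
      using xy by (auto simp: egg_rel_def glue_rel_def)
    have "?b v x = Inl (bal_class (v \<otimes> g, cyl_class (Inl (w, 0))))" using bal[OF v g(1), of "(w, 0)"] g(2) by simp
    moreover have "?b v y = Inr (act (v \<otimes> g) (\<phi> w))" using g v by (simp add: act_mult)
    moreover have "v \<otimes> g \<in> carrier G" using g(1) v by simp
    ultimately show ?thesis unfolding egg_rel_def glue_rel_def by blast
  qed
  have "?b u ` egg_class (?m x) = egg_class (?b u (?m x))"
    unfolding egg_class_def
  proof (rule image_ident_class[where b' = "?b (inv u)"])
    fix z assume "z \<in> topspace (disjoint_sum bal_prod (top_of_set E))"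
    then obtain w where w: "w \<in> topspace \<Omega>" "z = ?m w" unfolding m_surj by blast
    show "?b u z \<in> topspace (disjoint_sum bal_prod (top_of_set E))"
      "?b (inv u) z \<in> topspace (disjoint_sum bal_prod (top_of_set E))"
      "?b (inv u) (?b u z) = z" "?b u (?b (inv u) z) = z"
      unfolding w(2) m_surj using w(1) u by (simp_all only: b_m act\<Omega>_closed act\<Omega>_inv inv_closed imageI)
  qed (use rel u x m_surj in auto)
  then show ?thesis using b_m[OF u x] by (simp add: egg_action_def \<kappa>_def)
qed

lemma continuous_map_act\<Omega>:
  assumes u: "u \<in> carrier G"
  shows "continuous_map \<Omega> \<Omega> (act\<Omega> u)"
  unfolding continuous_map_from_disjoint_sum continuous_map_from_discrete_prod
proof (intro conjI ballI)
  fix g assume g: "g \<in> carrier G"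
  have "continuous_map slab (prod_topology (discrete_topology (carrier G)) slab) (\<lambda>y. (u \<otimes> g, y))"
    using u g by (simp add: continuous_map_pairwise o_def)
  from continuous_map_compose[OF this continuous_map_Inl]
  show "continuous_map slab \<Omega> (\<lambda>y. act\<Omega> u (Inl (g, y)))" by (simp add: act\<Omega>_def o_def)
next
  have "continuous_map (top_of_set E) (top_of_set E) (act u)"
    using continuous_act[OF u] u by (auto simp: continuous_map_in_subtopology)
  from continuous_map_compose[OF this continuous_map_Inr]
  show "continuous_map (top_of_set E) \<Omega> (\<lambda>e. act\<Omega> u (Inr e))" by (simp add: act\<Omega>_def o_def)
qed

lemma continuous_map_kappa: "continuous_map \<Omega> Z \<kappa>"
  by (rule quotient_imp_continuous_map[OF quotient_map_kappa])

lemma topological_action_egg: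
  assumes U: "subgroup U G"
  shows "topological_action (G\<lparr>carrier := U\<rparr>) Z (egg_action G act)"
proof -
  interpret K: group "G\<lparr>carrier := U\<rparr>" using U by (rule subgroup_imp_group)
  have UG: "u \<in> carrier G" if "u \<in> U" for u using U that by (rule subgroup.mem_carrier)
  show ?thesis
  proof
    fix g assume "g \<in> carrier (G\<lparr>carrier := U\<rparr>)"
    then have g: "g \<in> carrier G" using UG by simp
    have "continuous_map \<Omega> Z (\<kappa> \<circ> act\<Omega> g)"
      using continuous_map_act\<Omega>[OF g] continuous_map_kappa by (rule continuous_map_compose)
    then have "continuous_map \<Omega> Z (egg_action G act g \<circ> \<kappa>)"
      by (rule continuous_map_eq) (simp add: egg_action_kappa g)
    then show "continuous_map Z Z (egg_action G act g)"
      using continuous_compose_quotient_map[OF quotient_map_kappa] by blast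
  next
    fix z assume "z \<in> topspace Z"
    then obtain x where x: "x \<in> topspace \<Omega>" "z = \<kappa> x" by (auto simp: topspace_Z)
    have "act\<Omega> \<one> x = x" using x(1) by (auto simp: act\<Omega>_def topspace_disjoint_sum)
    then show "egg_action G act \<one>\<^bsub>G\<lparr>carrier := U\<rparr>\<^esub> z = z" using x by (simp add: egg_action_kappa)
    fix g h assume "g \<in> carrier (G\<lparr>carrier := U\<rparr>)" "h \<in> carrier (G\<lparr>carrier := U\<rparr>)"
    then have gh: "g \<in> carrier G" "h \<in> carrier G" using UG by auto
    have "act\<Omega> (g \<otimes> h) x = act\<Omega> g (act\<Omega> h x)"
      using x(1) gh by (auto simp: act\<Omega>_def topspace_disjoint_sum m_assoc act_mult)
    then show "egg_action G act (g \<otimes>\<^bsub>G\<lparr>carrier := U\<rparr>\<^esub> h) z = egg_action G act g (egg_action G act h z)"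
      using x gh by (simp add: egg_action_kappa act\<Omega>_closed)
  qed
qed

end

section \<open>Simple connectedness of the classifying space\<close>

lemma simply_connected_realise_if_retracts:
  assumes E: "simply_connected E" and R: "continuous_map Z (top_of_set E) R" and j: "continuous_map (top_of_set E) Z j"
    and hom: "homotopic_with (\<lambda>_. True) Z Z id (j \<circ> R)"
  shows "simply_connected (realise Z)"
proof (rule simply_connected_if_retracts_up_to_homotopy[OF E])
  have "continuous_map (top_of_set (realise Z)) (top_of_set E) (R \<circ> point)"
    by (rule continuous_map_compose[OF continuous_map_point R])
  then show "continuous_on (realise Z) (R \<circ> point)" "R \<circ> point \<in> realise Z \<rightarrow> E"
    by (auto simp: continuous_map_in_subtopology)
  have "continuous_map (top_of_set E) (top_of_set (realise Z)) (Pointed Z \<circ> j)"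
    by (rule continuous_map_compose[OF j continuous_map_Pointed])
  then show "continuous_on E (Pointed Z \<circ> j)" "Pointed Z \<circ> j \<in> E \<rightarrow> realise Z"
    by (auto simp: continuous_map_in_subtopology)
  have "homotopic_with_canon (\<lambda>_. True) (Pointed Z ` topspace Z) (realise Z) (realise_map Z id) (realise_map Z (j \<circ> R))"
    by (rule homotopic_with_realise) (use hom in auto)
  then have "homotopic_with_canon (\<lambda>_. True) (realise Z) (realise Z) (realise_map Z id) (realise_map Z (j \<circ> R))"
    by (simp add: realise_def)
  then show "homotopic_with_canon (\<lambda>_. True) (realise Z) (realise Z) id (Pointed Z \<circ> j \<circ> (R \<circ> point))"
    by (rule homotopic_with_eq) (auto simp: realise_map_def point_realise)
qed

text \<open>The interval is locally compact and Hausdorff, so its product with \<open>m\<close> is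
  still a quotient map, and a homotopy that is constant on fibres at each time descends.\<close>

lemma homotopic_with_from_quotient:
  assumes m: "quotient_map X Y m" and h: "continuous_map (prod_topology (top_of_set {0..1::real}) X) T h"
    and fibre: "\<And>\<tau> x y. \<tau> \<in> {0..1} \<Longrightarrow> x \<in> topspace X \<Longrightarrow> y \<in> topspace X \<Longrightarrow> m x = m y \<Longrightarrow> h (\<tau>, x) = h (\<tau>, y)"
    and ends: "\<And>x. x \<in> topspace X \<Longrightarrow> h (0, x) = f (m x)" "\<And>x. x \<in> topspace X \<Longrightarrow> h (1, x) = g (m x)"
  shows "homotopic_with (\<lambda>_. True) Y T f g"
proof -
  let ?I = "top_of_set {0..1::real}"
  have "quotient_map (prod_topology ?I X) (prod_topology ?I Y) (\<lambda>(\<tau>, x). (\<tau>, m x))"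
    by (rule quotient_map_prod_right[OF _ _ m])
       (auto intro!: compact_imp_locally_compact_space Hausdorff_space_subtopology simp: compact_space_subtopology)
  then obtain H where H: "continuous_map (prod_topology ?I Y) T H"
    "\<And>x. x \<in> topspace (prod_topology ?I X) \<Longrightarrow> H ((\<lambda>(\<tau>, x). (\<tau>, m x)) x) = h x"
  proof (rule quotient_map_lift_exists[OF _ h])
    show "h x = h y" if "x \<in> topspace (prod_topology ?I X)" "y \<in> topspace (prod_topology ?I X)"
      "(\<lambda>(\<tau>, x). (\<tau>, m x)) x = (\<lambda>(\<tau>, x). (\<tau>, m x)) y" for x y
      using that fibre[of "fst x" "snd x" "snd y"] by (cases x; cases y) simp
  qed (rule that)
  have Hm: "H (\<tau>, m x) = h (\<tau>, x)" if "\<tau> \<in> {0..1}" "x \<in> topspace X" for \<tau> x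
    using H(2)[of "(\<tau>, x)"] that by simp
  have topY: "topspace Y = m ` topspace X" using m by (simp add: quotient_map_def)
  show ?thesis
  proof (subst homotopic_with, goal_cases)
    case 2
    show ?case using H(1) Hm ends unfolding topY by (intro exI[of _ H]) auto
  qed simp
qed

context egg
begin

section \<open>Continuity of maps out of the coordinate space, piece by piece\<close>

lemma slab_eq: "slab = top_of_set (UNIV \<times> {0..1})"
  using prod_topology_subtopology_eu[of UNIV "{0..1::real}"] by (simp only: subtopology_UNIV)

lemma continuous_on_phi: "continuous_on S f \<Longrightarrow> continuous_on S (\<lambda>x. \<phi> (f x))"
  by (rule continuous_on_compose2[OF continuous_phi]) auto

lemma openin_\<Omega>I:
  assumes "W \<subseteq> topspace \<Omega>" and G: "\<And>g. g \<in> carrier G \<Longrightarrow> openin slab {y. Inl (g, y) \<in> W}"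
    and E: "openin (top_of_set E) {e. Inr e \<in> W}"
  shows "openin \<Omega> W"
proof -
  have "openin (prod_topology (discrete_topology (carrier G)) slab) (Inl -` W)"
    unfolding openin_prod_topology_alt[of "discrete_topology (carrier G)" slab]
  proof (intro allI impI)
    fix g y assume "(g, y) \<in> Inl -` W"
    then have "Inl (g, y) \<in> W" "g \<in> carrier G" using assms(1) by (auto simp: topspace_\<Omega>)
    then show "\<exists>U V. openin (discrete_topology (carrier G)) U \<and> openin slab V \<and> g \<in> U \<and> y \<in> V \<and> U \<times> V \<subseteq> Inl -` W"
      using G by (intro exI[of _ "{g}"] exI[of _ "{y. Inl (g, y) \<in> W}"]) auto
  qed
  then show ?thesis using E by (simp add: openin_disjoint_sum vimage_def)
qed

text \<open>The slabs and \<open>E\<close> are open in \<open>\<Omega>\<close>, so continuity is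
  examined on each piece; the parameter space \<open>P\<close> serves as the time of a
  homotopy.\<close>

lemma continuous_map_from_prod_\<Omega>:
  assumes G: "\<And>g. g \<in> carrier G \<Longrightarrow> continuous_map (prod_topology P slab) T (\<lambda>(p, y). f (p, Inl (g, y)))"
    and E: "continuous_map (prod_topology P (top_of_set E)) T (\<lambda>(p, e). f (p, Inr e))"
  shows "continuous_map (prod_topology P \<Omega>) T f"
  unfolding continuous_map_def
proof (intro conjI allI impI)
  show "f \<in> topspace (prod_topology P \<Omega>) \<rightarrow> topspace T"
    using G E by (fastforce simp: continuous_map_def topspace_disjoint_sum Pi_iff)
  fix W assume W: "openin T W"
  let ?A = "{x \<in> topspace (prod_topology P \<Omega>). f x \<in> W}"
  show "openin (prod_topology P \<Omega>) ?A"
    unfolding openin_prod_topology_alt[of P \<Omega>]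
  proof (intro allI impI)
    fix p x assume px: "(p, x) \<in> ?A"
    then have p: "p \<in> topspace P" and x: "x \<in> topspace \<Omega>" by auto
    show "\<exists>U V. openin P U \<and> openin \<Omega> V \<and> p \<in> U \<and> x \<in> V \<and> U \<times> V \<subseteq> ?A"
    proof (cases x)
      case (Inl gy)
      obtain g y where gy: "x = Inl (g, y)" "g \<in> carrier G" "y \<in> topspace slab"
        using x Inl by (auto simp: topspace_disjoint_sum)
      let ?B = "{z \<in> topspace (prod_topology P slab). (\<lambda>(p, y). f (p, Inl (g, y))) z \<in> W}"
      have "openin (prod_topology P slab) ?B" using G[OF gy(2)] W by (rule openin_continuous_map_preimage)
      moreover have "(p, y) \<in> ?B" using px gy by auto
      ultimately obtain U V where UV: "openin P U" "openin slab V" "p \<in> U" "y \<in> V" "U \<times> V \<subseteq> ?B"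
        unfolding openin_prod_topology_alt[of P slab] by meson
      have V: "V \<subseteq> topspace slab" and U: "U \<subseteq> topspace P" using UV by (auto dest: openin_subset)
      have sub: "Inl ` ({g} \<times> V) \<subseteq> topspace \<Omega>" using V gy(2) unfolding topspace_disjoint_sum by auto
      have "openin \<Omega> (Inl ` ({g} \<times> V))"
      proof (rule openin_\<Omega>I[OF sub])
        show "openin slab {y. Inl (g', y) \<in> Inl ` ({g} \<times> V)}" for g'
          using UV(2) by (cases "g' = g") (simp_all add: image_iff)
      qed (simp add: image_iff)
      moreover have "U \<times> Inl ` ({g} \<times> V) \<subseteq> ?A" using UV(5) U sub by fastforce
      ultimately show ?thesis using UV gy(1) by (intro exI[of _ U] exI[of _ "Inl ` ({g} \<times> V)"]) auto
    next
      case (Inr e)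
      then have e: "e \<in> E" using x by (auto simp: topspace_disjoint_sum)
      let ?B = "{z \<in> topspace (prod_topology P (top_of_set E)). (\<lambda>(p, e). f (p, Inr e)) z \<in> W}"
      have "openin (prod_topology P (top_of_set E)) ?B" using E W by (rule openin_continuous_map_preimage)
      moreover have "(p, e) \<in> ?B" using px e Inr by auto
      ultimately obtain U V where UV: "openin P U" "openin (top_of_set E) V" "p \<in> U" "e \<in> V" "U \<times> V \<subseteq> ?B"
        unfolding openin_prod_topology_alt[of P "top_of_set E"] by meson
      have V: "V \<subseteq> E" and U: "U \<subseteq> topspace P" using UV by (auto dest: openin_subset openin_imp_subset)
      have sub: "Inr ` V \<subseteq> topspace \<Omega>" using V unfolding topspace_disjoint_sum by auto
      have "openin \<Omega> (Inr ` V)"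
        using UV(2) by (intro openin_\<Omega>I[OF sub]) (auto simp: image_iff)
      moreover have "U \<times> Inr ` V \<subseteq> ?A" using UV(5) U sub by fastforce
      ultimately show ?thesis using UV Inr by (intro exI[of _ U] exI[of _ "Inr ` V"]) auto
    qed
  qed
qed

lemma \<Omega>_cases:
  assumes "x \<in> topspace \<Omega>"
  obtains g s t r where "x = Inl (g, ((s, t), r))" "g \<in> carrier G" "0 \<le> r" "r \<le> 1"
    | e where "x = Inr e" "e \<in> E"
  using assms by (auto simp: topspace_\<Omega>)

lemma Inl_in_\<Omega> [simp]: "Inl (g, (v, r)) \<in> topspace \<Omega> \<longleftrightarrow> g \<in> carrier G \<and> 0 \<le> r \<and> r \<le> 1"
  and Inr_in_\<Omega> [simp]: "Inr e \<in> topspace \<Omega> \<longleftrightarrow> e \<in> E"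
  by (auto simp: topspace_disjoint_sum)

lemma continuous_map_kappa_Inl:
  "g \<in> carrier G \<Longrightarrow> continuous_map slab Z (\<lambda>y. \<kappa> (Inl (g, y)))"
  and continuous_map_kappa_Inr: "continuous_map (top_of_set E) Z (\<lambda>e. \<kappa> (Inr e))"
  using continuous_map_kappa unfolding continuous_map_from_disjoint_sum continuous_map_from_discrete_prod by auto

text \<open>The labels \<open>g\<close> and \<open>g \<otimes> per i j\<close> describe the same
  slab with shifted coordinates. A chosen label in each coset fixes an axis \<open>s = 0\<close>
  towards which the slab can be squeezed.\<close>

definition coset_rep :: "'g \<Rightarrow> 'g" where
  "coset_rep g = (SOME k. k \<in> carrier G \<and> (\<exists>i j. g = k \<otimes> per i j))"

definition coset_coords :: "'g \<Rightarrow> int \<times> int" where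
  "coset_coords g = (SOME ij. g = coset_rep g \<otimes> per (fst ij) (snd ij))"

lemma coset_rep:
  assumes "g \<in> carrier G"
  shows "coset_rep g \<in> carrier G" "coset_rep g \<otimes> per (fst (coset_coords g)) (snd (coset_coords g)) = g"
proof -
  have "g \<otimes> per 0 0 = g" using assms by simp
  then have "\<exists>k. k \<in> carrier G \<and> (\<exists>i j. g = k \<otimes> per i j)" using assms by metis
  then have *: "coset_rep g \<in> carrier G \<and> (\<exists>i j. g = coset_rep g \<otimes> per i j)"
    unfolding coset_rep_def by (rule someI_ex)
  then show "coset_rep g \<in> carrier G" by simp
  from * have "\<exists>ij. g = coset_rep g \<otimes> per (fst ij) (snd ij)" by auto
  then have "g = coset_rep g \<otimes> per (fst (coset_coords g)) (snd (coset_coords g))"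
    unfolding coset_coords_def by (rule someI_ex)
  then show "coset_rep g \<otimes> per (fst (coset_coords g)) (snd (coset_coords g)) = g" ..
qed

lemma mult_per_eq_iff:
  assumes "g \<in> carrier G" "k \<in> carrier G"
  shows "g \<otimes> per i j = k \<otimes> per i' j' \<longleftrightarrow> g = k \<otimes> per (i' - i) (j' - j)"
proof
  assume "g \<otimes> per i j = k \<otimes> per i' j'"
  then have "g \<otimes> per i j \<otimes> per (- i) (- j) = k \<otimes> per i' j' \<otimes> per (- i) (- j)" by simp
  then show "g = k \<otimes> per (i' - i) (j' - j)" using assms by (simp add: m_assoc per_mult)
next
  assume "g = k \<otimes> per (i' - i) (j' - j)"
  then show "g \<otimes> per i j = k \<otimes> per i' j'" using assms by (simp add: m_assoc per_mult)
qed

text \<open>Both labels define the same predicate for the choice operator, hence the same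
  representative; by \<open>per_inject\<close> their coordinates then differ by exactly
  \<open>(i, j)\<close>.\<close>

lemma coset_rep_per:
  assumes g: "g \<in> carrier G"
  shows "coset_rep (g \<otimes> per i j) = coset_rep g"
    "coset_coords (g \<otimes> per i j) = (fst (coset_coords g) + i, snd (coset_coords g) + j)"
proof -
  have "k \<in> carrier G \<and> (\<exists>i' j'. g \<otimes> per i j = k \<otimes> per i' j') \<longleftrightarrow> k \<in> carrier G \<and> (\<exists>i' j'. g = k \<otimes> per i' j')" for k
  proof -
    have "\<exists>i' j'. g \<otimes> per i j = k \<otimes> per i' j'" if "k \<in> carrier G" "g = k \<otimes> per i' j'" for i' j'
      using that g by (intro exI[of _ "i' + i"] exI[of _ "j' + j"]) (simp add: mult_per_eq_iff)
    moreover have "\<exists>i' j'. g = k \<otimes> per i' j'" if "k \<in> carrier G" "g \<otimes> per i j = k \<otimes> per i' j'" for i' j'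
      using that g mult_per_eq_iff by blast
    ultimately show ?thesis by blast
  qed
  then show rep: "coset_rep (g \<otimes> per i j) = coset_rep g" by (simp add: coset_rep_def)
  let ?c = "coset_coords g" and ?d = "coset_coords (g \<otimes> per i j)" and ?k = "coset_rep g"
  have k: "?k \<in> carrier G" using coset_rep(1)[OF g] .
  have "?k \<otimes> per (fst ?d) (snd ?d) = g \<otimes> per i j"
    using coset_rep(2)[of "g \<otimes> per i j"] g rep by simp
  also have "\<dots> = ?k \<otimes> per (fst ?c) (snd ?c) \<otimes> per i j" using coset_rep(2)[OF g] by simp
  also have "\<dots> = ?k \<otimes> per (fst ?c + i) (snd ?c + j)" using k by (simp add: m_assoc per_mult)
  finally have "per (fst ?d) (snd ?d) = per (fst ?c + i) (snd ?c + j)" using k by simp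
  then show "?d = (fst ?c + i, snd ?c + j)" by (simp add: per_inject prod_eq_iff)
qed

text \<open>Squeezes the plane at height \<open>r\<close> towards the axis \<open>s = 0\<close> by the factor \<open>1 - r\<close>, and only then
  lowers the height. Points at height 1, where \<open>s\<close> is forgotten, therefore leave the line only when
  their first coordinate is 0.\<close>

definition squeeze :: "real \<Rightarrow> (real \<times> real) \<times> real \<Rightarrow> (real \<times> real) \<times> real" where
  "squeeze \<tau> y =
     (((1 - min 1 (2 * \<tau>) * snd y) * fst (fst y), snd (fst y)), (1 - max 0 (2 * \<tau> - 1)) * snd y)"

text \<open>A point is first rewritten with the label \<open>coset_rep g\<close> and then squeezed.
  This is well defined on \<open>Z\<close>, although not equivariant. At time 1 every slab has
  reached its boundary plane, and \<open>E\<close> stays fixed throughout.\<close>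

theorem simply_connected_egg:
  assumes sc: "simply_connected E"
  shows "simply_connected (realise Z)"
proof -
  let ?I = "top_of_set {0..1::real}"
  \<comment> \<open>The change from coordinates for the label \<open>g\<close> to coordinates for
    \<open>coset_rep g\<close>.\<close>
  define shift where "shift g y = ((fst (fst y) + of_int (fst (coset_coords g)),
      snd (fst y) + of_int (snd (coset_coords g))), snd y)" for g and y :: "(real \<times> real) \<times> real"
  have shift_per: "shift (g \<otimes> per i j) ((s, t), r) = shift g (translate i j ((s, t), r))" if "g \<in> carrier G" for g i j s t r
    using coset_rep_per(2)[OF that] by (simp add: shift_def add.assoc add.commute)
  have slab: "squeeze \<tau> y \<in> topspace slab" if \<tau>: "\<tau> \<in> {0..1}" and "y \<in> topspace slab" for \<tau> y
  proof -
    obtain s t r where y: "y = ((s, t), r)" "0 \<le> r" "r \<le> 1" using \<open>y \<in> topspace slab\<close> by auto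
    have "0 \<le> (1 - max 0 (2 * \<tau> - 1)) * r" "(1 - max 0 (2 * \<tau> - 1)) * r \<le> 1"
      using y \<tau> by (intro mult_nonneg_nonneg mult_le_one; simp)+
    then show ?thesis by (simp add: squeeze_def y)
  qed
  have shift_slab: "shift g y \<in> topspace slab" if "y \<in> topspace slab" for g y
    using that by (auto simp: shift_def)
  have cont_shift: "continuous_on S (shift g)" for S g
    unfolding shift_def by (intro continuous_intros)
  have cont_squeeze: "continuous_on S (\<lambda>x. squeeze (f x) (h x))" if "continuous_on S f" "continuous_on S h"
    for S :: "'b::topological_space set" and f h
    unfolding squeeze_def by (intro continuous_intros that)
  define D where "D = (\<lambda>(\<tau>, x). case x of Inl (g, y) \<Rightarrow> \<kappa> (Inl (coset_rep g, squeeze \<tau> (shift g y))) | Inr e \<Rightarrow> \<kappa> (Inr e))"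
  \<comment> \<open>The end of the squeezing with values in \<open>E\<close> itself: the retraction
    before it is passed to the quotient.\<close>
  define R0 where "R0 = (\<lambda>x. case x of Inl (g, y) \<Rightarrow> act (coset_rep g) (\<phi> (fst (squeeze 1 (shift g y)))) | Inr e \<Rightarrow> e)"
  have rep: "coset_rep g \<in> carrier G" if "g \<in> carrier G" for g using coset_rep(1)[OF that] .
  have squeeze_1: "squeeze 1 y = (fst (squeeze 1 y), 0)" for y
    by (simp add: squeeze_def)
  \<comment> \<open>At height 0 the change of label is undone by equivariance of
    \<open>\<phi>\<close>, so the squeezing fits together with the identity on
    \<open>E\<close>.\<close>
  have rep_shift: "act (coset_rep g) (\<phi> (fst (shift g (v, 0)))) = act g (\<phi> v)" if g: "g \<in> carrier G" for g v
  proof -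
    obtain s t where v: "v = (s, t)" by fastforce
    have "act (coset_rep g) (\<phi> (fst (shift g (v, 0)))) =
        act (coset_rep g \<otimes> per (fst (coset_coords g)) (snd (coset_coords g))) (\<phi> v)"
      using rep[OF g] by (simp add: shift_def v phi_per act_mult)
    then show ?thesis using coset_rep(2)[OF g] by simp
  qed
  have squeeze_0: "squeeze 0 y = y" for y by (simp add: squeeze_def)
  have squeeze_bottom: "squeeze \<tau> (v, 0) = (v, 0)" for \<tau> v by (simp add: squeeze_def)
  have squeeze_top: "\<kappa> (Inl (k, squeeze \<tau> ((s, t), 1))) = \<kappa> (Inl (k, squeeze \<tau> ((s', t), 1)))" for k \<tau> s s' t
  proof (cases "\<tau> \<le> 1 / 2")
    case True
    then show ?thesis using kappa_line[of k "(1 - 2 * \<tau>) * s" t "(1 - 2 * \<tau>) * s'"] by (simp add: squeeze_def)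
  qed (simp add: squeeze_def)
  have shift_bottom: "shift g (v, 0) = (fst (shift g (v, 0)), 0)" for g v
    by (simp add: shift_def)
  have D_inv: "D (\<tau>, x) = D (\<tau>, y)" if "\<tau> \<in> {0..1}" "\<kappa> x = \<kappa> y" "x \<in> topspace \<Omega>" "y \<in> topspace \<Omega>" for \<tau> x y
  proof (rule kappa_invariant[OF _ _ _ that(2-4), of "\<lambda>x. D (\<tau>, x)"])
    show "D (\<tau>, Inl (g, ((s, t), 1))) = D (\<tau>, Inl (g, ((s', t), 1)))" for g s s' t
      by (simp add: D_def shift_def) (rule squeeze_top)
    show "D (\<tau>, Inl (g \<otimes> per i j, ((s, t), r))) = D (\<tau>, Inl (g, translate i j ((s, t), r)))" if "g \<in> carrier G" for g i j s t r
      using shift_per[OF that] by (simp add: D_def coset_rep_per(1)[OF that])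
    show "D (\<tau>, Inl (g, (v, 0))) = D (\<tau>, Inr (act g (\<phi> v)))" if g: "g \<in> carrier G" for g v
    proof -
      have "D (\<tau>, Inl (g, (v, 0))) = \<kappa> (Inl (coset_rep g, (fst (shift g (v, 0)), 0)))"
        using squeeze_bottom[of \<tau> "fst (shift g (v, 0))"] shift_bottom[of g v] by (simp add: D_def)
      then show ?thesis using kappa_boundary[OF rep[OF g]] rep_shift[OF g] by (simp add: D_def)
    qed
  qed
  have R_inv: "R0 x = R0 y" if "\<kappa> x = \<kappa> y" "x \<in> topspace \<Omega>" "y \<in> topspace \<Omega>" for x y
  proof (rule kappa_invariant[OF _ _ _ that])
    show "R0 (Inl (g, ((s, t), 1))) = R0 (Inl (g, ((s', t), 1)))" for g s s' t
      by (simp add: R0_def shift_def squeeze_def)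
    show "R0 (Inl (g \<otimes> per i j, ((s, t), r))) = R0 (Inl (g, translate i j ((s, t), r)))" if "g \<in> carrier G" for g i j s t r
      using shift_per[OF that] by (simp add: R0_def coset_rep_per(1)[OF that])
    show "R0 (Inl (g, (v, 0))) = R0 (Inr (act g (\<phi> v)))" if g: "g \<in> carrier G" for g v
      using squeeze_bottom[of 1 "fst (shift g (v, 0))"] shift_bottom[of g v] rep_shift[OF g] by (simp add: R0_def)
  qed
  have contR0: "continuous_map \<Omega> (top_of_set E) R0"
    unfolding continuous_map_from_disjoint_sum continuous_map_from_discrete_prod
  proof (intro conjI ballI)
    fix g assume g: "g \<in> carrier G"
    have "continuous_on (UNIV \<times> {0..1}) (\<lambda>y. act (coset_rep g) (\<phi> (fst (squeeze 1 (shift g y)))))"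
      by (rule continuous_on_compose2[OF continuous_act[OF rep[OF g]]])
         (auto intro!: continuous_on_phi continuous_on_fst cont_squeeze cont_shift)
    then show "continuous_map slab (top_of_set E) (\<lambda>y. R0 (Inl (g, y)))"
      unfolding slab_eq using rep[OF g] by (auto simp: R0_def continuous_map_in_subtopology)
  qed (simp add: R0_def continuous_map_in_subtopology)
  obtain R where R: "continuous_map Z (top_of_set E) R" "\<And>x. x \<in> topspace \<Omega> \<Longrightarrow> R (\<kappa> x) = R0 x"
  proof (rule quotient_map_lift_exists[OF quotient_map_kappa contR0])
    show "R0 x = R0 y" if "x \<in> topspace \<Omega>" "y \<in> topspace \<Omega>" "\<kappa> x = \<kappa> y" for x y
      using R_inv that by blast
  qed (use that in blast)
  have contD: "continuous_map (prod_topology ?I \<Omega>) Z D"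
  proof (rule continuous_map_from_prod_\<Omega>)
    fix g assume g: "g \<in> carrier G"
    have "continuous_on ({0..1} \<times> (UNIV \<times> {0..1})) (\<lambda>x. squeeze (fst x) (shift g (snd x)))"
      by (intro cont_squeeze continuous_on_compose2[OF cont_shift] continuous_intros) auto
    moreover have "prod_topology ?I slab = top_of_set ({0..1} \<times> (UNIV \<times> {0..1}))"
      unfolding slab_eq by simp
    moreover have "(\<lambda>x. squeeze (fst x) (shift g (snd x))) \<in> {0..1} \<times> (UNIV \<times> {0..1}) \<rightarrow> UNIV \<times> {0..1}"
    proof
      fix x :: "real \<times> (real \<times> real) \<times> real" assume "x \<in> {0..1} \<times> (UNIV \<times> {0..1})"
      then have "fst x \<in> {0..1}" "snd x \<in> topspace slab" by auto
      from slab[OF this(1) shift_slab[OF this(2)]]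
      show "squeeze (fst x) (shift g (snd x)) \<in> UNIV \<times> {0..1}" by simp
    qed
    ultimately have "continuous_map (prod_topology ?I slab) slab (\<lambda>x. squeeze (fst x) (shift g (snd x)))"
      unfolding slab_eq by (simp add: continuous_map_in_subtopology)
    from continuous_map_compose[OF this continuous_map_kappa_Inl[OF rep[OF g]]]
    show "continuous_map (prod_topology ?I slab) Z (\<lambda>(p, y). D (p, Inl (g, y)))"
      by (simp add: D_def o_def case_prod_unfold)
  next
    have "continuous_map (prod_topology ?I (top_of_set E)) Z ((\<lambda>e. \<kappa> (Inr e)) \<circ> snd)"
      by (rule continuous_map_compose[OF continuous_map_snd continuous_map_kappa_Inr])
    then show "continuous_map (prod_topology ?I (top_of_set E)) Z (\<lambda>(p, e). D (p, Inr e))"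
      by (simp add: D_def o_def case_prod_unfold)
  qed
  have D0: "D (0, x) = \<kappa> x" if "x \<in> topspace \<Omega>" for x
    using that
  proof (cases rule: \<Omega>_cases)
    case (1 g s t r)
    have "D (0, x) = \<kappa> (Inl (coset_rep g, translate (fst (coset_coords g)) (snd (coset_coords g)) ((s, t), r)))"
      by (simp add: D_def squeeze_0 1(1) shift_def)
    also have "\<dots> = \<kappa> x"
      using kappa_per[OF rep[OF 1(2)], of r "fst (coset_coords g)" "snd (coset_coords g)" s t] coset_rep(2)[OF 1(2)] 1 by simp
    finally show ?thesis .
  qed (simp add: D_def)
  have D1: "D (1, x) = \<kappa> (Inr (R0 x))" if "x \<in> topspace \<Omega>" for x
    using that
  proof (cases rule: \<Omega>_cases)
    case (1 g s t r)
    have "D (1, x) = \<kappa> (Inl (coset_rep g, (fst (squeeze 1 (shift g ((s, t), r))), 0)))"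
      using squeeze_1[of "shift g ((s, t), r)"] by (simp add: D_def 1(1))
    then show ?thesis using kappa_boundary[OF rep[OF 1(2)]] by (simp add: R0_def 1(1))
  qed (simp add: D_def R0_def)
  have "homotopic_with (\<lambda>_. True) Z Z id ((\<lambda>e. \<kappa> (Inr e)) \<circ> R)"
  proof (rule homotopic_with_from_quotient[OF quotient_map_kappa contD])
    show "D (1, x) = ((\<lambda>e. \<kappa> (Inr e)) \<circ> R) (\<kappa> x)" if "x \<in> topspace \<Omega>" for x
      using D1[OF that] R(2)[OF that] by simp
    show "D (\<tau>, x) = D (\<tau>, y)" if "\<tau> \<in> {0..1}" "x \<in> topspace \<Omega>" "y \<in> topspace \<Omega>" "\<kappa> x = \<kappa> y" for \<tau> x y
      using D_inv that by blast
  qed (simp add: D0)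
  then show ?thesis by (rule simply_connected_realise_if_retracts[OF sc R(1) continuous_map_kappa_Inr])
qed

end

section \<open>Neighbourhoods of points on and off the lines\<close>

context egg
begin

lemma openin_kappa_image:
  assumes N: "openin \<Omega> N" and sat: "\<And>x y. x \<in> N \<Longrightarrow> y \<in> topspace \<Omega> \<Longrightarrow> \<kappa> x = \<kappa> y \<Longrightarrow> y \<in> N"
  shows "openin Z (\<kappa> ` N)"
proof -
  have NO: "N \<subseteq> topspace \<Omega>" using N by (rule openin_subset)
  have "{x \<in> topspace \<Omega>. \<kappa> x \<in> \<kappa> ` N} = N"
  proof (intro equalityI subsetI)
    fix y assume "y \<in> {x \<in> topspace \<Omega>. \<kappa> x \<in> \<kappa> ` N}"
    then obtain x where "x \<in> N" "\<kappa> x = \<kappa> y" "y \<in> topspace \<Omega>" by auto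
    then show "y \<in> N" using sat by blast
  qed (use NO in auto)
  moreover have "\<kappa> ` N \<subseteq> topspace Z" using NO by (auto simp: topspace_Z)
  ultimately show ?thesis using openin_Z_iff N by simp
qed

section \<open>Points off the lines\<close>

definition off_line :: "('g \<times> (real \<times> real) \<times> real) + 'e \<Rightarrow> bool" where
  "off_line x = (case x of Inl (g, y) \<Rightarrow> snd y < 1 | Inr e \<Rightarrow> True)"

text \<open>The vertical projection of the cylinders to the boundary planes. It is equivariant, and
  respects the identifications only below height 1, where \<open>s\<close> is still
  remembered.\<close>

definition base :: "('g \<times> (real \<times> real) \<times> real) + 'e \<Rightarrow> 'e" where
  "base x = (case x of Inl (g, y) \<Rightarrow> act g (\<phi> (fst y)) | Inr e \<Rightarrow> e)"

text \<open>\<open>off_line\<close> is paired with \<open>base\<close>, cut off to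
  \<open>undefined\<close> on the lines, so that the pair respects all three identifications at
  once.\<close>

lemma off_line_invariant:
  assumes "\<kappa> x = \<kappa> y" "x \<in> topspace \<Omega>" "y \<in> topspace \<Omega>"
  shows "off_line x \<longleftrightarrow> off_line y" "off_line x \<Longrightarrow> base x = base y"
proof -
  have "(off_line x, if off_line x then base x else undefined) = (off_line y, if off_line y then base y else undefined)"
    by (rule kappa_invariant[OF _ _ _ assms, of "\<lambda>x. (off_line x, if off_line x then base x else undefined)"])
       (auto simp: off_line_def base_def phi_per act_mult)
  then show "off_line x \<longleftrightarrow> off_line y" "off_line x \<Longrightarrow> base x = base y" by (auto split: if_splits)
qed

text \<open>By equivariance of \<open>base\<close>, an element under which the preimage of a
  wandering set \<open>B\<close> meets its translate also makes \<open>B\<close> meet its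
  translate.\<close>

lemma off_line_neighbourhood:
  assumes x: "x \<in> topspace \<Omega>" "off_line x"
  obtains N where "openin Z N" "\<kappa> x \<in> N" "\<And>u. u \<in> carrier G \<Longrightarrow> egg_action G act u ` N \<inter> N \<noteq> {} \<Longrightarrow> u = \<one>"
proof -
  have baseE: "base x \<in> E" using x by (cases rule: \<Omega>_cases) (auto simp: base_def)
  then obtain B where B: "openin (top_of_set E) B" "base x \<in> B"
    and wander: "\<And>g. g \<in> carrier G \<Longrightarrow> act g ` B \<inter> B \<noteq> {} \<Longrightarrow> g = \<one>"
    using wandering[OF baseE] by blast
  let ?N = "{x \<in> topspace \<Omega>. off_line x \<and> base x \<in> B}"
  have "openin \<Omega> ?N"
  proof (rule openin_\<Omega>I)
    show "openin slab {y. Inl (g, y) \<in> ?N}" if g: "g \<in> carrier G" for g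
    proof -
      have "continuous_on (UNIV \<times> {0..1::real}) (\<lambda>y. act g (\<phi> (fst y)))"
        by (rule continuous_on_compose2[OF continuous_act[OF g]]) (auto intro!: continuous_on_phi continuous_intros)
      then have "openin slab (UNIV \<times> {0..1} \<inter> (\<lambda>y. act g (\<phi> (fst y))) -` B)"
        unfolding slab_eq using B(1) g by (intro continuous_openin_preimage[where T = E]) auto
      moreover have "openin slab (UNIV \<times> {0..1} \<inter> snd -` {..<1})"
        unfolding slab_eq by (intro continuous_openin_preimage_gen continuous_intros open_lessThan)
      ultimately have "openin slab ((UNIV \<times> {0..1} \<inter> (\<lambda>y. act g (\<phi> (fst y))) -` B) \<inter> (UNIV \<times> {0..1} \<inter> snd -` {..<1}))"
        by (rule openin_Int)
      moreover have "{y. Inl (g, y) \<in> ?N} = (UNIV \<times> {0..1} \<inter> (\<lambda>y. act g (\<phi> (fst y))) -` B) \<inter> (UNIV \<times> {0..1} \<inter> snd -` {..<1})"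
        using g by (auto simp: off_line_def base_def)
      ultimately show ?thesis by simp
    qed
    have "{e. Inr e \<in> ?N} = B" using openin_imp_subset[OF B(1)] by (auto simp: off_line_def base_def)
    then show "openin (top_of_set E) {e. Inr e \<in> ?N}" using B(1) by simp
  qed auto
  moreover have sat: "y \<in> ?N" if "x \<in> ?N" "y \<in> topspace \<Omega>" "\<kappa> x = \<kappa> y" for x y
    using that off_line_invariant[of x y] by auto
  ultimately have "openin Z (\<kappa> ` ?N)" by (rule openin_kappa_image)
  moreover have "\<kappa> x \<in> \<kappa> ` ?N" using x B by auto
  moreover have "u = \<one>" if u: "u \<in> carrier G" and meet: "egg_action G act u ` \<kappa> ` ?N \<inter> \<kappa> ` ?N \<noteq> {}" for u
  proof -
    obtain v w where vw: "v \<in> ?N" "w \<in> ?N" "egg_action G act u (\<kappa> v) = \<kappa> w" using meet by auto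
    then have "act\<Omega> u v \<in> ?N"
      using sat[of w "act\<Omega> u v"] u act\<Omega>_closed by (auto simp: egg_action_kappa)
    moreover have "base (act\<Omega> u v) = act u (base v)"
    proof -
      have "v \<in> topspace \<Omega>" using vw(1) by simp
      then show ?thesis
      proof (cases rule: \<Omega>_cases)
        case (1 g s t r) then show ?thesis using u by (simp add: base_def act\<Omega>_def act_mult)
      qed (simp add: base_def act\<Omega>_def)
    qed
    ultimately have "act u ` B \<inter> B \<noteq> {}" using vw(1) by auto
    then show ?thesis using wander u by blast
  qed
  ultimately show ?thesis by (rule that)
qed

section \<open>Neighbourhoods of line points\<close>

definition line_nbhd :: "'g \<Rightarrow> real \<Rightarrow> (('g \<times> (real \<times> real) \<times> real) + 'e) set" where
  "line_nbhd g t0 = {Inl (g \<otimes> per i j, ((s, t), r)) |i j s t r. 0 < r \<and> r \<le> 1 \<and> \<bar>t + of_int j - t0\<bar> < 1 / 2}"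

text \<open>The part of the neighbourhood seen with the label \<open>g\<close> itself. The first
  coordinate is unrestricted because the line forgets it; the height is positive to stay away from
  \<open>E\<close>. Width 1/2 on both sides of \<open>t0\<close> keeps translates by different
  powers of \<open>l\<close> apart.\<close>

abbreviation line_chart :: "real \<Rightarrow> ((real \<times> real) \<times> real) set" where
  "line_chart t0 \<equiv> (UNIV \<times> {t0 - 1 / 2<..<t0 + 1 / 2}) \<times> {0<..1}"

lemma Inl_in_line_nbhd:
  assumes "g \<in> carrier G" "k \<in> carrier G"
  shows "Inl (k, ((s, t), r)) \<in> line_nbhd g t0 \<longleftrightarrow>
    (\<exists>i j. k = g \<otimes> per i j \<and> translate i j ((s, t), r) \<in> line_chart t0)"
proof -
  have "\<bar>x - t0\<bar> < 1 / 2 \<longleftrightarrow> t0 - 1 / 2 < x \<and> x < t0 + 1 / 2" for x by (safe; linarith)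
  then show ?thesis using assms by (auto simp: line_nbhd_def)
qed

lemma line_nbhd_subset: "g \<in> carrier G \<Longrightarrow> line_nbhd g t0 \<subseteq> topspace \<Omega>"
  by (auto simp: line_nbhd_def)

text \<open>Membership is a truth-valued function of the coordinates, to which
  \<open>kappa_invariant\<close> applies. All heights in the neighbourhood are positive, so both
  sides of the gluing condition are false.\<close>

lemma line_nbhd_saturated:
  assumes g: "g \<in> carrier G" and "x \<in> line_nbhd g t0" "y \<in> topspace \<Omega>" "\<kappa> x = \<kappa> y"
  shows "y \<in> line_nbhd g t0"
proof -
  have "x \<in> topspace \<Omega>" using assms line_nbhd_subset by blast
  have "(x \<in> line_nbhd g t0) = (y \<in> line_nbhd g t0)"
  proof (rule kappa_invariant[OF _ _ _ assms(4) \<open>x \<in> topspace \<Omega>\<close> assms(3), of "\<lambda>x. x \<in> line_nbhd g t0"])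
    show "(Inl (k, ((s, t), 1)) \<in> line_nbhd g t0) = (Inl (k, ((s', t), 1)) \<in> line_nbhd g t0)"
      if "k \<in> carrier G" for k s s' t
      using that by (simp add: Inl_in_line_nbhd[OF g])
    show "(Inl (k \<otimes> per i j, ((s, t), r)) \<in> line_nbhd g t0) = (Inl (k, translate i j ((s, t), r)) \<in> line_nbhd g t0)"
      if k: "k \<in> carrier G" for k i j s t r
    proof -
      have "(\<exists>i' j'. k \<otimes> per i j = g \<otimes> per i' j' \<and> translate i' j' ((s, t), r) \<in> line_chart t0) \<longleftrightarrow>
          (\<exists>i' j'. k = g \<otimes> per i' j' \<and> translate i' j' (translate i j ((s, t), r)) \<in> line_chart t0)"
      proof (intro iffI; elim exE conjE)
        fix i' j' assume *: "k \<otimes> per i j = g \<otimes> per i' j'" "translate i' j' ((s, t), r) \<in> line_chart t0"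
        then show "\<exists>i' j'. k = g \<otimes> per i' j' \<and> translate i' j' (translate i j ((s, t), r)) \<in> line_chart t0"
          using g k mult_per_eq_iff by (intro exI[of _ "i' - i"] exI[of _ "j' - j"]) auto
      next
        fix i' j' assume *: "k = g \<otimes> per i' j'" "translate i' j' (translate i j ((s, t), r)) \<in> line_chart t0"
        then show "\<exists>i' j'. k \<otimes> per i j = g \<otimes> per i' j' \<and> translate i' j' ((s, t), r) \<in> line_chart t0"
          using g by (intro exI[of _ "i' + i"] exI[of _ "j' + j"]) (auto simp: m_assoc per_mult algebra_simps)
      qed
      then show ?thesis using k by (simp add: Inl_in_line_nbhd[OF g])
    qed
    show "(Inl (k, (v, 0)) \<in> line_nbhd g t0) = (Inr (act k (\<phi> v)) \<in> line_nbhd g t0)" for k v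
      by (auto simp: line_nbhd_def)
  qed
  then show ?thesis using assms(2) by simp
qed

lemma openin_line_nbhd:
  assumes g: "g \<in> carrier G"
  shows "openin \<Omega> (line_nbhd g t0)"
proof (rule openin_\<Omega>I[OF line_nbhd_subset[OF g]])
  fix k assume k: "k \<in> carrier G"
  have "{y. Inl (k, y) \<in> line_nbhd g t0} =
      (\<Union>(i, j)\<in>{(i, j). k = g \<otimes> per i j}. {y. translate i j y \<in> line_chart t0})"
    (is "?L = ?R")
  proof (rule Set.set_eqI)
    fix y :: "(real \<times> real) \<times> real"
    obtain s t r where y: "y = ((s, t), r)" by (metis surj_pair)
    have "y \<in> ?L \<longleftrightarrow> (\<exists>i j. k = g \<otimes> per i j \<and> translate i j y \<in> line_chart t0)"
      unfolding y mem_Collect_eq by (rule Inl_in_line_nbhd[OF g k])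
    also have "\<dots> \<longleftrightarrow> y \<in> ?R"
    proof -
      have "(\<exists>i j. P i j \<and> Q i j y) \<longleftrightarrow> y \<in> (\<Union>(i, j)\<in>{(i, j). P i j}. {y. Q i j y})"
        for P :: "int \<Rightarrow> int \<Rightarrow> bool" and Q by auto
      then show ?thesis .
    qed
    finally show "y \<in> ?L \<longleftrightarrow> y \<in> ?R" .
  qed
  moreover have "openin slab {y. translate i j y \<in> line_chart t0}" for i j
  proof -
    have "openin slab (UNIV \<times> {0..1} \<inter> translate i j -` ((UNIV \<times> {t0 - 1 / 2<..<t0 + 1 / 2}) \<times> {0<..}))"
      unfolding slab_eq case_prod_unfold
      by (intro continuous_openin_preimage_gen continuous_intros) (auto intro!: open_Times)
    moreover have "{y. translate i j y \<in> line_chart t0} =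
        UNIV \<times> {0..1} \<inter> translate i j -` ((UNIV \<times> {t0 - 1 / 2<..<t0 + 1 / 2}) \<times> {0<..})"
      by auto
    ultimately show ?thesis by simp
  qed
  ultimately show "openin slab {y. Inl (k, y) \<in> line_nbhd g t0}" by auto
next
  have "{e. Inr e \<in> line_nbhd g t0} = {}" by (auto simp: line_nbhd_def)
  then show "openin (top_of_set E) {e. Inr e \<in> line_nbhd g t0}" by (simp only: openin_empty)
qed

lemma line_nbhd_wandering:
  assumes g: "g \<in> carrier G" and u: "u \<in> carrier G"
    and x: "x \<in> line_nbhd g t0" "act\<Omega> u x \<in> line_nbhd g t0"
  shows "\<exists>n. u \<otimes> g = g \<otimes> per n 0"
proof -
  obtain i j s t r where x1: "x = Inl (g \<otimes> per i j, ((s, t), r))" "\<bar>t + of_int j - t0\<bar> < 1 / 2"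
    using x(1) by (auto simp: line_nbhd_def)
  obtain i' j' where x2: "u \<otimes> (g \<otimes> per i j) = g \<otimes> per i' j'" "\<bar>t + of_int j' - t0\<bar> < 1 / 2"
    using x(2) by (auto simp: line_nbhd_def act\<Omega>_def x1(1))
  \<comment> \<open>Both \<open>t + j\<close> and \<open>t + j'\<close> are within 1/2 of
    \<open>t0\<close>, so the integers agree and only a power of \<open>a\<close> remains.\<close>
  have "\<bar>of_int j - of_int j' :: real\<bar> < 1" using x1(2) x2(2) by linarith
  then have "j = j'" by linarith
  then have "u \<otimes> g = g \<otimes> per (i' - i) 0"
    using x2(1) u g mult_per_eq_iff[of "u \<otimes> g" g i j i' j'] by (simp add: m_assoc)
  then show ?thesis by blast
qed

lemma Inl_chart_in_line_nbhd:
  assumes g: "g \<in> carrier G" and y: "y \<in> line_chart t0"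
  shows "Inl (g, y) \<in> line_nbhd g t0"
proof -
  obtain s t r where y': "y = ((s, t), r)" by (metis surj_pair)
  show ?thesis
    unfolding y' Inl_in_line_nbhd[OF g g] by (rule exI[of _ 0], rule exI[of _ 0]) (use g y y' in simp)
qed

text \<open>Moving the lattice element from the label into the coordinates gives every point of the
  neighbourhood the label \<open>g\<close>.\<close>

lemma kappa_line_nbhd:
  assumes g: "g \<in> carrier G"
  shows "\<kappa> ` line_nbhd g t0 = (\<lambda>y. \<kappa> (Inl (g, y))) ` line_chart t0"
proof (intro equalityI subsetI)
  fix z assume "z \<in> \<kappa> ` line_nbhd g t0"
  then obtain i j s t r where z: "z = \<kappa> (Inl (g \<otimes> per i j, ((s, t), r)))" "0 < r" "r \<le> 1" "\<bar>t + of_int j - t0\<bar> < 1 / 2"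
    by (auto simp: line_nbhd_def)
  then have "z = \<kappa> (Inl (g, translate i j ((s, t), r)))" using kappa_per[OF g] by simp
  moreover have "t0 - 1 / 2 < t + of_int j" "t + of_int j < t0 + 1 / 2" using z(4) by linarith+
  then have "translate i j ((s, t), r) \<in> line_chart t0" using z(2,3) by simp
  ultimately show "z \<in> (\<lambda>y. \<kappa> (Inl (g, y))) ` line_chart t0" by (rule image_eqI)
next
  fix z assume "z \<in> (\<lambda>y. \<kappa> (Inl (g, y))) ` line_chart t0"
  then show "z \<in> \<kappa> ` line_nbhd g t0" using Inl_chart_in_line_nbhd[OF g] by blast
qed

lemma continuous_map_line_chart:
  assumes "g \<in> carrier G"
  shows "continuous_map (top_of_set (line_chart t0)) Z (\<lambda>y. \<kappa> (Inl (g, y)))"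
proof -
  have "subtopology slab (line_chart t0) = top_of_set (line_chart t0)"
    unfolding slab_eq subtopology_subtopology by (rule arg_cong[of _ _ "subtopology euclidean"]) auto
  then show ?thesis
    using continuous_map_from_subtopology[OF continuous_map_kappa_Inl[OF assms], of "line_chart t0"] by simp
qed

lemma convex_line_chart: "convex (line_chart t0)"
  by (intro convex_Times) auto

lemma line_nbhd_path_connected:
  assumes g: "g \<in> carrier G" and "x \<in> \<kappa> ` line_nbhd g t0" "y \<in> \<kappa> ` line_nbhd g t0"
  shows "\<exists>e. pathin Z e \<and> e ` {0..1} \<subseteq> \<kappa> ` line_nbhd g t0 \<and> e 0 = x \<and> e 1 = y"
proof -
  obtain v w where vw: "v \<in> line_chart t0" "w \<in> line_chart t0" "x = \<kappa> (Inl (g, v))" "y = \<kappa> (Inl (g, w))"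
    using assms(2,3) unfolding kappa_line_nbhd[OF g] by blast
  have seg: "closed_segment v w \<subseteq> line_chart t0"
    using vw convex_line_chart by (intro closed_segment_subset)
  then have "continuous_map (top_of_set {0..1}) (top_of_set (line_chart t0)) (linepath v w)"
    by (auto simp: continuous_map_in_subtopology linepath_in_path continuous_on_linepath)
  from continuous_map_compose[OF this continuous_map_line_chart[OF g]]
  have "pathin Z ((\<lambda>y. \<kappa> (Inl (g, y))) \<circ> linepath v w)" by (simp add: pathin_def)
  moreover have "((\<lambda>y. \<kappa> (Inl (g, y))) \<circ> linepath v w) ` {0..1} \<subseteq> \<kappa> ` line_nbhd g t0"
    unfolding kappa_line_nbhd[OF g] using seg linepath_in_path by fastforce
  ultimately show ?thesis
    using vw(3,4) by (intro exI[of _ "(\<lambda>y. \<kappa> (Inl (g, y))) \<circ> linepath v w"]) (simp add: linepath_def)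
qed

text \<open>A straight-line motion towards \<open>t0\<close> and height 1 in the last two
  coordinates. Keeping \<open>s\<close> makes it commute with translations by powers of
  \<open>a\<close>; at time 1 the height is 1, where different values of \<open>s\<close> are
  identified, so the end is a single point of \<open>Z\<close>.\<close>

definition contract :: "real \<Rightarrow> real \<Rightarrow> (real \<times> real) \<times> real \<Rightarrow> (real \<times> real) \<times> real" where
  "contract t0 \<tau> = (\<lambda>((s, t), r). ((s, (1 - \<tau>) * t + \<tau> * t0), (1 - \<tau>) * r + \<tau>))"

lemma contract_line_chart:
  assumes "\<tau> \<in> {0..1}" "y \<in> line_chart t0"
  shows "contract t0 \<tau> y \<in> line_chart t0"
proof -
  obtain s t r where y: "y = ((s, t), r)" by (metis surj_pair)
  have "(1 - \<tau>) *\<^sub>R y + \<tau> *\<^sub>R ((s, t0), 1) \<in> line_chart t0"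
    using assms by (intro convexD[OF convex_line_chart]) auto
  moreover have "(1 - \<tau>) *\<^sub>R y + \<tau> *\<^sub>R ((s, t0), 1) = contract t0 \<tau> y"
    by (simp add: contract_def y algebra_simps)
  ultimately show ?thesis by simp
qed

section \<open>Line neighbourhoods in the orbit space of \<open>U\<close>\<close>

context
  fixes U
  assumes U: "subgroup U G"
begin

interpretation K: topological_action "G\<lparr>carrier := U\<rparr>" Z "egg_action G act"
  using U by (rule topological_action_egg)

lemma subgroup_self_U: "subgroup U (G\<lparr>carrier := U\<rparr>)"
  using K.subgroup_self by simp

abbreviation \<rho> where "\<rho> \<equiv> K.orbit_proj U"

lemma U_in_G: "u \<in> U \<Longrightarrow> u \<in> carrier G"
  using U by (rule subgroup.mem_carrier)

lemma orbit_kappa_eq: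
  assumes "x \<in> topspace \<Omega>" "y \<in> topspace \<Omega>" "\<rho> (\<kappa> x) = \<rho> (\<kappa> y)"
  obtains u where "u \<in> U" "\<kappa> (act\<Omega> u x) = \<kappa> y"
proof -
  have "\<kappa> x \<in> topspace Z" "\<kappa> y \<in> topspace Z" using assms by (auto simp: topspace_Z)
  then obtain u where "u \<in> U" "\<kappa> y = egg_action G act u (\<kappa> x)"
    using K.orbit_proj_eq_iff[OF subgroup_self_U] assms(3) by blast
  then show ?thesis using that[of u] assms(1) U_in_G by (simp add: egg_action_kappa)
qed

lemma orbit_kappa_act:
  assumes "u \<in> U" "x \<in> topspace \<Omega>"
  shows "\<rho> (\<kappa> (act\<Omega> u x)) = \<rho> (\<kappa> x)"
  using K.orbit_proj_action[OF subgroup_self_U assms(1), of "\<kappa> x"] assms U_in_G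
  by (simp add: egg_action_kappa topspace_Z)

text \<open>Chart points with the same orbit are related by some \<open>u\<close> with
  \<open>u \<otimes> g = g \<otimes> per n 0\<close>, a translation in \<open>s\<close>, which
  \<open>contract\<close> respects. To use \<open>kappa_invariant\<close>, the contraction is
  extended to all labels of the neighbourhood, as the function \<open>f\<close>.\<close>

lemma contract_invariant:
  assumes g: "g \<in> carrier G" and \<tau>: "\<tau> \<in> {0..1}" and y: "y \<in> line_chart t0" "y' \<in> line_chart t0"
    and eq: "\<rho> (\<kappa> (Inl (g, y))) = \<rho> (\<kappa> (Inl (g, y')))"
  shows "\<rho> (\<kappa> (Inl (g, contract t0 \<tau> y))) = \<rho> (\<kappa> (Inl (g, contract t0 \<tau> y')))"
proof -
  have in_\<Omega>: "Inl (k, y) \<in> topspace \<Omega>" if "k \<in> carrier G" "y \<in> line_chart t0" for k y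
    using that by auto
  obtain u where u: "u \<in> U" "\<kappa> (Inl (u \<otimes> g, y)) = \<kappa> (Inl (g, y'))"
    using orbit_kappa_eq[OF in_\<Omega>[OF g y(1)] in_\<Omega>[OF g y(2)] eq] by (auto simp: act\<Omega>_def)
  have uG: "u \<in> carrier G" using u U_in_G by simp
  \<comment> \<open>The lattice coordinates of a label relative to \<open>g\<close>;
    \<open>tr\<close> then rewrites a point so that its label becomes \<open>g\<close>.\<close>
  define crd where "crd k = (THE ij. k = g \<otimes> per (fst ij) (snd ij))" for k
  have crd: "crd (g \<otimes> per i j) = (i, j)" for i j
    unfolding crd_def using g by (intro the_equality) (auto simp: per_inject)
  define tr where "tr k = translate (fst (crd k)) (snd (crd k))" for k
  define f where "f x = (if x \<in> line_nbhd g t0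
      then case x of Inl (k, y) \<Rightarrow> \<kappa> (Inl (g, contract t0 \<tau> (tr k y))) | Inr e \<Rightarrow> undefined else undefined)" for x
  have f_eq: "f (Inl (u \<otimes> g, y)) = f (Inl (g, y'))"
  proof (rule kappa_invariant[OF _ _ _ u(2)])
    show "f (Inl (k, ((s, t), 1))) = f (Inl (k, ((s', t), 1)))" if k: "k \<in> carrier G" for k s s' t
    proof -
      have "(Inl (k, ((s, t), 1)) \<in> line_nbhd g t0) = (Inl (k, ((s', t), 1)) \<in> line_nbhd g t0)"
        using k by (simp add: Inl_in_line_nbhd[OF g])
      moreover have "\<kappa> (Inl (g, contract t0 \<tau> (tr k ((s, t), 1)))) = \<kappa> (Inl (g, contract t0 \<tau> (tr k ((s', t), 1))))"
        by (simp add: tr_def contract_def) (rule kappa_line)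
      ultimately show ?thesis by (simp add: f_def)
    qed
    show "f (Inl (k \<otimes> per i j, ((s, t), r))) = f (Inl (k, translate i j ((s, t), r)))"
      if k: "k \<in> carrier G" and r: "r \<in> {0..1}" for k i j s t r
    proof -
      have \<kappa>_eq: "\<kappa> (Inl (k \<otimes> per i j, ((s, t), r))) = \<kappa> (Inl (k, translate i j ((s, t), r)))"
        using kappa_per[OF k r] .
      have iff: "Inl (k \<otimes> per i j, ((s, t), r)) \<in> line_nbhd g t0 \<longleftrightarrow> Inl (k, translate i j ((s, t), r)) \<in> line_nbhd g t0"
      proof
        assume "Inl (k \<otimes> per i j, ((s, t), r)) \<in> line_nbhd g t0"
        then show "Inl (k, translate i j ((s, t), r)) \<in> line_nbhd g t0"
          by (rule line_nbhd_saturated[OF g]) (use k r \<kappa>_eq in auto)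
      next
        assume "Inl (k, translate i j ((s, t), r)) \<in> line_nbhd g t0"
        then show "Inl (k \<otimes> per i j, ((s, t), r)) \<in> line_nbhd g t0"
          by (rule line_nbhd_saturated[OF g]) (use k r \<kappa>_eq in auto)
      qed
      have "tr (k \<otimes> per i j) ((s, t), r) = tr k (translate i j ((s, t), r))"
        if mem: "Inl (k, translate i j ((s, t), r)) \<in> line_nbhd g t0"
      proof -
        obtain i' j' where "k = g \<otimes> per i' j'" using mem by (auto simp: line_nbhd_def)
        then have "crd k = (i', j')" "crd (k \<otimes> per i j) = (i' + i, j' + j)"
          using g crd by (auto simp: m_assoc per_mult)
        then show ?thesis by (simp add: tr_def)
      qed
      then show ?thesis using iff by (auto simp: f_def)
    qed
    show "f (Inl (k, (v, 0))) = f (Inr (act k (\<phi> v)))" for k v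
      by (auto simp: f_def line_nbhd_def)
  qed (use uG g y in_\<Omega> in auto)
  note y_in = Inl_chart_in_line_nbhd[OF g y(1)] and y'_in = Inl_chart_in_line_nbhd[OF g y(2)]
  have uy_in: "Inl (u \<otimes> g, y) \<in> line_nbhd g t0"
    using line_nbhd_saturated[OF g y'_in, of "Inl (u \<otimes> g, y)"] u uG g in_\<Omega> y(1) by simp
  obtain n where n: "u \<otimes> g = g \<otimes> per n 0"
    using line_nbhd_wandering[OF g uG y_in] uy_in by (auto simp: act\<Omega>_def)
  have tr_g: "tr g y' = y'"
    using crd[of 0 0] g by (simp add: tr_def case_prod_unfold)
  \<comment> \<open>The second component 0 leaves \<open>t\<close> unchanged, so moving towards
    \<open>t0\<close> commutes with the translation.\<close>
  have "contract t0 \<tau> (tr (u \<otimes> g) y) = translate n 0 (contract t0 \<tau> y)"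
    unfolding n tr_def crd by (simp add: contract_def case_prod_unfold)
  then have "f (Inl (u \<otimes> g, y)) = \<kappa> (Inl (g, translate n 0 (contract t0 \<tau> y)))"
    using uy_in by (simp add: f_def)
  also have "\<dots> = \<kappa> (Inl (u \<otimes> g, contract t0 \<tau> y))"
  proof -
    obtain s t r where c: "contract t0 \<tau> y = ((s, t), r)" by (metis surj_pair)
    then have "r \<in> {0..1}" using contract_line_chart[OF \<tau> y(1)] by auto
    then show ?thesis unfolding n c using kappa_per[OF g, of r n 0 s t] by simp
  qed
  finally have "\<kappa> (Inl (g, contract t0 \<tau> y')) = \<kappa> (act\<Omega> u (Inl (g, contract t0 \<tau> y)))"
    using f_eq y'_in by (simp add: f_def tr_g act\<Omega>_def)
  then show ?thesis
    using orbit_kappa_act[OF u(1) in_\<Omega>[OF g contract_line_chart[OF \<tau> y(1)]]] by simp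
qed

text \<open>The chart is a piece of a single slab and in general not saturated in
  \<open>\<Omega>\<close>, so the restricted projection is not a quotient map for free. It is one
  because the preimage of \<open>V\<close> in any slab is a union of translates of its preimage in
  the chart.\<close>

lemma quotient_map_line_chart:
  assumes g: "g \<in> carrier G"
  defines "Q \<equiv> orbit_space Z U (egg_action G act)"
  shows "quotient_map (top_of_set (line_chart t0)) (subtopology Q (\<rho> ` \<kappa> ` line_nbhd g t0)) (\<lambda>y. \<rho> (\<kappa> (Inl (g, y))))"
proof -
  let ?m = "\<lambda>y. \<rho> (\<kappa> (Inl (g, y)))" and ?W = "\<rho> ` \<kappa> ` line_nbhd g t0"
  have W: "?W = ?m ` line_chart t0" unfolding kappa_line_nbhd[OF g] image_image ..
  have "openin Z (\<kappa> ` line_nbhd g t0)"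
    using openin_line_nbhd[OF g] line_nbhd_saturated[OF g] by (rule openin_kappa_image)
  then have openW: "openin Q ?W" unfolding Q_def using K.openin_orbit_proj_image[OF subgroup_self_U] by simp
  have q: "quotient_map \<Omega> Q (\<rho> \<circ> \<kappa>)"
    unfolding Q_def using quotient_map_kappa K.quotient_map_orbit_proj[OF subgroup_self_U]
    by (rule quotient_map_compose)
  have "continuous_map (top_of_set (line_chart t0)) Q (\<rho> \<circ> (\<lambda>y. \<kappa> (Inl (g, y))))"
    unfolding Q_def
    by (rule continuous_map_compose[OF continuous_map_line_chart[OF g] K.continuous_map_orbit_proj[OF subgroup_self_U]])
  then have contm: "continuous_map (top_of_set (line_chart t0)) Q ?m" by (simp add: o_def)
  show ?thesis
    unfolding quotient_map_def
  proof (intro conjI allI impI)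
    show "?m ` topspace (top_of_set (line_chart t0)) = topspace (subtopology Q ?W)"
      using openin_subset[OF openW] W by auto
    fix V assume "V \<subseteq> topspace (subtopology Q ?W)"
    then have V: "V \<subseteq> ?W" by simp
    let ?V = "{y \<in> line_chart t0. ?m y \<in> V}"
    have "openin Q V" if open_V: "openin (top_of_set (line_chart t0)) ?V"
    proof -
      have slab_V: "openin slab ?V"
      proof -
        have "openin slab (UNIV \<times> {0..1} \<inter> ((UNIV \<times> {t0 - 1 / 2<..<t0 + 1 / 2}) \<times> {0<..}))"
          unfolding slab_eq by (intro openin_open_Int open_Times) auto
        moreover have "UNIV \<times> {0..1} \<inter> ((UNIV \<times> {t0 - 1 / 2<..<t0 + 1 / 2}) \<times> {0<..}) = line_chart t0" by auto
        ultimately have "openin (top_of_set (UNIV \<times> {0..1})) (line_chart t0)" unfolding slab_eq by simp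
        then show ?thesis unfolding slab_eq using open_V by (rule openin_trans[rotated])
      qed
      have "openin \<Omega> {x \<in> topspace \<Omega>. (\<rho> \<circ> \<kappa>) x \<in> V}"
      proof (rule openin_\<Omega>I)
        fix k assume k: "k \<in> carrier G"
        define A where "A i j = topspace slab \<inter> translate i j -` ?V" for i j
        have A_iff: "y \<in> A i j \<longleftrightarrow> y \<in> topspace slab \<and> translate i j y \<in> ?V" for y i j
          by (simp only: A_def Int_iff vimage_eq)
        \<comment> \<open>The slab with label \<open>k\<close> reaches the chart through some
          \<open>u\<close> in \<open>U\<close> and a lattice element; every such lattice element
          contributes one translate \<open>A i j\<close>.\<close>
        have "{y. Inl (k, y) \<in> {x \<in> topspace \<Omega>. (\<rho> \<circ> \<kappa>) x \<in> V}} = \<Union>{A i j |i j. \<exists>u\<in>U. u \<otimes> k = g \<otimes> per i j}"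
        proof (intro equalityI subsetI)
          fix y assume "y \<in> {y. Inl (k, y) \<in> {x \<in> topspace \<Omega>. (\<rho> \<circ> \<kappa>) x \<in> V}}"
          then have y: "Inl (k, y) \<in> topspace \<Omega>" "\<rho> (\<kappa> (Inl (k, y))) \<in> V" by auto
          then obtain w where w: "w \<in> line_nbhd g t0" "\<rho> (\<kappa> (Inl (k, y))) = \<rho> (\<kappa> w)" using V by blast
          have "w \<in> topspace \<Omega>" using w(1) line_nbhd_subset[OF g] by blast
          from orbit_kappa_eq[OF y(1) this w(2)] obtain u where u: "u \<in> U" "\<kappa> (act\<Omega> u (Inl (k, y))) = \<kappa> w" .
          obtain s t r where y': "y = ((s, t), r)" by (metis surj_pair)
          have "act\<Omega> u (Inl (k, y)) \<in> line_nbhd g t0"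
            by (rule line_nbhd_saturated[OF g w(1)]) (use u U_in_G y act\<Omega>_closed in auto)
          then have "Inl (u \<otimes> k, ((s, t), r)) \<in> line_nbhd g t0" by (simp add: act\<Omega>_def y')
          then obtain i j where ij: "u \<otimes> k = g \<otimes> per i j" "translate i j y \<in> line_chart t0"
            using Inl_in_line_nbhd[OF g, of "u \<otimes> k" s t r t0] u(1) k U_in_G y' by auto
          have "?m (translate i j y) = \<rho> (\<kappa> (act\<Omega> u (Inl (k, y))))"
            using kappa_per[OF g, of r i j s t] y(1) by (simp add: y' act\<Omega>_def ij(1))
          also have "\<dots> = \<rho> (\<kappa> (Inl (k, y)))" using orbit_kappa_act[OF u(1) y(1)] .
          finally have "translate i j y \<in> ?V" using ij(2) y(2) by simp
          moreover have "y \<in> topspace slab" using y(1) by (simp add: y')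
          ultimately have "y \<in> A i j" unfolding A_iff by (rule conjI[rotated])
          then show "y \<in> \<Union>{A i j |i j. \<exists>u\<in>U. u \<otimes> k = g \<otimes> per i j}" using ij(1) u(1) by blast
        next
          fix y assume "y \<in> \<Union>{A i j |i j. \<exists>u\<in>U. u \<otimes> k = g \<otimes> per i j}"
          then obtain i j u where u: "u \<in> U" "u \<otimes> k = g \<otimes> per i j" and y: "y \<in> topspace slab" "translate i j y \<in> ?V"
            by (auto simp only: A_iff mem_Collect_eq Union_iff)
          obtain s t r where y': "y = ((s, t), r)" by (metis surj_pair)
          have yO: "Inl (k, y) \<in> topspace \<Omega>" using y(1) k by (simp add: y')
          have "?m (translate i j y) = \<rho> (\<kappa> (act\<Omega> u (Inl (k, y))))"
            using kappa_per[OF g, of r i j s t] yO by (simp add: y' act\<Omega>_def u(2))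
          also have "\<dots> = \<rho> (\<kappa> (Inl (k, y)))" using orbit_kappa_act[OF u(1) yO] .
          finally show "y \<in> {y. Inl (k, y) \<in> {x \<in> topspace \<Omega>. (\<rho> \<circ> \<kappa>) x \<in> V}}" using yO y(2) by simp
        qed
        moreover have "openin slab (A i j)" for i j
        proof -
          have "continuous_on (UNIV \<times> {0..1}) (translate i j)"
            unfolding case_prod_unfold by (intro continuous_intros)
          moreover have "translate i j \<in> UNIV \<times> {0..1} \<rightarrow> UNIV \<times> {0..1}" by auto
          ultimately have "openin slab (UNIV \<times> {0..1} \<inter> translate i j -` ?V)"
            using slab_V unfolding slab_eq by (rule continuous_openin_preimage)
          then show ?thesis by (simp add: A_def)
        qed
        ultimately show "openin slab {y. Inl (k, y) \<in> {x \<in> topspace \<Omega>. (\<rho> \<circ> \<kappa>) x \<in> V}}" by auto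
      next
        \<comment> \<open>The neighbourhood is saturated and invariant under passing to other
          labels, and it contains no point of \<open>E\<close>, so \<open>E\<close> contributes
          nothing to the preimage.\<close>
        have "(\<rho> \<circ> \<kappa>) (Inr e) \<notin> V" if "e \<in> E" for e
        proof
          assume "(\<rho> \<circ> \<kappa>) (Inr e) \<in> V"
          then obtain w where w: "w \<in> line_nbhd g t0" "\<rho> (\<kappa> (Inr e)) = \<rho> (\<kappa> w)" using V by force
          have wO: "w \<in> topspace \<Omega>" and eO: "Inr e \<in> topspace \<Omega>" using w(1) line_nbhd_subset[OF g] that by auto
          from orbit_kappa_eq[OF eO wO w(2)] obtain u where u: "u \<in> U" "\<kappa> (act\<Omega> u (Inr e)) = \<kappa> w" .
          have "act\<Omega> u (Inr e) \<in> line_nbhd g t0"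
            by (rule line_nbhd_saturated[OF g w(1)]) (use u U_in_G that act\<Omega>_closed eO in auto)
          then show False by (simp add: act\<Omega>_def line_nbhd_def)
        qed
        then have "{e. Inr e \<in> {x \<in> topspace \<Omega>. (\<rho> \<circ> \<kappa>) x \<in> V}} = {}" by auto
        then show "openin (top_of_set E) {e. Inr e \<in> {x \<in> topspace \<Omega>. (\<rho> \<circ> \<kappa>) x \<in> V}}"
          by (simp only: openin_empty)
      qed auto
      moreover have "V \<subseteq> topspace Q" using V openin_subset[OF openW] by blast
      ultimately show ?thesis using q unfolding quotient_map_def by blast
    qed
    moreover have "openin (top_of_set (line_chart t0)) ?V" if "openin Q V"
      using openin_continuous_map_preimage[OF contm that] by simp
    moreover have "openin (subtopology Q ?W) V \<longleftrightarrow> openin Q V"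
      using V openin_open_subtopology[OF openW] by blast
    ultimately show "openin (top_of_set (line_chart t0)) {y \<in> topspace (top_of_set (line_chart t0)). ?m y \<in> V} =
        openin (subtopology Q ?W) V"
      by auto
  qed
qed

lemma line_nbhd_null_homotopic:
  assumes g: "g \<in> carrier G"
  defines "Q \<equiv> orbit_space Z U (egg_action G act)"
  shows "homotopic_with (\<lambda>_. True) (subtopology Q (\<rho> ` \<kappa> ` line_nbhd g t0)) Q id (\<lambda>_. \<rho> (\<kappa> (Inl (g, ((0, t0), 1)))))"
proof -
  let ?m = "\<lambda>y. \<rho> (\<kappa> (Inl (g, y)))" and ?W = "subtopology Q (\<rho> ` \<kappa> ` line_nbhd g t0)"
  let ?I = "top_of_set {0..1::real}" and ?Y = "top_of_set (line_chart t0)"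
  have qm: "quotient_map ?Y ?W ?m" unfolding Q_def by (rule quotient_map_line_chart[OF g])
  let ?h = "\<lambda>x. ?m (contract t0 (fst x) (snd x))"
  have "continuous_on ({0..1} \<times> line_chart t0) (\<lambda>x. contract t0 (fst x) (snd x))"
    unfolding contract_def case_prod_unfold by (intro continuous_intros)
  then have "continuous_map (prod_topology ?I ?Y) ?Y (\<lambda>x. contract t0 (fst x) (snd x))"
    unfolding prod_topology_subtopology_eu using contract_line_chart by (auto simp: continuous_map_in_subtopology)
  from continuous_map_compose[OF this continuous_map_line_chart[OF g]]
  have "continuous_map (prod_topology ?I ?Y) Z (\<lambda>x. \<kappa> (Inl (g, contract t0 (fst x) (snd x))))" by (simp add: o_def)
  from continuous_map_compose[OF this K.continuous_map_orbit_proj[OF subgroup_self_U]]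
  have conth: "continuous_map (prod_topology ?I ?Y) Q ?h" by (simp add: o_def Q_def)
  show ?thesis
  proof (rule homotopic_with_from_quotient[OF qm conth])
    fix y assume y: "y \<in> topspace ?Y"
    obtain s t r where y': "y = ((s, t), r)" by (metis surj_pair)
    show "?h (0, y) = id (?m y)" by (simp add: contract_def y')
    show "?h (1, y) = \<rho> (\<kappa> (Inl (g, ((0, t0), 1))))"
      using kappa_line[of g s t0 0] by (simp add: contract_def y')
  next
    fix \<tau> x y assume "\<tau> \<in> {0..1::real}" "x \<in> topspace ?Y" "y \<in> topspace ?Y" "?m x = ?m y"
    then show "?h (\<tau>, x) = ?h (\<tau>, y)" using contract_invariant[OF g, of \<tau> x t0 y] by simp
  qed
qed

text \<open>One neighbourhood both lifts paths and locates the elements under which it meets its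
  translate. Off the lines only the identity does so, written as a conjugate with
  \<open>n = 0\<close>; near a line only conjugates of powers of \<open>a\<close> do.\<close>

lemma egg_neighbourhood:
  assumes "z \<in> topspace Z"
  shows "\<exists>N. openin Z N \<and> z \<in> N \<and> K.lifts_paths_over U N \<and>
    (\<forall>u\<in>U. egg_action G act u ` N \<inter> N \<noteq> {} \<longrightarrow> (\<exists>g\<in>carrier G. \<exists>n. u = g \<otimes> per n 0 \<otimes> inv g))"
proof -
  obtain x where x: "x \<in> topspace \<Omega>" "z = \<kappa> x" using assms by (auto simp: topspace_Z)
  show ?thesis
  proof (cases "off_line x")
    case True
    then obtain N where N: "openin Z N" "\<kappa> x \<in> N" "\<And>u. u \<in> carrier G \<Longrightarrow> egg_action G act u ` N \<inter> N \<noteq> {} \<Longrightarrow> u = \<one>"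
      using off_line_neighbourhood x(1) by blast
    have N3: "K.lifts_paths_over U N"
      using K.lifts_paths_over_if_free[OF subgroup_self_U N(1)] N(3) U_in_G by simp
    have "\<exists>g\<in>carrier G. \<exists>n. \<one> = g \<otimes> per n 0 \<otimes> inv g"
      by (intro bexI[of _ \<one>] exI[of _ 0]) auto
    then have N4: "\<exists>g\<in>carrier G. \<exists>n. u = g \<otimes> per n 0 \<otimes> inv g" if "u \<in> U" "egg_action G act u ` N \<inter> N \<noteq> {}" for u
      using N(3)[OF U_in_G[OF that(1)] that(2)] by simp
    show ?thesis unfolding x(2) by (intro exI[of _ N] conjI ballI impI N(1,2) N3 N4)
  next
    case False
    obtain g s t where g: "x = Inl (g, ((s, t), 1))" "g \<in> carrier G"
      using x(1) False by (cases rule: \<Omega>_cases) (auto simp: off_line_def)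
    let ?N = "\<kappa> ` line_nbhd g t"
    have N1: "openin Z ?N"
      using openin_line_nbhd[OF g(2)] line_nbhd_saturated[OF g(2)] by (rule openin_kappa_image)
    have N2: "z \<in> ?N"
      unfolding kappa_line_nbhd[OF g(2)] x(2) g(1) by (rule imageI) simp
    have N3: "K.lifts_paths_over U ?N"
      by (rule K.lifts_paths_over_if_null_homotopic[OF subgroup_self_U _ _ line_nbhd_null_homotopic[OF g(2)]])
         (use line_nbhd_path_connected[OF g(2)] openin_subset[OF N1] in auto)
    have N4: "\<exists>g\<in>carrier G. \<exists>n. u = g \<otimes> per n 0 \<otimes> inv g"
      if u: "u \<in> U" and meet: "egg_action G act u ` ?N \<inter> ?N \<noteq> {}" for u
    proof -
      obtain v w where vw: "v \<in> line_nbhd g t" "w \<in> line_nbhd g t" "egg_action G act u (\<kappa> v) = \<kappa> w"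
        using meet by auto
      have v: "v \<in> topspace \<Omega>" using vw(1) line_nbhd_subset[OF g(2)] by blast
      have uG: "u \<in> carrier G" using u by (rule U_in_G)
      have "act\<Omega> u v \<in> line_nbhd g t"
        by (rule line_nbhd_saturated[OF g(2) vw(2)]) (use vw(3) v uG act\<Omega>_closed in \<open>auto simp: egg_action_kappa\<close>)
      then obtain n where "u \<otimes> g = g \<otimes> per n 0" using line_nbhd_wandering[OF g(2) uG vw(1)] by blast
      moreover have "u = u \<otimes> g \<otimes> inv g" using uG g(2) by (simp add: m_assoc)
      ultimately have "u = g \<otimes> per n 0 \<otimes> inv g" by simp
      then show ?thesis using g(2) by blast
    qed
    show ?thesis by (intro exI[of _ ?N] conjI ballI impI N1 N2 N3 N4)
  qed
qed

text \<open>The fixed point is the one over 0 on the line of the slab \<open>g\<close>: a power of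
  \<open>a\<close> shifts only \<open>s\<close>, which height 1 forgets.\<close>

lemma egg_fixed_point:
  assumes g: "g \<in> carrier G" and u: "u \<in> U" "u = g \<otimes> per n 0 \<otimes> inv g"
  shows "\<exists>z\<in>topspace Z. egg_action G act u z = z"
proof -
  let ?x = "Inl (g, ((0, 0), 1))"
  have x: "?x \<in> topspace \<Omega>" using g by simp
  have "u \<otimes> g = g \<otimes> per n 0" using u(2) g by (simp add: m_assoc)
  then have "egg_action G act u (\<kappa> ?x) = \<kappa> (Inl (g \<otimes> per n 0, ((0, 0), 1)))"
    using U_in_G[OF u(1)] x by (simp add: egg_action_kappa act\<Omega>_def)
  also have "\<dots> = \<kappa> ?x" using kappa_per[OF g, of 1 n 0 0 0] kappa_line[of g "of_int n" 0 0] by simp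
  finally show ?thesis using x by (intro bexI[of _ "\<kappa> ?x"]) (auto simp: topspace_Z)
qed

end

end

section \<open>Deck transformations and meridians\<close>

text \<open>The hull is the intersection of all normal subgroups containing \<open>S\<close>. The
  whole group is one of them, so the intersection is over a nonempty set and is again a normal
  subgroup.\<close>

lemma (in group) normal_normal_closure:
  assumes "S \<subseteq> carrier G"
  shows "normal_closure G S \<lhd> G" "S \<subseteq> normal_closure G S"
    "N \<lhd> G \<Longrightarrow> S \<subseteq> N \<Longrightarrow> normal_closure G S \<subseteq> N"
proof -
  let ?A = "{N. N \<lhd> G \<and> S \<subseteq> N}"
  have eq: "normal_closure G S = \<Inter>?A" by (simp add: normal_closure_def hull_def)
  have "carrier G \<lhd> G" using subgroup_self by (auto simp: normal_inv_iff)
  then have ne: "?A \<noteq> {}" using assms by blast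
  have "subgroup (\<Inter>?A) G" using ne by (intro subgroups_Inter) (auto intro: normal_imp_subgroup)
  moreover have "x \<otimes> h \<otimes> inv x \<in> \<Inter>?A" if "x \<in> carrier G" "h \<in> \<Inter>?A" for x h
    using that by (auto simp: normal_inv_iff)
  ultimately show "normal_closure G S \<lhd> G" unfolding eq normal_inv_iff by blast
  show "S \<subseteq> normal_closure G S" unfolding normal_closure_def by (rule hull_subset)
  show "N \<lhd> G \<Longrightarrow> S \<subseteq> N \<Longrightarrow> normal_closure G S \<subseteq> N"
    unfolding normal_closure_def by (rule hull_minimal)
qed

text \<open>Conjugation is an endomorphism, and endomorphisms respect integer powers.\<close>

lemma (in group) int_pow_conjugate:
  assumes g: "g \<in> carrier G" and b: "b \<in> carrier G"
  shows "(inv g \<otimes> b \<otimes> g) [^] (i::int) = inv g \<otimes> b [^] i \<otimes> g"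
proof -
  have cancel: "g \<otimes> (inv g \<otimes> x) = x" if "x \<in> carrier G" for x using g that by (simp flip: m_assoc)
  have "(\<lambda>x. inv g \<otimes> x \<otimes> g) \<in> hom G G"
    using g by (intro homI) (simp_all add: m_assoc cancel)
  then interpret group_hom G G "\<lambda>x. inv g \<otimes> x \<otimes> g"
    by (simp add: group_hom_def group_hom_axioms_def is_group)
  show ?thesis using hom_int_pow[OF b, of i] by simp
qed

lemma pathin_top_of_set: "pathin (top_of_set X) c \<longleftrightarrow> path c \<and> path_image c \<subseteq> X"
  by (auto simp: pathin_def path_def path_image_def continuous_map_in_subtopology)

lemma path_homotopic_top_of_set: "path_homotopic (top_of_set X) c d \<longleftrightarrow> homotopic_paths X c d"
  using path_homotopic_iff[of c "c 0" "c 1" "top_of_set X" d]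
  by (simp add: homotopic_paths_def pathstart_def pathfinish_def)

text \<open>\<open>deck_action\<close> ties \<open>g\<close> to a loop only through its effect on
  \<open>e0\<close>. If \<open>act g\<close> fixes \<open>e\<close>, it agrees with the identity on
  \<open>E\<close>, as both lift \<open>p\<close>. So the lift of a loop representing
  \<open>g\<close> closes up at \<open>e0\<close>; it is null-homotopic in \<open>E\<close>, and the
  homotopy projects to \<open>X\<close>.\<close>

lemma deck_action_free:
  assumes cover: "universal_cover E p X" and e0: "e0 \<in> E" and deck: "deck_action E p X e0 act"
    and g: "g \<in> carrier (fundamental_group (top_of_set X) (p e0))" and e: "e \<in> E" "act g e = e"
  shows "g = \<one>\<^bsub>fundamental_group (top_of_set X) (p e0)\<^esub>"
proof -
  let ?X = "top_of_set X"
  have cov: "covering_space E p X" and sc: "simply_connected E"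
    using cover by (auto simp: universal_cover_def)
  interpret group_action "fundamental_group ?X (p e0)" E act
    using deck by (simp add: deck_action_def)
  have act_g: "continuous_on E (act g)" "\<And>e. e \<in> E \<Longrightarrow> p (act g e) = p e"
    using deck g by (auto simp: deck_action_def)
  have "connected E"
    using simply_connected_imp_path_connected_gen[OF sc] by (rule path_connected_imp_connected)
  then have "act g e0 = e0"
    using act_g e e0 element_image[OF g]
    by (intro covering_space_lift_unique_connected[OF cov, of E "act g" "\<lambda>x. x" e e0]) auto
  moreover obtain c where c: "c \<in> loops_at ?X (p e0)" "g = loop_class ?X (p e0) c"
    using g by (auto simp: fundamental_group_def)
  obtain h where h: "path h" "path_image h \<subseteq> E" "pathstart h = e0" "\<And>t. t \<in> {0..1} \<Longrightarrow> p (h t) = c t"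
    using covering_space_path_lift[OF cov _ _ e0, of c] c(1)
    by (auto simp: loops_at_def pathin_top_of_set pathstart_def)
  have contp: "continuous_on E p" and pE: "p ` E = X" using cov by (auto simp: covering_space_def)
  have ph: "homotopic_paths X c (p \<circ> h)"
    using h(4) c(1) by (intro homotopic_paths_eq) (auto simp: loops_at_def pathin_top_of_set)
  have end_h: "p (pathfinish h) = p e0"
    using h(4)[of 1] c(1) by (simp add: pathfinish_def loops_at_def)
  have "p \<circ> h \<in> loops_at ?X (p e0)"
    using homotopic_paths_imp_path[OF ph] homotopic_paths_imp_subset[OF ph] end_h h(3)
    by (simp add: loops_at_def pathin_top_of_set pathstart_def pathfinish_def)
  then have gh: "g = loop_class ?X (p e0) (p \<circ> h)"
    unfolding c(2) using loop_class_eq_iff[OF c(1)] ph by (simp add: path_homotopic_top_of_set)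
  have "act g e0 = pathfinish h"
    using deck h(1-3) end_h unfolding gh by (simp add: deck_action_def)
  ultimately have "pathfinish h = e0" by simp
  then have "homotopic_paths E h (\<lambda>_. e0)"
    using h e0 by (intro simply_connected_imp_homotopic_paths[OF sc]) auto
  then have "homotopic_paths X (p \<circ> h) (p \<circ> (\<lambda>_. e0))"
    by (rule homotopic_paths_continuous_image) (use contp pE in auto)
  then have "homotopic_paths X (p \<circ> h) (\<lambda>_. p e0)" by (simp add: o_def)
  moreover from homotopic_paths_imp_path[OF this] homotopic_paths_imp_subset[OF this]
  have "(\<lambda>_. p e0) \<in> loops_at ?X (p e0)" by (simp add: loops_at_def pathin_top_of_set)
  ultimately have "g = loop_class ?X (p e0) (\<lambda>_. p e0)"
    unfolding gh using loop_class_eq_iff[OF \<open>p \<circ> h \<in> loops_at ?X (p e0)\<close>] by (simp add: path_homotopic_top_of_set)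
  then show ?thesis by (simp add: fundamental_group_def)
qed

text \<open>The sphere is closed, so it contains the closure of \<open>V\<close>; the boundary torus
  avoids \<open>V\<close> and hence lies in the exterior.\<close>

lemma loop_class_boundary_torus:
  assumes "tubular_neighbourhood K V" "simple_closed_at x0 c" "path_image c \<subseteq> boundary_torus V"
  shows "loop_class (top_of_set (knot_exterior V)) x0 c \<in> carrier (knot_group V x0)"
proof -
  have "V \<subseteq> S3"
  proof -
    obtain T :: "complex \<times> complex \<Rightarrow> real^4" where "T ` (sphere 0 1 \<times> cball 0 2) \<subseteq> S3" "V = T ` (sphere 0 1 \<times> ball 0 1)"
      using assms(1) unfolding tubular_neighbourhood_def by blast
    moreover have "sphere 0 1 \<times> ball 0 1 \<subseteq> sphere 0 1 \<times> (cball 0 2 :: complex set)" by auto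
    ultimately show ?thesis by blast
  qed
  then have "closure V \<subseteq> S3" by (rule closure_minimal) simp
  then have "path_image c \<subseteq> knot_exterior V"
    using assms(3) unfolding boundary_torus_def knot_exterior_def by blast
  then have "c \<in> loops_at (top_of_set (knot_exterior V)) x0"
    using assms(2) by (simp add: loops_at_def pathin_top_of_set simple_closed_at_def simple_path_imp_path pathstart_def pathfinish_def)
  then show ?thesis by (simp add: fundamental_group_def)
qed

theorem propositionA:
  fixes K V :: "(real^4) set"
    and \<theta> :: "(real^4) chain set \<Rightarrow> int"
    and x0 :: "real^4"
    and \<mu> \<nu> :: "real \<Rightarrow> real^4"
    and G :: "(real \<Rightarrow> real^4) set monoid"
    and a l :: "(real \<Rightarrow> real^4) set"
    and E :: "('e::topological_space) set"
    and p :: "'e \<Rightarrow> real^4"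
    and e0 :: 'e
    and act :: "(real \<Rightarrow> real^4) set \<Rightarrow> 'e \<Rightarrow> 'e"
    and \<phi> :: "real \<times> real \<Rightarrow> 'e"
    and U M :: "(real \<Rightarrow> real^4) set set"
    and Q :: "((((real \<Rightarrow> real^4) set \<times> (((real \<times> real) \<times> real) + real) set) set + 'e) set) set topology"
    and z :: "(((real \<Rightarrow> real^4) set \<times> (((real \<times> real) \<times> real) + real) set) set + 'e) set set"
  assumes "prime_knot K" and "tubular_neighbourhood K V" and "linking_orientation K \<theta>"
    and "meridian_curve K V \<theta> x0 \<mu>" and "longitude_curve K V x0 \<mu> \<nu>"
    and "G = knot_group V x0"
    and "a = loop_class (top_of_set (knot_exterior V)) x0 \<mu>"
    and "l = loop_class (top_of_set (knot_exterior V)) x0 \<nu>"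
    and "universal_cover E p (knot_exterior V)"
    and "e0 \<in> E" and "p e0 = x0"
    and "deck_action E p (knot_exterior V) e0 act"
    and "boundary_chart G a l (connected_component_set (E \<inter> p -` boundary_torus V) e0) act \<phi>"
    and "U \<lhd> G" and "finite (rcosets\<^bsub>G\<^esub> U)"
    and "M = normal_closure (G\<lparr>carrier := U\<rparr>) (meridian_powers G a \<inter> U)"
    and "Q = orbit_space (egg_space G a l E act \<phi>) U (egg_action G act)"
    and "z \<in> topspace Q"
  shows "\<exists>q. short_exact (G\<lparr>carrier := M\<rparr>) (G\<lparr>carrier := U\<rparr>) (fundamental_group Q z) (\<lambda>x. x) q"
proof -
  let ?X = "knot_exterior V"
  have G: "G = fundamental_group (top_of_set ?X) (p e0)" using assms by simp
  have cov: "covering_space E p ?X" and sc: "simply_connected E"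
    using assms(9) by (auto simp: universal_cover_def)
  have deck: "group_action G E act"
    "\<And>g. g \<in> carrier G \<Longrightarrow> continuous_on E (act g)" "\<And>g e. g \<in> carrier G \<Longrightarrow> e \<in> E \<Longrightarrow> p (act g e) = p e"
    using assms(12) unfolding deck_action_def G by auto
  interpret group_action G E act by (rule deck(1))
  have aG: "a \<in> carrier G" and lG: "l \<in> carrier G"
    using loop_class_boundary_torus[OF assms(2)] assms(4-8) by (auto simp: meridian_curve_def longitude_curve_def)
  let ?P = "connected_component_set (E \<inter> p -` boundary_torus V) e0"
  obtain \<psi> where \<psi>: "homeomorphism UNIV ?P \<phi> \<psi>"
    and chart: "\<And>i j s t. \<phi> (s + of_int i, t + of_int j) = act (a [^]\<^bsub>G\<^esub> (i::int) \<otimes>\<^bsub>G\<^esub> l [^]\<^bsub>G\<^esub> (j::int)) (\<phi> (s, t))"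
    using assms(13) unfolding boundary_chart_def by blast
  have PE: "?P \<subseteq> E" using connected_component_subset by blast
  \<comment> \<open>A set on which \<open>p\<close> is injective is wandering: a point and its
    translate in that set have the same image under \<open>p\<close>, hence coincide, and the action
    is free.\<close>
  interpret egg G E act a l \<phi>
  proof
    fix e assume e: "e \<in> E"
    obtain N where N: "openin (top_of_set E) N" "e \<in> N" "inj_on p N"
      using covering_space_sheet[OF cov e e refl] by metis
    have "g = \<one>\<^bsub>G\<^esub>" if g: "g \<in> carrier G" "act g ` N \<inter> N \<noteq> {}" for g
    proof -
      obtain n where n: "n \<in> N" "act g n \<in> N" using g(2) by auto
      have nE: "n \<in> E" using n(1) openin_imp_subset[OF N(1)] by auto
      have "act g n = n" by (rule inj_onD[OF N(3) deck(3)[OF g(1) nE] n(2) n(1)])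
      then show ?thesis using deck_action_free[OF assms(9,10,12)] g(1) nE unfolding G by blast
    qed
    then show "\<exists>N. openin (top_of_set E) N \<and> e \<in> N \<and> (\<forall>g\<in>carrier G. act g ` N \<inter> N \<noteq> {} \<longrightarrow> g = \<one>\<^bsub>G\<^esub>)"
      using N(1,2) by blast
  next
    show "\<phi> v \<in> E" for v using \<psi> PE by (auto simp: homeomorphism_def)
    show "inj \<phi>" using \<psi> by (metis homeomorphism_def inj_on_inverseI)
  qed (use deck aG lG chart \<psi> in \<open>auto simp: homeomorphism_def\<close>)
  have U: "subgroup U G" using assms(14) by (rule normal_imp_subgroup)
  let ?K = "G\<lparr>carrier := U\<rparr>"
  interpret K: topological_action ?K Z "egg_action G act" using U by (rule topological_action_egg)
  have K_carrier: "carrier ?K = U" by simp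
  let ?S = "meridian_powers G a \<inter> U"
  have M: "M \<lhd> ?K" "?S \<subseteq> M" "\<And>N. N \<lhd> ?K \<Longrightarrow> ?S \<subseteq> N \<Longrightarrow> M \<subseteq> N"
    using K.normal_normal_closure[of ?S] assms(16) by auto
  have subM: "subgroup M ?K" using M(1) by (rule normal_imp_subgroup)
  \<comment> \<open>A meridian is a conjugate of \<open>a\<close> or of its inverse; the second case
    only changes the sign of the exponent.\<close>
  have power: "\<exists>n. s = inv\<^bsub>G\<^esub> g \<otimes>\<^bsub>G\<^esub> per n 0 \<otimes>\<^bsub>G\<^esub> g"
    if "g \<in> carrier G" "b \<in> {a, inv\<^bsub>G\<^esub> a}" "s = (inv\<^bsub>G\<^esub> g \<otimes>\<^bsub>G\<^esub> b \<otimes>\<^bsub>G\<^esub> g) [^]\<^bsub>G\<^esub> (i::int)" for g b i s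
  proof -
    have "b [^]\<^bsub>G\<^esub> i = per i 0 \<or> b [^]\<^bsub>G\<^esub> i = per (- i) 0"
      using that(2) aG by (auto simp: per_def int_pow_neg int_pow_inv)
    moreover have "b \<in> carrier G" using that(2) aG by auto
    ultimately show ?thesis using int_pow_conjugate[OF that(1), of b i] that(3) by metis
  qed
  have conj_in_M: "u \<in> M" if "u \<in> U" "g \<in> carrier G" "u = g \<otimes>\<^bsub>G\<^esub> per n 0 \<otimes>\<^bsub>G\<^esub> inv\<^bsub>G\<^esub> g" for u g n
  proof -
    \<comment> \<open>The double inverse matches the shape required by \<open>meridians\<close>,
      with the inverse of \<open>g\<close> as the conjugating element.\<close>
    let ?b = "inv\<^bsub>G\<^esub> (inv\<^bsub>G\<^esub> g) \<otimes>\<^bsub>G\<^esub> a \<otimes>\<^bsub>G\<^esub> inv\<^bsub>G\<^esub> g"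
    have "u = ?b [^]\<^bsub>G\<^esub> n" using that int_pow_conjugate[of "inv\<^bsub>G\<^esub> g" a n] aG by (simp add: per_def)
    moreover have "?b \<in> meridians G a" unfolding meridians_def using that(2) by blast
    ultimately have "u \<in> ?S" unfolding meridian_powers_def using that(1) by blast
    then show ?thesis using M(2) by blast
  qed
  have Q: "Q = orbit_space Z U (egg_action G act)" using assms(17) by simp
  have subU: "subgroup U ?K" using K.subgroup_self by simp
  obtain z0 where z0: "z0 \<in> topspace Z" "z = K.orbit_proj U z0"
    using assms(18) K.topspace_orbit_space[OF subU] unfolding Q by auto
  obtain q where q: "q \<in> epi ?K (fundamental_group Q z)" "group (fundamental_group Q z)"
    "kernel ?K (fundamental_group Q z) q = M"
  proof (rule K.fundamental_group_orbit_space[OF simply_connected_egg[OF sc] M(1) z0(1), of ?S])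
    fix w assume w: "w \<in> topspace Z"
    show "\<exists>N. openin Z N \<and> w \<in> N \<and> (\<forall>u\<in>carrier ?K. egg_action G act u ` N \<inter> N \<noteq> {} \<longrightarrow> u \<in> M)"
    proof -
      obtain N where N: "openin Z N" "w \<in> N" and
        wander: "\<forall>u\<in>U. egg_action G act u ` N \<inter> N \<noteq> {} \<longrightarrow>
          (\<exists>g\<in>carrier G. \<exists>n. u = g \<otimes>\<^bsub>G\<^esub> per n 0 \<otimes>\<^bsub>G\<^esub> inv\<^bsub>G\<^esub> g)"
        using egg_neighbourhood[OF U w] by (elim exE conjE)
      have N3: "u \<in> M" if u: "u \<in> carrier ?K" and meet: "egg_action G act u ` N \<inter> N \<noteq> {}" for u
      proof -
        have uU: "u \<in> U" using u by simp
        then obtain g n where "g \<in> carrier G" "u = g \<otimes>\<^bsub>G\<^esub> per n 0 \<otimes>\<^bsub>G\<^esub> inv\<^bsub>G\<^esub> g"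
          using wander[rule_format, OF _ meet] by blast
        then show ?thesis by (rule conj_in_M[OF uU])
      qed
      show ?thesis by (intro exI[of _ N] conjI ballI impI N(1,2) N3)
    qed
    show "\<exists>N. openin Z N \<and> w \<in> N \<and> K.lifts_paths_over (carrier ?K) N"
      using egg_neighbourhood[OF U w] unfolding K_carrier by (elim exE conjE) (intro exI conjI)
  next
    fix s assume s: "s \<in> ?S"
    then obtain g b i where g: "g \<in> carrier G" "b \<in> {a, inv\<^bsub>G\<^esub> a}" "s = (inv\<^bsub>G\<^esub> g \<otimes>\<^bsub>G\<^esub> b \<otimes>\<^bsub>G\<^esub> g) [^]\<^bsub>G\<^esub> (i::int)"
      unfolding meridian_powers_def meridians_def by blast
    then obtain n where n: "s = inv\<^bsub>G\<^esub> g \<otimes>\<^bsub>G\<^esub> per n 0 \<otimes>\<^bsub>G\<^esub> inv\<^bsub>G\<^esub> (inv\<^bsub>G\<^esub> g)" using power[OF g] by auto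
    show "s \<in> carrier ?K \<and> (\<exists>z\<in>topspace Z. egg_action G act s z = z)"
      using egg_fixed_point[OF U _ _ n] g(1) s by simp
  next
    show "M \<subseteq> N" if "N \<lhd> ?K" "?S \<subseteq> N" for N using M(3) that by blast
    fix q assume "q \<in> epi ?K (fundamental_group (orbit_space Z (carrier ?K) (egg_action G act)) (K.orbit_proj (carrier ?K) z0))"
      "group (fundamental_group (orbit_space Z (carrier ?K) (egg_action G act)) (K.orbit_proj (carrier ?K) z0))"
      "kernel ?K (fundamental_group (orbit_space Z (carrier ?K) (egg_action G act)) (K.orbit_proj (carrier ?K) z0)) q = M"
    then show thesis using that[of q] z0(2) Q by simp
  qed
  have "group (G\<lparr>carrier := M\<rparr>)"
    using K.subgroup_imp_group[OF subM] by simp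
  moreover have "(\<lambda>x. x) \<in> mon (G\<lparr>carrier := M\<rparr>) ?K"
    using subgroup.subset[OF subM] by (auto simp: mon_def hom_def inj_on_def)
  ultimately have "short_exact (G\<lparr>carrier := M\<rparr>) ?K (fundamental_group Q z) (\<lambda>x. x) q"
    using q K.is_group by (simp add: short_exact_def)
  then show ?thesis by blast
qed

end
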